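(* Let $(C_n)_{n\in\mathbb{N}}$ be a sequence of copulas converging weakly to a copula $C$, and let $(k_n)_{n\in\mathbb{N}}$ be nonnegative integers with $k_n\le n$ and $k_n\to\infty$. For each $n$, let $\Pi_n$ be the random permutation generated by an i.i.d. sample $Z_{n,1},\dots,Z_{n,n}$ from $C_n$, let $T_n(\sigma)=t(\Pi_n,\sigma)$, and define the random function $W_{n,k_n}:\mathbb{S}\to\mathbb{R}$ by $W_{n,k_n}(\sigma)=\sqrt{n}\,|\sigma|^{-1}\bigl(T_n(\sigma)-C_n^{\mathbb{S}}(\sigma)\bigr)$ if $|\sigma|\le k_n$ and $W_{n,k_n}(\sigma)=0$ otherwise. Then $W_{n,k_n}$ converges in distribution, as random elements of the Hilbert space $\mathbb{H}=\ell^2(\mathbb{S},p)$, to a centered Gaussian random element $W_C=(W_C(\sigma))_{\sigma\in\mathbb{S}}$ of $\mathbb{H}$ with covariance function $\rho_C(\sigma,\tau)=C^{\mathbb{S},2}(\sigma,\tau)-C^{\mathbb{S}}(\sigma)C^{\mathbb{S}}(\tau)$, $\sigma,\tau\in\mathbb{S}$.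
   Context: $\mathbb{S}_k$ is the set of permutations of $[k]=\{1,\dots,k\}$ in one-line notation, $\mathbb{S}=\bigsqcup_{k\ge1}\mathbb{S}_k$, $|\sigma|=k$ for $\sigma\in\mathbb{S}_k$. For $\pi\in\mathbb{S}_n$, $\sigma\in\mathbb{S}_m$, $m\le n$, and $A=\{i_1<\dots<i_m\}\subset[n]$, we write $\pi(A)=\sigma$ if $\sigma(j)<\sigma(l)\iff\pi(i_j)<\pi(i_l)$ for all $j,l\in[m]$; the pattern frequency is $t(\pi,\sigma)=\#\{A\subset[n]:\#A=m,\ \pi(A)=\sigma\}/\binom{n}{m}$ if $m\le n$ and $t(\pi,\sigma)=0$ if $m>n$. For points $z_1=(u_1,v_1),\dots,z_n=(u_n,v_n)\in[0,1]^2$ without ties in either coordinate, $\Pi_n(z_1,\dots,z_n)$ is the unique $\pi\in\mathbb{S}_n$ with $u_i<u_j\iff v_{\pi(i)}<v_{\pi(j)}$; the random permutation generated by a sample is $\Pi_n$ applied to the sample. A copula is the distribution function of a probability measure on $[0,1]^2$ with uniform marginals; weak convergence of copulas refers to their measures. For a copula $C$ and independent $Z_1,Z_2,Z_2',\dots$ with distribution function $C$: $C^{\mathbb{S}}(\sigma)=\mathbb{P}(\Pi_k(Z_1,\dots,Z_k)=\sigma)$ for $\sigma\in\mathbb{S}_k$, and $C^{\mathbb{S},2}(\sigma,\tau)=\mathbb{P}(\Pi_k(Z_1,Z_2,\dots,Z_k)=\sigma,\ \Pi_j(Z_1,Z_2',\dots,Z_j')=\tau)$ for $\sigma\in\mathbb{S}_k,\tau\in\mathbb{S}_j$.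 The weights are $p_\sigma=\gamma\,|\sigma|!^{-2}2^{-|\sigma|}$ with $\gamma=e^{-1/2}(1-e^{-1/2})^{-1}$ (a probability mass function on $\mathbb{S}$), and $\mathbb{H}=\ell^2(\mathbb{S},p)$ is the Hilbert space of functions $f:\mathbb{S}\to\mathbb{R}$ with inner product $\langle f,g\rangle=\sum_{\sigma\in\mathbb{S}}p_\sigma f(\sigma)g(\sigma)$.
   Formalization: The permutation generated by a sample is taken as the rank permutation (sort points by first coordinate, list ranks of second coordinates) instead of the condition u_i<u_j iff v_{π(i)}<v_{π(j)}, which depends on the labelling and makes the claim false, e.g. for the countermonotone copula. *)

theory Defs
  imports "HOL-Probability.Probability"
begin

definition perms :: "nat \<Rightarrow> nat list set" where
  "perms k = {\<sigma>. length \<sigma> = k \<and> set \<sigma> = {1..k}}"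

definition Sall :: "nat list set" where
  "Sall = {\<sigma>. length \<sigma> \<ge> 1 \<and> \<sigma> \<in> perms (length \<sigma>)}"

text \<open>Positions of a list are 0-based; A is a set of positions i_1<...<i_m, and
  the j-th smallest element of A is  sorted_list_of_set A ! j.\<close>
definition pattern_at :: "nat list \<Rightarrow> nat set \<Rightarrow> nat list \<Rightarrow> bool" where
  "pattern_at \<pi> A \<sigma> \<longleftrightarrow>
     (\<forall>j < length \<sigma>. \<forall>l < length \<sigma>.
        (\<sigma> ! j < \<sigma> ! l) \<longleftrightarrow>
        (\<pi> ! (sorted_list_of_set A ! j) < \<pi> ! (sorted_list_of_set A ! l)))"

definition pfreq :: "nat list \<Rightarrow> nat list \<Rightarrow> real" where
  "pfreq \<pi> \<sigma> =
     (if length \<sigma> \<le> length \<pi> then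
        real (card {A. A \<subseteq> {..<length \<pi>} \<and> card A = length \<sigma> \<and> pattern_at \<pi> A \<sigma>})
        / real (length \<pi> choose length \<sigma>)
      else 0)"

definition no_ties :: "nat \<Rightarrow> (nat \<Rightarrow> real \<times> real) \<Rightarrow> bool" where
  "no_ties n z \<longleftrightarrow> inj_on (\<lambda>i. fst (z i)) {..<n} \<and> inj_on (\<lambda>i. snd (z i)) {..<n}"

definition sample_perm :: "nat \<Rightarrow> (nat \<Rightarrow> real \<times> real) \<Rightarrow> nat list" where
  "sample_perm n z =
     map (\<lambda>i. card {j. j < n \<and> snd (z j) \<le> snd (z i)}) (sort_key (\<lambda>i. fst (z i)) [0..<n])"

section \<open>Copulas (as probability measures on the unit square)\<close>

definition copula :: "(real \<times> real) measure \<Rightarrow> bool" where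
  "copula \<mu> \<longleftrightarrow> prob_space \<mu> \<and> sets \<mu> = sets borel \<and>
     (\<forall>x\<in>{0..1}. measure \<mu> {z. fst z \<le> x} = x \<and> measure \<mu> {z. snd z \<le> x} = x)"

definition weak_conv2 :: "(nat \<Rightarrow> (real \<times> real) measure) \<Rightarrow> (real \<times> real) measure \<Rightarrow> bool" where
  "weak_conv2 \<mu> \<nu> \<longleftrightarrow>
     (\<forall>f :: real \<times> real \<Rightarrow> real. continuous_on UNIV f \<and> bounded (range f) \<longrightarrow>
        (\<lambda>n. \<integral>x. f x \<partial>\<mu> n) \<longlonglongrightarrow> (\<integral>x. f x \<partial>\<nu>))"

definition CS :: "(real \<times> real) measure \<Rightarrow> nat list \<Rightarrow> real" where
  "CS \<mu> \<sigma> = measure (PiM {..<length \<sigma>} (\<lambda>_. \<mu>))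
     {z \<in> space (PiM {..<length \<sigma>} (\<lambda>_. \<mu>)).
        no_ties (length \<sigma>) z \<and> sample_perm (length \<sigma>) z = \<sigma>}"

text \<open>C^{S,2}(sigma,tau): indices 0..k-1 are Z_1..Z_k, indices k..k+j-2 are Z'_2..Z'_j;
  the second sample is Z_1, Z'_2, ..., Z'_j.\<close>
definition second_sample :: "nat \<Rightarrow> (nat \<Rightarrow> real \<times> real) \<Rightarrow> nat \<Rightarrow> real \<times> real" where
  "second_sample k z = (\<lambda>i. if i = 0 then z 0 else z (k + i - 1))"

definition CS2 :: "(real \<times> real) measure \<Rightarrow> nat list \<Rightarrow> nat list \<Rightarrow> real" where
  "CS2 \<mu> \<sigma> \<tau> =
     (let k = length \<sigma>; j = length \<tau>; P = PiM {..<k + j - 1} (\<lambda>_. \<mu>) in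
      measure P {z \<in> space P. no_ties k z \<and> sample_perm k z = \<sigma> \<and>
                  no_ties j (second_sample k z) \<and> sample_perm j (second_sample k z) = \<tau>})"

definition rho :: "(real \<times> real) measure \<Rightarrow> nat list \<Rightarrow> nat list \<Rightarrow> real" where
  "rho \<mu> \<sigma> \<tau> = CS2 \<mu> \<sigma> \<tau> - CS \<mu> \<sigma> * CS \<mu> \<tau>"

definition gamma_const :: real where
  "gamma_const = exp (-1/2) / (1 - exp (-1/2))"

definition pw :: "nat list \<Rightarrow> real" where
  "pw \<sigma> = gamma_const / (fact (length \<sigma>) ^ 2 * 2 ^ length \<sigma>)"

definition Hsp :: "(nat list \<Rightarrow> real) set" where
  "Hsp = {f. (\<lambda>\<sigma>. pw \<sigma> * (f \<sigma>)^2) summable_on Sall}"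

definition hinner :: "(nat list \<Rightarrow> real) \<Rightarrow> (nat list \<Rightarrow> real) \<Rightarrow> real" where
  "hinner f g = (\<Sum>\<^sub>\<infinity>\<sigma>\<in>Sall. pw \<sigma> * f \<sigma> * g \<sigma>)"

definition hnorm :: "(nat list \<Rightarrow> real) \<Rightarrow> real" where
  "hnorm f = sqrt (\<Sum>\<^sub>\<infinity>\<sigma>\<in>Sall. pw \<sigma> * (f \<sigma>)^2)"

definition bcont_H :: "((nat list \<Rightarrow> real) \<Rightarrow> real) \<Rightarrow> bool" where
  "bcont_H g \<longleftrightarrow> (\<exists>B. \<forall>f\<in>Hsp. \<bar>g f\<bar> \<le> B) \<and>
     (\<forall>f\<in>Hsp. \<forall>e>0. \<exists>d>0. \<forall>f'\<in>Hsp. hnorm (\<lambda>\<sigma>. f' \<sigma> - f \<sigma>) < d \<longrightarrow> \<bar>g f' - g f\<bar> < e)"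

definition centered_gaussian_rv :: "'a measure \<Rightarrow> ('a \<Rightarrow> real) \<Rightarrow> bool" where
  "centered_gaussian_rv M X \<longleftrightarrow> X \<in> borel_measurable M \<and>
     (\<exists>v\<ge>0. \<forall>t. char (distr M borel X) t = exp (- complex_of_real (v * t^2 / 2)))"

definition centered_gaussian_H :: "'a measure \<Rightarrow> ('a \<Rightarrow> nat list \<Rightarrow> real) \<Rightarrow> bool" where
  "centered_gaussian_H M W \<longleftrightarrow> prob_space M \<and>
     (\<forall>\<omega>\<in>space M. W \<omega> \<in> Hsp) \<and>
     (\<forall>\<sigma>\<in>Sall. (\<lambda>\<omega>. W \<omega> \<sigma>) \<in> borel_measurable M) \<and>
     (\<forall>h\<in>Hsp. centered_gaussian_rv M (\<lambda>\<omega>. hinner (W \<omega>) h))"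

text \<open>Value of W_{n,k} when Pi_n = pi (mu is the copula measure C_n).\<close>
definition Wnk :: "(real \<times> real) measure \<Rightarrow> nat \<Rightarrow> nat \<Rightarrow> nat list \<Rightarrow> nat list \<Rightarrow> real" where
  "Wnk \<mu> k n \<pi> \<sigma> =
     (if \<sigma> \<in> Sall \<and> length \<sigma> \<le> k
      then sqrt (real n) / real (length \<sigma>) * (pfreq \<pi> \<sigma> - CS \<mu> \<sigma>) else 0)"

end

theory Submission
  imports Defs "HOL-Combinatorics.Multiset_Permutations"
begin

text \<open>
  Up to the a.s. absence of ties, \<open>t(\<Pi>\<^sub>n, \<sigma>)\<close> is a U-statistic: the average of the indicators
  \<open>pind \<sigma> A\<close> that the points with indices in \<open>A\<close> form the pattern \<open>\<sigma>\<close>. Averages over \<open>k\<close>-subsets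
  of quantities that are uncorrelated for subsets sharing fewer than \<open>r\<close> indices have second moments of order
  \<open>n\<^sup>-\<^sup>r\<close>; with \<open>r = 1\<close> this bounds all second moments of \<open>W\<^sub>n\<close> by 1, with \<open>r = 2\<close> it shows that \<open>W\<^sub>n(\<sigma>)\<close>
  is asymptotically the normalised sum of \<open>m1 \<sigma> (Z\<^sub>i)\<close>, where \<open>m1 \<sigma>\<close> is the centred conditional
  pattern probability given one point. The covariances of the \<open>m1 \<sigma>\<close> are \<open>\<rho>\<close>, and they are continuous in
  the copula because patterns can be read off a fine grid except on an event whose probability
  depends only on the uniform marginals. This gives the convergence of the characteristic functions of all finite
  linear combinations. The second moment bound puts \<open>W\<^sub>n\<close> with high probability into a box that is
  compact in the Hilbert space. On such a box a bounded continuous function is approximated by a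
  trigonometric polynomial, and the polynomial can be chosen to be bounded outside the box as well.
\<close>

section \<open>Patterns in samples\<close>

text \<open>The sampling law changes with \<open>n\<close>, so no limit theorem for one fixed law
  applies. Every error term (grid ties, ramps, projection remainder, characteristic functions) is
  bounded explicitly in terms of the uniform marginals, \<open>n\<close> and the patterns involved,
  and weak convergence enters only through finitely many cell probabilities. Division by the pattern
  length turns the variance bound \<open>k^2 / n\<close> into one that is uniform over all patterns.
  This leaves room for boxes with squared radius \<open>A^2 * k! * (3/2)^k\<close> at length
  \<open>k\<close>: as there are \<open>k!\<close> patterns of length \<open>k\<close>, the weighted
  squared radii and the Chebyshev bounds for leaving the box both sum to geometric series, of ratio
  3/4 and 2/3. A trigonometric polynomial that is close to the functional on the box alone could be
  huge elsewhere; folding with \<open>arcsin (sin u)\<close>, a bounded function equal to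
  \<open>u\<close> near 0, makes the approximation global. The Gaussian element comes from
  independent normals through a triangular factorisation, so each coordinate is a finite sum and
  only square summability over all patterns needs an almost sure argument.\<close>

definition pat :: "nat list \<Rightarrow> nat set \<Rightarrow> (nat \<Rightarrow> real \<times> real) \<Rightarrow> bool" where
  "pat \<sigma> A z \<longleftrightarrow> (\<exists>l. distinct l \<and> set l = A \<and> length l = length \<sigma> \<and>
     sorted_wrt (\<lambda>a b. fst (z a) < fst (z b)) l \<and>
     (\<forall>i<length \<sigma>. \<forall>j<length \<sigma>. \<sigma> ! i < \<sigma> ! j \<longleftrightarrow> snd (z (l ! i)) < snd (z (l ! j))))"

lemma permsD: "\<sigma> \<in> perms k \<Longrightarrow> length \<sigma> = k \<and> set \<sigma> = {1..k} \<and> distinct \<sigma>"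
  unfolding perms_def by (auto intro!: card_distinct)

lemma Sall_perms: "\<sigma> \<in> Sall \<Longrightarrow> \<sigma> \<in> perms (length \<sigma>)"
  by (simp add: Sall_def)

lemma strictly_sorted_key_unique:
  fixes f :: "'a \<Rightarrow> 'b::linorder"
  assumes "sorted_wrt (\<lambda>a b. f a < f b) l" "sorted_wrt (\<lambda>a b. f a < f b) l'" "set l = set l'"
  shows "l = l'"
proof -
  have "map f l = map f l'"
    by (rule strict_sorted_equal) (use assms in \<open>auto simp: sorted_wrt_map\<close>)
  moreover have "distinct (map f l)"
    using assms(1) by (simp add: strict_sorted_iff flip: sorted_wrt_map)
  then have "inj_on f (set l)"
    by (simp add: distinct_map)
  ultimately show ?thesis
    using assms(3) by (simp add: map_inj_on)
qed

lemma strictly_sorted_sort_key: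
  fixes f :: "'a \<Rightarrow> 'b::linorder"
  assumes "inj_on f (set xs)" "distinct xs"
  shows "sorted_wrt (\<lambda>a b. f a < f b) (sort_key f xs)"
proof -
  have "sorted_wrt (<) (map f (sort_key f xs))"
    using assms by (auto simp: strict_sorted_iff distinct_map)
  then show ?thesis by (simp add: sorted_wrt_map)
qed

lemma rank_less_iff:
  fixes f :: "'a \<Rightarrow> 'b::linorder"
  assumes "finite A" "a \<in> A" "b \<in> A"
  shows "card {c \<in> A. f c \<le> f a} < card {c \<in> A. f c \<le> f b} \<longleftrightarrow> f a < f b"
proof
  assume "f a < f b"
  then show "card {c \<in> A. f c \<le> f a} < card {c \<in> A. f c \<le> f b}"
    using assms by (intro psubset_card_mono) (auto dest: order.trans less_le_not_le[THEN iffD1])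
next
  assume *: "card {c \<in> A. f c \<le> f a} < card {c \<in> A. f c \<le> f b}"
  show "f a < f b"
  proof (rule ccontr)
    assume "\<not> f a < f b"
    then have "card {c \<in> A. f c \<le> f b} \<le> card {c \<in> A. f c \<le> f a}"
      using assms by (intro card_mono) auto
    with * show False by simp
  qed
qed

text \<open>A permutation is thereby recovered from the order comparisons between its entries;
  \<open>pat_sample_perm\<close> uses this to pass from equal orders to equal lists.\<close>

lemma perms_rank:
  assumes "\<sigma> \<in> perms k" "i < k"
  shows "card {j \<in> {..<k}. \<sigma> ! j \<le> \<sigma> ! i} = \<sigma> ! i"
proof -
  note \<sigma> = permsD[OF assms(1)]
  have "bij_betw ((!) \<sigma>) {j \<in> {..<k}. \<sigma> ! j \<le> \<sigma> ! i} {1..\<sigma> ! i}"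
  proof (rule bij_betw_imageI)
    show "inj_on ((!) \<sigma>) {j \<in> {..<k}. \<sigma> ! j \<le> \<sigma> ! i}"
      using \<sigma> by (auto simp: inj_on_def nth_eq_iff_index_eq)
    have "\<sigma> ! i \<in> {1..k}"
      using \<sigma> assms(2) nth_mem by metis
    show "(!) \<sigma> ` {j \<in> {..<k}. \<sigma> ! j \<le> \<sigma> ! i} = {1..\<sigma> ! i}"
    proof (intro equalityI subsetI)
      fix x assume "x \<in> {1..\<sigma> ! i}"
      then have "x \<in> set \<sigma>" using \<sigma> \<open>\<sigma> ! i \<in> {1..k}\<close> by auto
      then obtain j where "j < k" "\<sigma> ! j = x" using \<sigma> by (metis in_set_conv_nth)
      with \<open>x \<in> {1..\<sigma> ! i}\<close> show "x \<in> (!) \<sigma> ` {j \<in> {..<k}. \<sigma> ! j \<le> \<sigma> ! i}" by auto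
    next
      fix x assume "x \<in> (!) \<sigma> ` {j \<in> {..<k}. \<sigma> ! j \<le> \<sigma> ! i}"
      then obtain j where j: "j < k" "\<sigma> ! j \<le> \<sigma> ! i" "x = \<sigma> ! j" by auto
      then have "\<sigma> ! j \<in> {1..k}" using \<sigma> nth_mem by metis
      with j show "x \<in> {1..\<sigma> ! i}" by auto
    qed
  qed
  then show ?thesis by (simp add: bij_betw_same_card)
qed

text \<open>Only comparisons of coordinates enter \<open>pat\<close>. This is what permits moving
  the points to a grid as long as no comparison changes.\<close>

lemma pat_cong_order:
  assumes "\<And>a b. a \<in> A \<Longrightarrow> b \<in> A \<Longrightarrow> fst (z a) < fst (z b) \<longleftrightarrow> fst (z' a) < fst (z' b)"
    "\<And>a b. a \<in> A \<Longrightarrow> b \<in> A \<Longrightarrow> snd (z a) < snd (z b) \<longleftrightarrow> snd (z' a) < snd (z' b)"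
  shows "pat \<sigma> A z \<longleftrightarrow> pat \<sigma> A z'"
proof -
  have 1: "sorted_wrt (\<lambda>a b. fst (z a) < fst (z b)) l \<longleftrightarrow> sorted_wrt (\<lambda>a b. fst (z' a) < fst (z' b)) l"
    if "set l = A" for l
    using assms(1) that by (auto simp: sorted_wrt_iff_nth_less)
  have 2: "snd (z (l ! i)) < snd (z (l ! j)) \<longleftrightarrow> snd (z' (l ! i)) < snd (z' (l ! j))"
    if "set l = A" "length l = length \<sigma>" "i < length \<sigma>" "j < length \<sigma>" for l i j
    using assms(2) that by (metis nth_mem)
  show ?thesis
    unfolding pat_def using 1 2 by (intro ex_cong1) auto
qed

lemma pat_cong: "(\<And>a. a \<in> A \<Longrightarrow> z a = z' a) \<Longrightarrow> pat \<sigma> A z \<longleftrightarrow> pat \<sigma> A z'"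
  by (rule pat_cong_order) auto

text \<open>\<open>pat\<close> asks for some enumeration of \<open>A\<close> by increasing first
  coordinate and never looks at the order of the indices, so relabelling carries enumerations to
  enumerations. For iid points this is the exchangeability behind every reduction to the index set
  \<open>{..<k}\<close>.\<close>

lemma pat_reindex:
  assumes "inj_on e A"
  shows "pat \<sigma> A (\<lambda>i. z (e i)) \<longleftrightarrow> pat \<sigma> (e ` A) z"
proof
  assume "pat \<sigma> A (\<lambda>i. z (e i))"
  then obtain l where l: "distinct l" "set l = A" "length l = length \<sigma>"
     "sorted_wrt (\<lambda>a b. fst (z (e a)) < fst (z (e b))) l"
     "\<forall>i<length \<sigma>. \<forall>j<length \<sigma>. \<sigma> ! i < \<sigma> ! j \<longleftrightarrow> snd (z (e (l ! i))) < snd (z (e (l ! j)))"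
    unfolding pat_def by auto
  then show "pat \<sigma> (e ` A) z"
    unfolding pat_def using assms
    by (intro exI[of _ "map e l"]) (auto simp: distinct_map sorted_wrt_map)
next
  assume "pat \<sigma> (e ` A) z"
  then obtain l where l: "distinct l" "set l = e ` A" "length l = length \<sigma>"
     "sorted_wrt (\<lambda>a b. fst (z a) < fst (z b)) l"
     "\<forall>i<length \<sigma>. \<forall>j<length \<sigma>. \<sigma> ! i < \<sigma> ! j \<longleftrightarrow> snd (z (l ! i)) < snd (z (l ! j))"
    unfolding pat_def by auto
  define l' where "l' = map (inv_into A e) l"
  have 1: "map e l' = l" unfolding l'_def using l(2)
    by (auto intro!: map_idI simp: f_inv_into_f)
  have 2: "set l' = A" unfolding l'_def using l(2) assms by auto
  have 3: "e (l' ! i) = l ! i" if "i < length \<sigma>" for i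
    using that 1 l(3) by (metis length_map nth_map)
  have 4: "distinct l'" using l(1) 1 by (metis distinct_map)
  have 5: "sorted_wrt (\<lambda>a b. fst (z (e a)) < fst (z (e b))) l'"
    using l(4) unfolding 1[symmetric] sorted_wrt_map .
  have 6: "length l' = length \<sigma>" using l(3) by (simp add: l'_def)
  have 7: "\<forall>i<length \<sigma>. \<forall>j<length \<sigma>. \<sigma> ! i < \<sigma> ! j \<longleftrightarrow> snd (z (e (l' ! i))) < snd (z (e (l' ! j)))"
  proof (intro allI impI)
    fix i j assume ij: "i < length \<sigma>" "j < length \<sigma>"
    then have "\<sigma> ! i < \<sigma> ! j \<longleftrightarrow> snd (z (l ! i)) < snd (z (l ! j))" using l(5) by blast
    then show "\<sigma> ! i < \<sigma> ! j \<longleftrightarrow> snd (z (e (l' ! i))) < snd (z (e (l' ! j)))"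
      by (simp only: 3[OF ij(1)] 3[OF ij(2)])
  qed
  show "pat \<sigma> A (\<lambda>i. z (e i))"
    unfolding pat_def by (rule exI[of _ l']) (intro conjI 2 4 5 6 7)
qed

lemma pat_card:
  assumes "pat \<sigma> A z"
  shows "card A = length \<sigma>" "finite A"
  using assms unfolding pat_def by (auto simp: distinct_card)

text \<open>A tie in the second coordinate would make two entries of \<sigma> incomparable under
  \<open><\<close>, hence equal, which a permutation excludes; the first coordinates increase
  strictly. So tied points never form a pattern.\<close>

lemma pat_inj:
  assumes "\<sigma> \<in> perms k" "pat \<sigma> A z"
  shows "inj_on (\<lambda>i. fst (z i)) A" "inj_on (\<lambda>i. snd (z i)) A"
proof -
  note \<sigma> = permsD[OF assms(1)]
  obtain l where l: "distinct l" "set l = A" "length l = length \<sigma>"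
     "sorted_wrt (\<lambda>a b. fst (z a) < fst (z b)) l"
     "\<forall>i<length \<sigma>. \<forall>j<length \<sigma>. \<sigma> ! i < \<sigma> ! j \<longleftrightarrow> snd (z (l ! i)) < snd (z (l ! j))"
    using assms(2) unfolding pat_def by auto
  have "sorted_wrt (<) (map (\<lambda>a. fst (z a)) l)"
    using l(4) by (simp add: sorted_wrt_map)
  then show "inj_on (\<lambda>i. fst (z i)) A"
    unfolding strict_sorted_iff distinct_map l(2) by simp
  show "inj_on (\<lambda>i. snd (z i)) A"
  proof (rule inj_onI)
    fix a b assume ab: "a \<in> A" "b \<in> A" "snd (z a) = snd (z b)"
    then obtain i j where ij: "i < length \<sigma>" "j < length \<sigma>" "a = l ! i" "b = l ! j"
      using l(2,3) by (metis in_set_conv_nth)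
    then have "\<sigma> ! i = \<sigma> ! j"
      using l(5) ab by (metis less_irrefl linorder_neqE_nat)
    then show "a = b"
      using \<sigma> ij by (simp add: nth_eq_iff_index_eq)
  qed
qed

lemma pat_iff_sorted:
  assumes "sorted_wrt (\<lambda>a b. fst (z a) < fst (z b)) l" "set l = A" "length l = length \<sigma>" "distinct l"
  shows "pat \<sigma> A z \<longleftrightarrow>
    (\<forall>i<length \<sigma>. \<forall>j<length \<sigma>. \<sigma> ! i < \<sigma> ! j \<longleftrightarrow> snd (z (l ! i)) < snd (z (l ! j)))"
proof
  assume "pat \<sigma> A z"
  then obtain l' where l': "set l' = A" 
     "sorted_wrt (\<lambda>a b. fst (z a) < fst (z b)) l'"
     "\<forall>i<length \<sigma>. \<forall>j<length \<sigma>. \<sigma> ! i < \<sigma> ! j \<longleftrightarrow> snd (z (l' ! i)) < snd (z (l' ! j))"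
    unfolding pat_def by auto
  have "l' = l"
    by (rule strictly_sorted_key_unique[OF l'(2) assms(1)]) (use assms l' in auto)
  with l' show "\<forall>i<length \<sigma>. \<forall>j<length \<sigma>. \<sigma> ! i < \<sigma> ! j \<longleftrightarrow> snd (z (l ! i)) < snd (z (l ! j))" by simp
next
  assume "\<forall>i<length \<sigma>. \<forall>j<length \<sigma>. \<sigma> ! i < \<sigma> ! j \<longleftrightarrow> snd (z (l ! i)) < snd (z (l ! j))"
  then show "pat \<sigma> A z"
    unfolding pat_def using assms by blast
qed

lemma length_sample_perm [simp]: "length (sample_perm n z) = n"
  by (simp add: sample_perm_def)

lemma sample_perm_nth_less_iff:
  assumes "p < n" "q < n"
  shows "sample_perm n z ! p < sample_perm n z ! q \<longleftrightarrow>
    snd (z (sort_key (\<lambda>i. fst (z i)) [0..<n] ! p)) < snd (z (sort_key (\<lambda>i. fst (z i)) [0..<n] ! q))"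
proof -
  let ?s = "sort_key (\<lambda>i. fst (z i)) [0..<n]"
  have len: "length ?s = n" by simp
  have mem: "?s ! r < n" if "r < n" for r
    using nth_mem[of r ?s] that by simp
  show ?thesis
    unfolding sample_perm_def using assms mem
      rank_less_iff[of "{..<n}" "?s ! p" "?s ! q" "\<lambda>i. snd (z i)"]
    by simp
qed

text \<open>With ties both sides are false. Without ties the only possible enumeration is the list
  sorted by first coordinate, and along it the second coordinates are ordered like the entries of
  \<open>sample_perm\<close>.\<close>

lemma pat_sample_perm:
  assumes "\<sigma> \<in> perms k"
  shows "pat \<sigma> {..<k} z \<longleftrightarrow> no_ties k z \<and> sample_perm k z = \<sigma>"
proof (cases "no_ties k z")
  case False
  then show ?thesis
    using pat_inj[OF assms, of "{..<k}" z] by (auto simp: no_ties_def)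
next
  case True
  note \<sigma> = permsD[OF assms]
  let ?s = "sort_key (\<lambda>i. fst (z i)) [0..<k]"
  have s: "sorted_wrt (\<lambda>a b. fst (z a) < fst (z b)) ?s" "set ?s = {..<k}" "length ?s = length \<sigma>" "distinct ?s"
    using True \<sigma> by (auto intro!: strictly_sorted_sort_key simp: no_ties_def atLeast0LessThan)
  have mem: "?s ! r < k" if "r < k" for r
    using nth_mem[of r ?s] that by simp
  have bij: "bij_betw ((!) ?s) {..<k} {..<k}"
    using s \<sigma> by (intro bij_betw_nth) auto
  have "pat \<sigma> {..<k} z \<longleftrightarrow> (\<forall>i<k. \<forall>j<k. \<sigma> ! i < \<sigma> ! j \<longleftrightarrow> sample_perm k z ! i < sample_perm k z ! j)"
    using \<sigma> by (simp add: pat_iff_sorted[OF s] sample_perm_nth_less_iff)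
  also have "\<dots> \<longleftrightarrow> sample_perm k z = \<sigma>"
  proof
    assume *: "\<forall>i<k. \<forall>j<k. \<sigma> ! i < \<sigma> ! j \<longleftrightarrow> sample_perm k z ! i < sample_perm k z ! j"
    show "sample_perm k z = \<sigma>"
    proof (rule nth_equalityI)
      fix i assume "i < length (sample_perm k z)"
      then have i: "i < k" by simp
      \<comment> \<open>The rank counts sample indices; the sorted list is a bijection that turns
        this into a count of positions, where the order agrees with that of \<sigma>.\<close>
      have "sample_perm k z ! i = card {j \<in> {..<k}. snd (z j) \<le> snd (z (?s ! i))}"
        unfolding sample_perm_def using i by (simp add: conj_commute)
      also have "\<dots> = card {j \<in> {..<k}. snd (z (?s ! j)) \<le> snd (z (?s ! i))}"
      proof -
        have "bij_betw ((!) ?s) {j \<in> {..<k}. snd (z (?s ! j)) \<le> snd (z (?s ! i))}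
            {j \<in> {..<k}. snd (z j) \<le> snd (z (?s ! i))}"
          using bij by (auto simp: bij_betw_def inj_on_def image_iff set_eq_iff) (metis lessThan_iff mem)
        then show ?thesis by (simp add: bij_betw_same_card)
      qed
      also have "\<dots> = card {j \<in> {..<k}. \<sigma> ! j \<le> \<sigma> ! i}"
        using * i by (intro arg_cong[where f=card] Collect_cong)
          (auto simp: sample_perm_nth_less_iff simp flip: not_less)
      also have "\<dots> = \<sigma> ! i" by (rule perms_rank[OF assms i])
      finally show "sample_perm k z ! i = \<sigma> ! i" .
    qed (use \<sigma> in simp)
  qed auto
  finally show ?thesis using True by simp
qed

text \<open>\<open>pattern_at\<close> addresses points by their rank in the first coordinate,
  \<open>pat\<close> by their sample index. The sorted list \<open>?s\<close> is a bijection between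
  the two and maps the counted sets onto each other.\<close>

lemma pfreq_sample_perm:
  assumes nt: "no_ties n z" and \<sigma>: "\<sigma> \<in> perms k" and "k \<le> n"
  shows "pfreq (sample_perm n z) \<sigma> =
    real (card {B. B \<subseteq> {..<n} \<and> card B = k \<and> pat \<sigma> B z}) / real (n choose k)"
proof -
  let ?s = "sort_key (\<lambda>i. fst (z i)) [0..<n]"
  note \<sigma>' = permsD[OF \<sigma>]
  have s: "sorted_wrt (\<lambda>a b. fst (z a) < fst (z b)) ?s" "set ?s = {..<n}" "length ?s = n" "distinct ?s"
    using nt by (auto intro!: strictly_sorted_sort_key simp: no_ties_def atLeast0LessThan)
  have bij: "bij_betw ((!) ?s) {..<n} {..<n}"
    using s by (intro bij_betw_nth) auto
  then have inj: "inj_on ((!) ?s) {..<n}" by (simp add: bij_betw_def)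
  have eq: "pattern_at (sample_perm n z) A \<sigma> \<longleftrightarrow> pat \<sigma> ((!) ?s ` A) z"
    if A: "A \<subseteq> {..<n}" "card A = k" for A
  proof -
    have finA: "finite A" using A(1) finite_subset by blast
    define a where "a = sorted_list_of_set A"
    have a: "sorted_wrt (<) a" "set a = A" "length a = k" "distinct a"
      unfolding a_def using A finA by auto
    have an: "a ! i < n" if "i < k" for i
      using a that A(1) by (metis lessThan_iff nth_mem subsetD)
    \<comment> \<open>Positions increase along \<open>a\<close> and \<open>?s\<close> is sorted by
      first coordinate, so \<open>l\<close> is the enumeration that \<open>pat\<close> asks
      for.\<close>
    define l where "l = map ((!) ?s) a"
    have l: "sorted_wrt (\<lambda>a b. fst (z a) < fst (z b)) l" "set l = (!) ?s ` A" "length l = length \<sigma>" "distinct l"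
    proof -
      show "sorted_wrt (\<lambda>a b. fst (z a) < fst (z b)) l"
        unfolding sorted_wrt_iff_nth_less
      proof (intro allI impI)
        fix i j assume ij: "i < j" "j < length l"
        then have "a ! i < a ! j" "a ! j < n" "j < k"
          using a(1) an a(3) by (auto simp: l_def sorted_wrt_iff_nth_less)
        then have "fst (z (?s ! (a ! i))) < fst (z (?s ! (a ! j)))"
          using s(1) s(3) unfolding sorted_wrt_iff_nth_less by auto
        then show "fst (z (l ! i)) < fst (z (l ! j))"
          using ij by (simp add: l_def a(3))
      qed
      show "set l = (!) ?s ` A" "length l = length \<sigma>" using a \<sigma>' by (auto simp: l_def)
      show "distinct l" unfolding l_def distinct_map using a inj A(1) by (auto intro: inj_on_subset)
    qed
    show ?thesis
      unfolding pat_iff_sorted[OF l] pattern_at_def a_def[symmetric]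
      using \<sigma>' a an by (simp add: l_def sample_perm_nth_less_iff)
  qed
  have "bij_betw ((`) ((!) ?s)) {A. A \<subseteq> {..<n} \<and> card A = k \<and> pattern_at (sample_perm n z) A \<sigma>}
      {B. B \<subseteq> {..<n} \<and> card B = k \<and> pat \<sigma> B z}"
  proof (rule bij_betw_imageI)
    show "inj_on ((`) ((!) ?s)) {A. A \<subseteq> {..<n} \<and> card A = k \<and> pattern_at (sample_perm n z) A \<sigma>}"
      using inj by (auto simp: inj_on_def inj_on_image_eq_iff[OF inj])
    have cardimg: "card ((!) ?s ` A) = card A" if "A \<subseteq> {..<n}" for A
      using inj that by (intro card_image) (auto intro: inj_on_subset)
    show "(`) ((!) ?s) ` {A. A \<subseteq> {..<n} \<and> card A = k \<and> pattern_at (sample_perm n z) A \<sigma>} =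
        {B. B \<subseteq> {..<n} \<and> card B = k \<and> pat \<sigma> B z}" (is "?L = ?R")
    proof (intro equalityI subsetI)
      fix B assume B: "B \<in> ?R"
      then obtain A where A: "A \<subseteq> {..<n}" "B = (!) ?s ` A"
        using bij subset_imageE[of B "(!) ?s" "{..<n}"] unfolding bij_betw_def by auto
      then have "A \<in> {A. A \<subseteq> {..<n} \<and> card A = k \<and> pattern_at (sample_perm n z) A \<sigma>}"
        using B eq[of A] cardimg[of A] by auto
      then show "B \<in> ?L" using A(2) by (rule rev_image_eqI)
    next
      fix B assume "B \<in> ?L"
      then obtain A where A: "A \<subseteq> {..<n}" "card A = k" "pattern_at (sample_perm n z) A \<sigma>" "B = (!) ?s ` A"
        by auto
      have "B \<subseteq> {..<n}" using A(1,4) bij by (auto simp: bij_betw_def)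
      then show "B \<in> ?R"
        using A eq[of A] cardimg[of A] by auto
    qed
  qed
  then show ?thesis
    unfolding pfreq_def using \<sigma>' assms by (simp add: bij_betw_same_card)
qed

lemma insort_key_cong:
  assumes "\<And>y. y \<in> set xs \<Longrightarrow> f x \<le> f y \<longleftrightarrow> g x \<le> g y"
  shows "insort_key f x xs = insort_key g x xs"
  using assms by (induction xs) auto

lemma sort_key_cong_order:
  assumes "\<And>x y. x \<in> set xs \<Longrightarrow> y \<in> set xs \<Longrightarrow> f x \<le> f y \<longleftrightarrow> g x \<le> g y"
  shows "sort_key f xs = sort_key g xs"
  using assms
proof (induction xs)
  case (Cons x xs)
  then have "sort_key f xs = sort_key g xs" by auto
  then show ?case
    using Cons.prems by (auto intro!: insort_key_cong)
qed simp

text \<open>Sorting and ranking use comparisons only, also when there are ties. Hence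
  \<open>sample_perm\<close> factors through finitely many comparisons, which gives its
  measurability and its dependence on the first \<open>n\<close> points.\<close>

lemma sample_perm_cong_order:
  assumes "\<And>a b. a < n \<Longrightarrow> b < n \<Longrightarrow> fst (z a) \<le> fst (z b) \<longleftrightarrow> fst (z' a) \<le> fst (z' b)"
    "\<And>a b. a < n \<Longrightarrow> b < n \<Longrightarrow> snd (z a) \<le> snd (z b) \<longleftrightarrow> snd (z' a) \<le> snd (z' b)"
  shows "sample_perm n z = sample_perm n z'"
proof -
  have "sort_key (\<lambda>i. fst (z i)) [0..<n] = sort_key (\<lambda>i. fst (z' i)) [0..<n]"
    by (rule sort_key_cong_order) (use assms(1) in auto)
  then show ?thesis
    unfolding sample_perm_def
    by (auto intro!: map_cong arg_cong[where f=card] simp: assms(2))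
qed

section \<open>Infinite product measures\<close>

text \<open>A pointwise substitute for measurability with respect to the coordinates in
  \<open>A\<close>. It behaves well under fixing a coordinate, which simply removes that index from
  \<open>A\<close>.\<close>

definition depends_on :: "((nat \<Rightarrow> 'a) \<Rightarrow> 'b) \<Rightarrow> nat set \<Rightarrow> bool" where
  "depends_on f A \<longleftrightarrow> (\<forall>z z'. (\<forall>i\<in>A. z i = z' i) \<longrightarrow> f z = f z')"

lemma depends_onD: "depends_on f A \<Longrightarrow> (\<And>i. i \<in> A \<Longrightarrow> z i = z' i) \<Longrightarrow> f z = f z'"
  by (auto simp: depends_on_def)

lemma depends_on_mono: "depends_on f A \<Longrightarrow> A \<subseteq> B \<Longrightarrow> depends_on f B"
  by (auto simp: depends_on_def)

lemma depends_on_update: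
  "depends_on f A \<Longrightarrow> depends_on (\<lambda>z. f (z(i := x))) (A - {i})"
  unfolding depends_on_def by (metis Diff_iff fun_upd_apply singletonD)

text \<open>The bound is required at every point rather than almost surely, so that it survives the
  substitution of a fixed value for a coordinate.\<close>

definition bdd_meas :: "'b measure \<Rightarrow> ('b \<Rightarrow> real) \<Rightarrow> bool" where
  "bdd_meas M f \<longleftrightarrow> f \<in> borel_measurable M \<and> (\<exists>c. \<forall>z. \<bar>f z\<bar> \<le> c)"

lemma bdd_measI: "f \<in> borel_measurable M \<Longrightarrow> (\<And>z. \<bar>f z\<bar> \<le> c) \<Longrightarrow> bdd_meas M f"
  by (auto simp: bdd_meas_def)

lemma bdd_meas_measurable: "bdd_meas M f \<Longrightarrow> f \<in> borel_measurable M"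
  by (auto simp: bdd_meas_def)

lemma bdd_meas_const [simp, intro]: "bdd_meas M (\<lambda>_. c)"
  by (rule bdd_measI[of _ _ "\<bar>c\<bar>"]) auto

lemma bdd_meas_mult [intro]:
  assumes "bdd_meas M f" "bdd_meas M g" shows "bdd_meas M (\<lambda>z. f z * g z)"
proof -
  from assms obtain c d where "\<And>z. \<bar>f z\<bar> \<le> c" "\<And>z. \<bar>g z\<bar> \<le> d"
    by (auto simp: bdd_meas_def)
  moreover have "0 \<le> c" by (rule order_trans[OF abs_ge_zero calculation(1)])
  ultimately show ?thesis
    using assms by (intro bdd_measI[of _ _ "c * d"]) (auto simp: abs_mult bdd_meas_def intro!: mult_mono)
qed

lemma bdd_meas_add [intro]:
  assumes "bdd_meas M f" "bdd_meas M g" shows "bdd_meas M (\<lambda>z. f z + g z)"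
proof -
  from assms obtain c d where "\<And>z. \<bar>f z\<bar> \<le> c" "\<And>z. \<bar>g z\<bar> \<le> d"
    by (auto simp: bdd_meas_def)
  then show ?thesis
    using assms by (intro bdd_measI[of _ _ "c + d"])
      (auto simp: bdd_meas_def intro!: order_trans[OF abs_triangle_ineq] add_mono)
qed

lemma bdd_meas_diff [intro]:
  assumes "bdd_meas M f" "bdd_meas M g" shows "bdd_meas M (\<lambda>z. f z - g z)"
  using bdd_meas_add[OF assms(1) bdd_meas_mult[OF bdd_meas_const[of M "-1"] assms(2)]] by simp

lemma bdd_meas_sum [intro]:
  assumes "\<And>i. i \<in> I \<Longrightarrow> bdd_meas M (f i)" shows "bdd_meas M (\<lambda>z. \<Sum>i\<in>I. f i z)"
  using assms by (induction I rule: infinite_finite_induct) auto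

lemma bdd_meas_compose:
  assumes "bdd_meas N f" "T \<in> measurable M N" shows "bdd_meas M (\<lambda>z. f (T z))"
  using assms by (auto simp: bdd_meas_def)

lemma (in prob_space) bdd_meas_integrable: "bdd_meas M f \<Longrightarrow> integrable M f"
  unfolding bdd_meas_def by (metis AE_I2 integrable_const_bound real_norm_def)

text \<open>The space is the whole type so that each update \<open>z(i := x)\<close> and each
  reindexing stays inside the sample space.\<close>

locale iid = prob_space \<mu> for \<mu> :: "'a measure" +
  assumes space_UNIV [simp]: "space \<mu> = UNIV"
begin

definition Om :: "(nat \<Rightarrow> 'a) measure" where "Om = PiM UNIV (\<lambda>_. \<mu>)"

sublocale Om: prob_space Om
  unfolding Om_def by (intro prob_space_PiM prob_space_axioms)

lemma space_Om [simp]: "space Om = UNIV"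
  by (simp add: Om_def space_PiM)

lemma prob_UNIV_Om [simp]: "Om.prob UNIV = 1"
  using Om.prob_space by simp

lemma measurable_Om_component [measurable]: "(\<lambda>z. z i) \<in> measurable Om \<mu>"
  unfolding Om_def by measurable

lemma measurable_OmI: "(\<And>i. (\<lambda>x. f x i) \<in> measurable N \<mu>) \<Longrightarrow> f \<in> measurable N Om"
  unfolding Om_def by (rule measurable_PiM_single') auto

lemma measurable_Om_update: "(\<lambda>z. z(i := x)) \<in> measurable Om Om"
  by (rule measurable_OmI) (auto simp: fun_upd_def)

lemma measurable_Om_update_pair: "(\<lambda>(x, z). z(i := x)) \<in> measurable (\<mu> \<Otimes>\<^sub>M Om) Om"
proof (rule measurable_OmI)
  fix j show "(\<lambda>p. (case p of (x, z) \<Rightarrow> z(i := x)) j) \<in> \<mu> \<Otimes>\<^sub>M Om \<rightarrow>\<^sub>M \<mu>"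
    by (cases "j = i") (auto simp: case_prod_unfold)
qed

lemma bdd_meas_update: "bdd_meas Om f \<Longrightarrow> bdd_meas Om (\<lambda>z. f (z(i := x)))"
  by (rule bdd_meas_compose[OF _ measurable_Om_update])

sublocale PO: pair_prob_space \<mu> Om ..

lemma bdd_meas_update_integral:
  assumes "bdd_meas Om f" shows "bdd_meas \<mu> (\<lambda>x. \<integral>z. f (z(i := x)) \<partial>Om)"
proof -
  obtain c where c: "\<And>z. \<bar>f z\<bar> \<le> c" using assms by (auto simp: bdd_meas_def)
  have [measurable]: "f \<in> borel_measurable Om" using assms by (simp add: bdd_meas_def)
  have [measurable]: "(\<lambda>(x, z). f (z(i := x))) \<in> borel_measurable (\<mu> \<Otimes>\<^sub>M Om)"
    using measurable_compose[OF measurable_Om_update_pair, of f borel i] by (simp add: case_prod_unfold)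
  show ?thesis
  proof (rule bdd_measI[of _ _ c])
    show "(\<lambda>x. \<integral>z. f (z(i := x)) \<partial>Om) \<in> borel_measurable \<mu>" by measurable
    fix x
    have "\<bar>\<integral>z. f (z(i := x)) \<partial>Om\<bar> \<le> (\<integral>z. \<bar>f (z(i := x))\<bar> \<partial>Om)"
      by (rule integral_abs_bound)
    also have "\<dots> \<le> (\<integral>z. c \<partial>Om)"
      by (rule integral_mono) (auto intro!: Om.bdd_meas_integrable bdd_meas_update assms c integrable_abs)
    finally show "\<bar>\<integral>z. f (z(i := x)) \<partial>Om\<bar> \<le> c" by simp
  qed
qed

text \<open>Overwriting one coordinate by an independent draw leaves the product law unchanged, and
  Fubini separates that draw. The inner integral plays the role of the conditional expectation given
  point \<open>i\<close>.\<close>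

lemma integral_Om_update:
  assumes "bdd_meas Om f"
  shows "(\<integral>z. f z \<partial>Om) = (\<integral>x. (\<integral>z. f (z(i := x)) \<partial>Om) \<partial>\<mu>)"
proof -
  have [measurable]: "f \<in> borel_measurable Om" using assms by (simp add: bdd_meas_def)
  obtain c where c: "\<And>z. \<bar>f z\<bar> \<le> c" using assms by (auto simp: bdd_meas_def)
  have "distr (\<mu> \<Otimes>\<^sub>M Om) Om (\<lambda>(x, z). z(i := x)) = Om"
    using distr_pair_PiM_eq_PiM[of UNIV "\<lambda>_. \<mu>" i] prob_space_axioms by (simp add: Om_def)
  then have "(\<integral>z. f z \<partial>Om) = (\<integral>z. f z \<partial>distr (\<mu> \<Otimes>\<^sub>M Om) Om (\<lambda>(x, z). z(i := x)))" by simp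
  also have "\<dots> = (\<integral>p. f ((snd p)(i := fst p)) \<partial>(\<mu> \<Otimes>\<^sub>M Om))"
    by (subst integral_distr[OF measurable_Om_update_pair]) (auto simp: case_prod_unfold)
  also have "\<dots> = (\<integral>x. (\<integral>z. f (z(i := x)) \<partial>Om) \<partial>\<mu>)"
  proof (subst PO.integral_fst'[symmetric])
    have "(\<lambda>p. f ((snd p)(i := fst p))) \<in> borel_measurable (\<mu> \<Otimes>\<^sub>M Om)"
      using measurable_compose[OF measurable_Om_update_pair, of f borel i] by (simp add: case_prod_unfold)
    then show "integrable (\<mu> \<Otimes>\<^sub>M Om) (\<lambda>p. f ((snd p)(i := fst p)))"
      by (intro PO.integrable_const_bound[of _ c]) (auto simp: c)
  qed simp
  finally show ?thesis .
qed

text \<open>Induction on \<open>A\<close>: fixing the value at \<open>a\<close> removes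
  \<open>a\<close> from the indices that matter for \<open>f\<close> and does not affect
  \<open>g\<close>. Once \<open>A\<close> is empty, \<open>f\<close> is constant.\<close>

lemma integral_Om_indep:
  assumes "finite A" "bdd_meas Om f" "bdd_meas Om g" "depends_on f A" "depends_on g (- A)"
  shows "(\<integral>z. f z * g z \<partial>Om) = (\<integral>z. f z \<partial>Om) * (\<integral>z. g z \<partial>Om)"
  using assms
proof (induction A arbitrary: f rule: finite_induct)
  case empty
  then obtain c where "f = (\<lambda>_. c)" unfolding depends_on_def by (metis empty_iff)
  then show ?case by simp
next
  case (insert a A)
  have g: "g (z(a := x)) = g z" for x z
    by (rule depends_onD[OF insert.prems(4)]) auto
  have step: "(\<integral>z. f (z(a := x)) * g z \<partial>Om) = (\<integral>z. f (z(a := x)) \<partial>Om) * (\<integral>z. g z \<partial>Om)" for x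
  proof (rule insert.IH)
    show "depends_on (\<lambda>z. f (z(a := x))) A"
      by (rule depends_on_mono[OF depends_on_update[OF insert.prems(3)]]) auto
    show "depends_on g (- A)"
      by (rule depends_on_mono[OF insert.prems(4)]) auto
  qed (rule bdd_meas_update insert.prems)+
  have "(\<integral>z. f z * g z \<partial>Om) = (\<integral>x. (\<integral>z. f (z(a := x)) * g (z(a := x)) \<partial>Om) \<partial>\<mu>)"
    by (rule integral_Om_update[OF bdd_meas_mult[OF insert.prems(1,2)]])
  also have "\<dots> = (\<integral>x. (\<integral>z. f (z(a := x)) \<partial>Om) * (\<integral>z. g z \<partial>Om) \<partial>\<mu>)"
    by (simp only: g step)
  also have "\<dots> = (\<integral>z. f z \<partial>Om) * (\<integral>z. g z \<partial>Om)"
    by (simp only: integral_Om_update[OF insert.prems(1), of a] integral_mult_left_zero)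
  finally show ?case .
qed

text \<open>Conditioning on the single shared coordinate leaves two factors that depend on disjoint
  sets of coordinates.\<close>

lemma integral_Om_overlap:
  assumes "finite A" "A \<inter> B = {i}" "bdd_meas Om f" "bdd_meas Om g" "depends_on f A" "depends_on g B"
  shows "(\<integral>z. f z * g z \<partial>Om) =
    (\<integral>x. (\<integral>z. f (z(i := x)) \<partial>Om) * (\<integral>z. g (z(i := x)) \<partial>Om) \<partial>\<mu>)"
proof (subst integral_Om_update[of _ i])
  have "(\<integral>z. f (z(i := x)) * g (z(i := x)) \<partial>Om) = (\<integral>z. f (z(i := x)) \<partial>Om) * (\<integral>z. g (z(i := x)) \<partial>Om)" for x
  proof (rule integral_Om_indep[of "A - {i}"])
    show "depends_on (\<lambda>z. f (z(i := x))) (A - {i})" by (rule depends_on_update[OF assms(5)])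
    show "depends_on (\<lambda>z. g (z(i := x))) (- (A - {i}))"
      by (rule depends_on_mono[OF depends_on_update[OF assms(6)]]) (use assms(2) in auto)
  qed (use assms bdd_meas_update in auto)
  then show "(\<integral>x. (\<integral>z. f (z(i := x)) * g (z(i := x)) \<partial>Om) \<partial>\<mu>) =
      (\<integral>x. (\<integral>z. f (z(i := x)) \<partial>Om) * (\<integral>z. g (z(i := x)) \<partial>Om) \<partial>\<mu>)" by simp
qed (use assms in auto)

text \<open>A point of the product over \<open>K\<close> is a full function with the constant value
  \<open>undefined\<close> outside \<open>K\<close>, hence also a point of the infinite product.
  Functions on the latter can therefore be integrated over either space.\<close>

lemma measurable_PiM_Om: "(\<lambda>z. z) \<in> measurable (PiM K (\<lambda>_. \<mu>)) Om"
proof (rule measurable_OmI)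
  fix i show "(\<lambda>z. z i) \<in> measurable (PiM K (\<lambda>_. \<mu>)) \<mu>"
  proof (cases "i \<in> K")
    case False
    then have "(\<lambda>z. z i) \<in> measurable (PiM K (\<lambda>_. \<mu>)) \<mu> \<longleftrightarrow> (\<lambda>z. undefined) \<in> measurable (PiM K (\<lambda>_. \<mu>)) \<mu>"
      by (intro measurable_cong) (auto simp: space_PiM PiE_def extensional_def)
    then show ?thesis by simp
  qed simp
qed

lemma integral_PiM_eq_reindex:
  fixes f :: "(nat \<Rightarrow> 'a) \<Rightarrow> 'b :: {banach, second_countable_topology}"
  assumes "f \<in> borel_measurable Om" "depends_on f K" "inj_on e K"
  shows "(\<integral>z. f z \<partial>PiM K (\<lambda>_. \<mu>)) = (\<integral>z. f (\<lambda>i. z (e i)) \<partial>Om)"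
proof -
  have "distr Om (PiM K (\<lambda>_. \<mu>)) (\<lambda>z. \<lambda>i\<in>K. z (e i)) = PiM K (\<lambda>_. \<mu>)"
    unfolding Om_def using distr_PiM_reindex[of UNIV "\<lambda>_. \<mu>" e K] assms(3) prob_space_axioms by simp
  then have "(\<integral>z. f z \<partial>PiM K (\<lambda>_. \<mu>)) = (\<integral>z. f z \<partial>distr Om (PiM K (\<lambda>_. \<mu>)) (\<lambda>z. \<lambda>i\<in>K. z (e i)))" by simp
  also have "\<dots> = (\<integral>z. f (\<lambda>i\<in>K. z (e i)) \<partial>Om)"
  proof (rule integral_distr)
    show "(\<lambda>z. \<lambda>i\<in>K. z (e i)) \<in> Om \<rightarrow>\<^sub>M Pi\<^sub>M K (\<lambda>_. \<mu>)"
      by (rule measurable_restrict) simp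
    show "f \<in> borel_measurable (PiM K (\<lambda>_. \<mu>))"
      using measurable_compose[OF measurable_PiM_Om assms(1)] .
  qed
  also have "\<dots> = (\<integral>z. f (\<lambda>i. z (e i)) \<partial>Om)"
    by (intro Bochner_Integration.integral_cong refl depends_onD[OF assms(2)]) simp
  finally show ?thesis .
qed

lemma integral_PiM_eq_Om:
  fixes f :: "(nat \<Rightarrow> 'a) \<Rightarrow> 'b :: {banach, second_countable_topology}"
  assumes "f \<in> borel_measurable Om" "depends_on f K"
  shows "(\<integral>z. f z \<partial>PiM K (\<lambda>_. \<mu>)) = (\<integral>z. f z \<partial>Om)"
  using integral_PiM_eq_reindex[OF assms, of id] by simp

lemma integral_Om_reindex:
  fixes f :: "(nat \<Rightarrow> 'a) \<Rightarrow> 'b :: {banach, second_countable_topology}"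
  assumes "f \<in> borel_measurable Om" "depends_on f K" "inj_on e K"
  shows "(\<integral>z. f (\<lambda>i. z (e i)) \<partial>Om) = (\<integral>z. f z \<partial>Om)"
  using integral_PiM_eq_reindex[OF assms] integral_PiM_eq_Om[OF assms(1,2)] by simp

lemma integral_Om_component:
  fixes f :: "'a \<Rightarrow> 'b :: {banach, second_countable_topology}"
  assumes "f \<in> borel_measurable \<mu>"
  shows "(\<integral>z. f (z i) \<partial>Om) = (\<integral>x. f x \<partial>\<mu>)"
proof -
  have "distr Om \<mu> (\<lambda>z. z i) = \<mu>"
    unfolding Om_def by (rule distr_PiM_component) (auto intro: prob_space_axioms)
  then show ?thesis
    using integral_distr[OF measurable_Om_component assms, of i] by simp
qed

lemma integral_Om_prod:
  fixes f :: "nat \<Rightarrow> 'a \<Rightarrow> 'b::{real_normed_field,banach,second_countable_topology}"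
  assumes "finite I" "\<And>i. i \<in> I \<Longrightarrow> integrable \<mu> (f i)"
  shows "(\<integral>z. (\<Prod>i\<in>I. f i (z i)) \<partial>Om) = (\<Prod>i\<in>I. integral\<^sup>L \<mu> (f i))"
proof -
  interpret P: product_sigma_finite "\<lambda>_::nat. \<mu>"
    by (simp add: product_sigma_finite_def sigma_finite_measure_axioms)
  have "(\<integral>z. (\<Prod>i\<in>I. f i (z i)) \<partial>Om) = (\<integral>z. (\<Prod>i\<in>I. f i (z i)) \<partial>PiM I (\<lambda>_. \<mu>))"
  proof (rule integral_PiM_eq_Om[symmetric])
    show "(\<lambda>z. \<Prod>i\<in>I. f i (z i)) \<in> borel_measurable Om"
      by (intro borel_measurable_prod measurable_compose[OF measurable_Om_component])
        (use assms(2) in auto)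
  qed (auto simp: depends_on_def intro!: prod.cong)
  also have "\<dots> = (\<Prod>i\<in>I. integral\<^sup>L \<mu> (f i))"
    by (rule P.product_integral_prod[OF assms])
  finally show ?thesis .
qed

end

section \<open>Samples from a copula\<close>

locale copula_space =
  fixes \<mu> :: "(real \<times> real) measure"
  assumes copula: "copula \<mu>"
begin

lemma sets_eq [measurable_cong]: "sets \<mu> = sets borel"
  using copula by (simp add: copula_def)

sublocale iid \<mu>
proof -
  interpret prob_space \<mu> using copula by (simp add: copula_def)
  show "iid \<mu>" by unfold_locales (use sets_eq_imp_space_eq[OF sets_eq] in simp)
qed

lemma prob_UNIV [simp]: "prob UNIV = 1"
  using prob_space by simp

definition uniform_marginal :: "(real \<times> real \<Rightarrow> real) \<Rightarrow> bool" where
  "uniform_marginal h \<longleftrightarrow> h \<in> borel_measurable borel \<and> (\<forall>x\<in>{0..1}. prob {z. h z \<le> x} = x)"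

lemma uniform_marginal_fst: "uniform_marginal fst"
  using copula by (auto simp: copula_def uniform_marginal_def intro!: borel_measurable_continuous_onI continuous_intros)

lemma uniform_marginal_snd: "uniform_marginal snd"
  using copula by (auto simp: copula_def uniform_marginal_def intro!: borel_measurable_continuous_onI continuous_intros)

lemma measurable_fst_snd [measurable]:
  "fst \<in> borel_measurable \<mu>" "snd \<in> borel_measurable \<mu>"
  using uniform_marginal_fst uniform_marginal_snd measurable_cong_sets[OF sets_eq refl]
  by (auto simp: uniform_marginal_def)

lemma measurable_Om_fst_snd [measurable]:
  "(\<lambda>z. fst (z i)) \<in> borel_measurable Om" "(\<lambda>z. snd (z i)) \<in> borel_measurable Om"
  using measurable_compose[OF measurable_Om_component] by auto

lemma pred_Om_order [measurable]:
  "Measurable.pred Om (\<lambda>z. fst (z i) < fst (z j))" "Measurable.pred Om (\<lambda>z. snd (z i) < snd (z j))"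
  by (rule borel_measurable_pred_less measurable_Om_fst_snd)+

lemma pred_Om_order_le [measurable]:
  "Measurable.pred Om (\<lambda>z. fst (z i) \<le> fst (z j))" "Measurable.pred Om (\<lambda>z. snd (z i) \<le> snd (z j))"
  unfolding not_less[symmetric] by measurable

lemma uniform_marginal_measurable: "uniform_marginal h \<Longrightarrow> h \<in> borel_measurable \<mu>"
  using measurable_cong_sets[OF sets_eq refl] by (auto simp: uniform_marginal_def)

text \<open>The measure lives on the plane; it is the values of the marginal distribution functions
  at 0 and 1 that confine it to the unit square.\<close>

lemma prob_marginal_outside:
  assumes h: "uniform_marginal h"
  shows "prob {z. h z \<le> 0} = 0" "prob {z. 1 < h z} = 0"
proof -
  note [measurable] = uniform_marginal_measurable[OF h]
  show "prob {z. h z \<le> 0} = 0" using h by (auto simp: uniform_marginal_def)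
  have 1: "{z. h z \<le> 1} \<in> events"
    using measurable_sets[OF uniform_marginal_measurable[OF h], of "{..1}"] by (simp add: vimage_def)
  have "{z. 1 < h z} = space \<mu> - {z. h z \<le> 1}" by auto
  then have "prob {z. 1 < h z} = 1 - prob {z. h z \<le> 1}"
    by (simp only: prob_compl[OF 1])
  then show "prob {z. 1 < h z} = 0" using h by (auto simp: uniform_marginal_def)
qed

lemma prob_marginal_interval:
  assumes h: "uniform_marginal h" and x: "0 \<le> x" "x \<le> 1" and d: "0 \<le> d"
  shows "prob {z. x < h z \<and> h z \<le> x + d} \<le> d"
proof -
  note [measurable] = uniform_marginal_measurable[OF h]
  \<comment> \<open>The distribution function is known on the unit interval only; beyond 1 there is
    no mass.\<close>
  define y where "y = min 1 (x + d)"
  have y: "0 \<le> y" "y \<le> 1" "x \<le> y" using assms by (auto simp: y_def)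
  have s: "{z. h z \<le> a} \<in> events" for a
    using measurable_sets[OF uniform_marginal_measurable[OF h], of "{..a}"] by (simp add: vimage_def)
  have s1: "{z. 1 < h z} \<in> events"
    using measurable_sets[OF uniform_marginal_measurable[OF h], of "{1<..}"] by (simp add: vimage_def)
  have "prob {z. x < h z \<and> h z \<le> x + d} \<le> prob (({z. h z \<le> y} - {z. h z \<le> x}) \<union> {z. 1 < h z})"
  proof (rule finite_measure_mono)
    show "({z. h z \<le> y} - {z. h z \<le> x}) \<union> {z. 1 < h z} \<in> events"
      by (intro sets.Un sets.Diff s s1)
  qed (auto simp: y_def)
  also have "\<dots> \<le> prob ({z. h z \<le> y} - {z. h z \<le> x}) + prob {z. 1 < h z}"
    by (rule measure_Un_le) (use s s1 in auto)
  also have "prob ({z. h z \<le> y} - {z. h z \<le> x}) = prob {z. h z \<le> y} - prob {z. h z \<le> x}"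
    by (rule finite_measure_Diff) (use s y in auto)
  also have "\<dots> = y - x" using h x y by (auto simp: uniform_marginal_def)
  finally show ?thesis using prob_marginal_outside[OF h] by (simp add: y_def)
qed

text \<open>Rounding up gives cells that are open on the left and closed on the right, matching
  distribution functions defined with \<open>\<le>\<close>. Cells outside the unit interval are
  null.\<close>

lemma prob_marginal_cell:
  assumes h: "uniform_marginal h" and N: "0 < N"
  shows "prob {z. \<lceil>real N * h z\<rceil> = b} \<le> 1 / real N"
proof -
  have s: "{z. a < h z \<and> h z \<le> c} \<in> events" for a c
    using measurable_sets[OF uniform_marginal_measurable[OF h], of "{a<..c}"] by (simp add: vimage_def greaterThanAtMost_def)
  have s0: "{z. h z \<le> a} \<in> events" for a
    using measurable_sets[OF uniform_marginal_measurable[OF h], of "{..a}"] by (simp add: vimage_def)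
  have s1: "{z. 1 < h z} \<in> events"
    using measurable_sets[OF uniform_marginal_measurable[OF h], of "{1<..}"] by (simp add: vimage_def)
  have eq: "{z. \<lceil>real N * h z\<rceil> = b} = {z. (b - 1) / N < h z \<and> h z \<le> (b - 1) / N + 1 / N}"
    using N by (auto simp: ceiling_eq_iff field_simps)
  consider "b \<le> 0" | "b > int N" | "0 < b" "b \<le> int N" by linarith
  then show ?thesis
  proof cases
    case 1
    have "prob {z. \<lceil>real N * h z\<rceil> = b} \<le> prob {z. h z \<le> 0}"
    proof (rule finite_measure_mono[OF _ s0], safe)
      fix z assume "b = \<lceil>real N * h z\<rceil>"
      with 1 have "real N * h z \<le> 0" by (simp add: ceiling_le_iff)
      then show "h z \<le> 0" using N by (simp add: mult_le_0_iff)
    qed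
    then show ?thesis using prob_marginal_outside[OF h] by simp (metis divide_nonneg_nonneg of_nat_0_le_iff order_trans zero_le_one)
  next
    case 2
    have "prob {z. \<lceil>real N * h z\<rceil> = b} \<le> prob {z. 1 < h z}"
    proof (rule finite_measure_mono[OF _ s1], safe)
      fix z assume "b = \<lceil>real N * h z\<rceil>"
      with 2 have "real N * 1 < real N * h z" by linarith
      then show "1 < h z" using N by (simp only: mult_less_cancel_left_pos of_nat_0_less_iff)
    qed
    then show ?thesis using prob_marginal_outside[OF h] by simp (metis divide_nonneg_nonneg of_nat_0_le_iff order_trans zero_le_one)
  next
    case 3
    then have "real_of_int (b - 1) / N \<le> 1" "0 \<le> real_of_int (b - 1) / N"
      using N by (auto simp: field_simps)
    then show ?thesis unfolding eq
      using prob_marginal_interval[OF h, of "(b - 1) / N" "1 / N"] by simp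
  qed
qed

lemma integral_of_bool: "Measurable.pred \<mu> P \<Longrightarrow> (\<integral>x. of_bool (P x) \<partial>\<mu>) = prob {x. P x}"
proof -
  have "(\<integral>x. of_bool (P x) \<partial>\<mu>) = (\<integral>x. indicator {x. P x} x \<partial>\<mu>)"
    by (intro Bochner_Integration.integral_cong) (auto simp: indicator_def)
  also have "\<dots> = prob ({x. P x} \<inter> space \<mu>)" by (rule Bochner_Integration.integral_indicator)
  finally show ?thesis by simp
qed

text \<open>Given point \<open>i\<close>, the independent point \<open>j\<close> has to fall into
  one prescribed cell.\<close>

lemma expectation_tie:
  assumes h: "uniform_marginal h" and N: "0 < N" and ij: "i \<noteq> j"
  shows "(\<integral>z. of_bool (\<lceil>real N * h (z i)\<rceil> = \<lceil>real N * h (z j)\<rceil>) \<partial>Om) \<le> 1 / real N"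
proof -
  note [measurable] = uniform_marginal_measurable[OF h] measurable_compose[OF measurable_Om_component uniform_marginal_measurable[OF h]]
  let ?f = "\<lambda>z. of_bool (\<lceil>real N * h (z i)\<rceil> = \<lceil>real N * h (z j)\<rceil>) :: real"
  have m: "?f \<in> borel_measurable Om" by measurable
  have bm: "bdd_meas Om ?f"
    by (rule bdd_measI[of _ _ 1]) (use m in auto)
  have inner: "(\<integral>z. ?f (z(i := x)) \<partial>Om) \<le> 1 / real N" for x
  proof -
    have "(\<integral>z. ?f (z(i := x)) \<partial>Om) = (\<integral>z. of_bool (\<lceil>real N * h (z j)\<rceil> = \<lceil>real N * h x\<rceil>) \<partial>Om)"
      using ij by (simp add: eq_commute)
    also have "\<dots> = (\<integral>y. of_bool (\<lceil>real N * h y\<rceil> = \<lceil>real N * h x\<rceil>) \<partial>\<mu>)"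
      by (rule integral_Om_component[of "\<lambda>y. of_bool (\<lceil>real N * h y\<rceil> = \<lceil>real N * h x\<rceil>)"]) measurable
    also have "\<dots> = prob {y. \<lceil>real N * h y\<rceil> = \<lceil>real N * h x\<rceil>}"
      by (rule integral_of_bool) measurable
    also have "\<dots> \<le> 1 / real N"
      by (rule prob_marginal_cell[OF h N])
    finally show ?thesis .
  qed
  have "(\<integral>z. ?f z \<partial>Om) = (\<integral>x. (\<integral>z. ?f (z(i := x)) \<partial>Om) \<partial>\<mu>)"
    by (rule integral_Om_update[OF bm])
  also have "\<dots> \<le> (\<integral>x. 1 / real N \<partial>\<mu>)"
    by (rule integral_mono[OF bdd_meas_integrable[OF bdd_meas_update_integral[OF bm]] _ inner]) simp
  finally show ?thesis by simp
qed

text \<open>Off this event the grid separates the points in both coordinates and so preserves their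
  order. Its probability is controlled by the marginals alone, hence for all copulas at
  once.\<close>

definition grid_tie :: "nat \<Rightarrow> nat \<Rightarrow> (nat \<Rightarrow> real \<times> real) \<Rightarrow> bool" where
  "grid_tie N m z \<longleftrightarrow> (\<exists>i<m. \<exists>j<m. i \<noteq> j \<and>
     (\<lceil>real N * fst (z i)\<rceil> = \<lceil>real N * fst (z j)\<rceil> \<or> \<lceil>real N * snd (z i)\<rceil> = \<lceil>real N * snd (z j)\<rceil>))"

lemma pred_grid_tie [measurable]: "Measurable.pred Om (grid_tie N m)"
  unfolding grid_tie_def by measurable

text \<open>Union bound over \<open>m^2\<close> ordered pairs and two coordinates.\<close>

lemma expectation_grid_tie:
  assumes N: "0 < N"
  shows "(\<integral>z. of_bool (grid_tie N m z) \<partial>Om) \<le> 2 * (real m)^2 / real N"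
proof -
  define t :: "(real \<times> real \<Rightarrow> real) \<Rightarrow> nat \<Rightarrow> nat \<Rightarrow> (nat \<Rightarrow> real \<times> real) \<Rightarrow> real" where
    "t h i j z = of_bool (i \<noteq> j \<and> \<lceil>real N * h (z i)\<rceil> = \<lceil>real N * h (z j)\<rceil>)" for h i j z
  have t: "bdd_meas Om (t fst i j)" "bdd_meas Om (t snd i j)" for i j
    unfolding t_def by (auto intro!: bdd_measI[of _ _ 1])
  have i: "(\<integral>z. t h i j z \<partial>Om) \<le> 1 / real N" if "uniform_marginal h" for h i j
    using expectation_tie[OF that N, of i j] by (cases "i = j") (auto simp: t_def)
  have "(\<integral>z. of_bool (grid_tie N m z) \<partial>Om) \<le> (\<integral>z. (\<Sum>i<m. \<Sum>j<m. t fst i j z + t snd i j z) \<partial>Om)"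
  proof (rule integral_mono)
    show "integrable Om (\<lambda>z. of_bool (grid_tie N m z) :: real)"
      by (rule Om.bdd_meas_integrable[OF bdd_measI[of _ _ 1]]) auto
    show "integrable Om (\<lambda>z. \<Sum>i<m. \<Sum>j<m. t fst i j z + t snd i j z)"
      by (intro Om.bdd_meas_integrable bdd_meas_sum bdd_meas_add t)
    fix z
    have nn: "0 \<le> t fst i j z + t snd i j z" for i j by (simp add: t_def)
    show "of_bool (grid_tie N m z) \<le> (\<Sum>i<m. \<Sum>j<m. t fst i j z + t snd i j z)"
    proof (cases "grid_tie N m z")
      case True
      then obtain i j where ij: "i < m" "j < m" "1 \<le> t fst i j z + t snd i j z"
        unfolding grid_tie_def t_def by (auto; force)
      have "1 \<le> (\<Sum>j<m. t fst i j z + t snd i j z)"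
        using ij nn member_le_sum[of j "{..<m}" "\<lambda>j. t fst i j z + t snd i j z"] by force
      also have "\<dots> \<le> (\<Sum>i<m. \<Sum>j<m. t fst i j z + t snd i j z)"
        by (rule member_le_sum[of i _ "\<lambda>i. \<Sum>j<m. t fst i j z + t snd i j z"]) (use ij nn in \<open>auto intro: sum_nonneg\<close>)
      finally show ?thesis by simp
    qed (simp add: sum_nonneg nn)
  qed
  also have "\<dots> = (\<Sum>i<m. \<Sum>j<m. (\<integral>z. t fst i j z \<partial>Om) + (\<integral>z. t snd i j z \<partial>Om))"
    by (simp add: Bochner_Integration.integral_sum Bochner_Integration.integral_add
        Om.bdd_meas_integrable bdd_meas_sum bdd_meas_add t)
  also have "\<dots> \<le> (\<Sum>i<m. \<Sum>j<m. 1 / real N + 1 / real N)"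
    by (intro sum_mono add_mono i uniform_marginal_fst uniform_marginal_snd)
  also have "\<dots> = 2 * (real m)^2 / real N" by (simp add: power2_eq_square)
  finally show ?thesis .
qed

lemma ties_imp_grid_tie:
  assumes "\<not> no_ties m z" shows "grid_tie N m z"
proof -
  obtain i j where "i < m" "j < m" "i \<noteq> j" "fst (z i) = fst (z j) \<or> snd (z i) = snd (z j)"
    using assms by (auto simp: no_ties_def inj_on_def)
  then show ?thesis unfolding grid_tie_def by metis
qed

text \<open>A genuine tie is a grid tie for every \<open>N\<close>, and the bound for the latter
  tends to 0.\<close>

lemma AE_no_ties: "AE z in Om. no_ties m z"
proof -
  have meas: "{z. \<not> no_ties m z} \<in> Om.events"
  proof -
    have "Measurable.pred Om (\<lambda>z. \<not> no_ties m z)"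
    proof -
      have "(\<lambda>z. \<not> no_ties m z) = (\<lambda>z. \<exists>i<m. \<exists>j<m. i \<noteq> j \<and>
          ((fst (z i) \<le> fst (z j) \<and> fst (z j) \<le> fst (z i)) \<or> (snd (z i) \<le> snd (z j) \<and> snd (z j) \<le> snd (z i))))"
        by (auto simp: no_ties_def inj_on_def fun_eq_iff order_eq_iff[symmetric])
      moreover have "Measurable.pred Om (\<lambda>z. \<exists>i<m. \<exists>j<m. i \<noteq> j \<and>
          ((fst (z i) \<le> fst (z j) \<and> fst (z j) \<le> fst (z i)) \<or> (snd (z i) \<le> snd (z j) \<and> snd (z j) \<le> snd (z i))))"
        by measurable
      ultimately show ?thesis by (simp only:)
    qed
    then show ?thesis by (simp add: pred_def)
  qed
  have le: "Om.prob {z. \<not> no_ties m z} \<le> 2 * (real m)^2 / real (Suc N)" for N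
  proof -
    have "Om.prob {z. \<not> no_ties m z} = (\<integral>z. indicator {z. \<not> no_ties m z} z \<partial>Om)"
      using Bochner_Integration.integral_indicator[of Om "{z. \<not> no_ties m z}"] by (simp only: space_Om Int_UNIV_right)
    also have "\<dots> \<le> (\<integral>z. of_bool (grid_tie (Suc N) m z) \<partial>Om)"
    proof (rule integral_mono)
      show "integrable Om (indicator {z. \<not> no_ties m z} :: _ \<Rightarrow> real)" 
        by (intro Om.bdd_meas_integrable bdd_measI[of _ _ 1] borel_measurable_indicator meas) (auto simp: indicator_def)
      show "integrable Om (\<lambda>z. of_bool (grid_tie (Suc N) m z) :: real)"
        by (rule Om.bdd_meas_integrable[OF bdd_measI[of _ _ 1]]) auto
    qed (use ties_imp_grid_tie in \<open>auto simp: indicator_def\<close>)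
    also have "\<dots> \<le> 2 * (real m)^2 / real (Suc N)" by (rule expectation_grid_tie) simp
    finally show ?thesis .
  qed
  have "Om.prob {z. \<not> no_ties m z} \<le> 0"
  proof (rule LIMSEQ_le_const)
    show "(\<lambda>N. 2 * (real m)^2 / real (Suc N)) \<longlonglongrightarrow> 0"
      using tendsto_mult_right_zero[OF LIMSEQ_inverse_real_of_nat, of "2 * (real m)^2"]
      by (simp add: divide_inverse)
  qed (use le in auto)
  then have "Om.prob {z. \<not> no_ties m z} = 0"
    using measure_nonneg[of Om "{z. \<not> no_ties m z}"] by linarith
  then have "AE z in Om. z \<notin> {z. \<not> no_ties m z}"
    using Om.prob_eq_0[OF meas] by simp
  then show ?thesis by simp
qed

text \<open>A finite \<open>A\<close> has finitely many candidate enumerations, so the existential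
  quantifier over lists becomes a finite one.\<close>

lemma pred_pat [measurable]: "Measurable.pred Om (pat \<sigma> A)"
proof (cases "finite A")
  case True
  define L where "L = {l. set l \<subseteq> A \<and> length l = length \<sigma>}"
  have [simp]: "finite L" unfolding L_def by (rule finite_lists_length_eq[OF True])
  have eq: "pat \<sigma> A = (\<lambda>z. \<exists>l\<in>L. distinct l \<and> set l = A \<and> length l = length \<sigma> \<and>
     (\<forall>j<length l. \<forall>i<j. fst (z (l ! i)) < fst (z (l ! j))) \<and>
     (\<forall>i<length \<sigma>. \<forall>j<length \<sigma>. \<sigma> ! i < \<sigma> ! j \<longleftrightarrow> snd (z (l ! i)) < snd (z (l ! j))))"
  proof
    fix z :: "nat \<Rightarrow> real \<times> real"
    have "sorted_wrt (\<lambda>a b. fst (z a) < fst (z b)) l \<longleftrightarrow> (\<forall>j<length l. \<forall>i<j. fst (z (l ! i)) < fst (z (l ! j)))" for l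
      by (auto simp: sorted_wrt_iff_nth_less)
    then show "pat \<sigma> A z = (\<exists>l\<in>L. distinct l \<and> set l = A \<and> length l = length \<sigma> \<and>
     (\<forall>j<length l. \<forall>i<j. fst (z (l ! i)) < fst (z (l ! j))) \<and>
     (\<forall>i<length \<sigma>. \<forall>j<length \<sigma>. \<sigma> ! i < \<sigma> ! j \<longleftrightarrow> snd (z (l ! i)) < snd (z (l ! j))))"
      unfolding pat_def L_def by blast
  qed
  show ?thesis unfolding eq by measurable
next
  case False
  then have "pat \<sigma> A = (\<lambda>z. False)" using pat_card(2) by blast
  then show ?thesis by simp
qed

text \<open>\<open>R\<close> records the comparisons that determine the permutation and takes values
  in a finite set, so any function of it is measurable once its fibres are. \<open>\<phi>\<close>
  evaluates the permutation at an arbitrary sample with the given comparisons.\<close>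

lemma measurable_sample_perm [measurable]: "sample_perm n \<in> measurable Om (count_space UNIV)"
proof -
  define R :: "(nat \<Rightarrow> real \<times> real) \<Rightarrow> (nat \<times> nat) set \<times> (nat \<times> nat) set" where
    "R z = ({(i, j). i < n \<and> j < n \<and> fst (z i) \<le> fst (z j)}, {(i, j). i < n \<and> j < n \<and> snd (z i) \<le> snd (z j)})" for z
  have dep: "sample_perm n z = sample_perm n z'" if "R z = R z'" for z z'
    using that unfolding R_def by (intro sample_perm_cong_order) (auto simp: set_eq_iff)
  define \<phi> where "\<phi> r = sample_perm n (SOME z. R z = r)" for r
  have \<phi>: "sample_perm n z = \<phi> (R z)" for z
    unfolding \<phi>_def by (rule dep) (metis (mono_tags) someI)
  have "R \<in> measurable Om (count_space (Pow ({..<n} \<times> {..<n}) \<times> Pow ({..<n} \<times> {..<n})))"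
  proof (rule measurable_count_space_eq2[THEN iffD2], simp, intro conjI ballI)
    show "R \<in> space Om \<rightarrow> Pow ({..<n} \<times> {..<n}) \<times> Pow ({..<n} \<times> {..<n})"
      by (auto simp: R_def)
    fix r assume r: "r \<in> Pow ({..<n} \<times> {..<n}) \<times> Pow ({..<n} \<times> {..<n})"
    have "R -` {r} \<inter> space Om = {z \<in> space Om. \<forall>i<n. \<forall>j<n.
        (fst (z i) \<le> fst (z j) \<longleftrightarrow> (i, j) \<in> fst r) \<and> (snd (z i) \<le> snd (z j) \<longleftrightarrow> (i, j) \<in> snd r)}"
    proof -
      obtain a b where ab: "r = (a, b)" "\<And>i j. (i, j) \<in> a \<Longrightarrow> i < n \<and> j < n" "\<And>i j. (i, j) \<in> b \<Longrightarrow> i < n \<and> j < n"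
        using r by (cases r) auto
      have "R z = r \<longleftrightarrow> (\<forall>i<n. \<forall>j<n.
        (fst (z i) \<le> fst (z j) \<longleftrightarrow> (i, j) \<in> a) \<and> (snd (z i) \<le> snd (z j) \<longleftrightarrow> (i, j) \<in> b))" for z
      proof -
        have "a = {(i, j). i < n \<and> j < n \<and> (i, j) \<in> a}" "b = {(i, j). i < n \<and> j < n \<and> (i, j) \<in> b}"
          using ab(2,3) by auto
        then have "R z = r \<longleftrightarrow> {(i, j). i < n \<and> j < n \<and> fst (z i) \<le> fst (z j)} = {(i, j). i < n \<and> j < n \<and> (i, j) \<in> a} \<and>
            {(i, j). i < n \<and> j < n \<and> snd (z i) \<le> snd (z j)} = {(i, j). i < n \<and> j < n \<and> (i, j) \<in> b}"
          by (simp add: R_def ab(1))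
        also have "\<dots> \<longleftrightarrow> (\<forall>i<n. \<forall>j<n.
          (fst (z i) \<le> fst (z j) \<longleftrightarrow> (i, j) \<in> a) \<and> (snd (z i) \<le> snd (z j) \<longleftrightarrow> (i, j) \<in> b))"
          unfolding set_eq_iff split_paired_All mem_Collect_eq prod.case by auto
        finally show ?thesis .
      qed
      then show ?thesis by (auto simp: ab(1))
    qed
    also have "\<dots> \<in> sets Om" by measurable
    finally show "R -` {r} \<inter> space Om \<in> sets Om" .
  qed
  then have "(\<lambda>z. \<phi> (R z)) \<in> measurable Om (count_space UNIV)"
    by (rule measurable_compose) simp
  then show ?thesis using \<phi> by (simp add: fun_eq_iff[symmetric] cong: measurable_cong)
qed

end

section \<open>Pattern indicators and their conditional probabilities given one point\<close>

context copula_space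
begin

definition pind :: "nat list \<Rightarrow> nat set \<Rightarrow> (nat \<Rightarrow> real \<times> real) \<Rightarrow> real" where
  "pind \<sigma> A z = of_bool (pat \<sigma> A z)"

lemma pind_bounds: "0 \<le> pind \<sigma> A z" "pind \<sigma> A z \<le> 1" "\<bar>pind \<sigma> A z\<bar> \<le> 1"
  by (auto simp: pind_def)

lemma bdd_meas_pind: "bdd_meas Om (pind \<sigma> A)"
  by (rule bdd_measI[OF _ pind_bounds(3)]) (unfold pind_def[abs_def], measurable)

lemma depends_on_pind: "depends_on (pind \<sigma> A) A"
  by (auto simp: depends_on_def pind_def cong: pat_cong)

lemma pind_reindex: "inj_on e A \<Longrightarrow> pind \<sigma> A (\<lambda>i. z (e i)) = pind \<sigma> (e ` A) z"
  by (simp add: pind_def pat_reindex)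

lemma measure_PiM_Collect:
  assumes "Measurable.pred Om Q" "depends_on Q K"
  shows "measure (PiM K (\<lambda>_. \<mu>)) {z \<in> space (PiM K (\<lambda>_. \<mu>)). Q z} = (\<integral>z. of_bool (Q z) \<partial>Om)"
proof -
  let ?P = "PiM K (\<lambda>_. \<mu>)"
  have "measure ?P {z \<in> space ?P. Q z} = measure ?P ({z. Q z} \<inter> space ?P)"
    by (rule arg_cong[where f="measure ?P"]) auto
  also have "\<dots> = (\<integral>z. indicator {z. Q z} z \<partial>?P)"
    by (rule Bochner_Integration.integral_indicator[symmetric])
  also have "\<dots> = (\<integral>z. of_bool (Q z) \<partial>?P)"
    by (intro Bochner_Integration.integral_cong) (auto simp: indicator_def)
  also have "\<dots> = (\<integral>z. of_bool (Q z) \<partial>Om)"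
  proof (rule integral_PiM_eq_Om)
    show "(\<lambda>z. of_bool (Q z) :: real) \<in> borel_measurable Om" using assms(1) by measurable
    show "depends_on (\<lambda>z. of_bool (Q z) :: real) K"
      unfolding depends_on_def by (intro allI impI arg_cong[where f=of_bool] depends_onD[OF assms(2)]) blast
  qed
  finally show ?thesis .
qed

lemma depends_on_pat: "depends_on (pat \<sigma> A) A"
  unfolding depends_on_def using pat_cong by blast

lemma depends_on_conj_pat: "A \<subseteq> K \<Longrightarrow> B \<subseteq> K \<Longrightarrow> depends_on (\<lambda>z. pat \<sigma> A z \<and> pat \<tau> B z) K"
  unfolding depends_on_def by (metis pat_cong subsetD)

lemma CS_eq_expectation:
  assumes "\<sigma> \<in> perms k"
  shows "CS \<mu> \<sigma> = (\<integral>z. pind \<sigma> {..<k} z \<partial>Om)"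
proof -
  have "length \<sigma> = k" using permsD[OF assms] by simp
  then show ?thesis
    unfolding CS_def pind_def
    using measure_PiM_Collect[OF pred_pat depends_on_pat, of "{..<k}" \<sigma>]
    by (simp add: pat_sample_perm[OF assms])
qed

lemma expectation_pind:
  assumes "\<sigma> \<in> perms k" "finite A" "card A = k"
  shows "(\<integral>z. pind \<sigma> A z \<partial>Om) = CS \<mu> \<sigma>"
proof -
  obtain e where e: "bij_betw e {..<k} A"
    using finite_same_card_bij[of "{..<k}" A] assms by auto
  then have inj: "inj_on e {..<k}" "e ` {..<k} = A" by (auto simp: bij_betw_def)
  have "(\<integral>z. pind \<sigma> A z \<partial>Om) = (\<integral>z. pind \<sigma> {..<k} (\<lambda>i. z (e i)) \<partial>Om)"
    by (simp add: pind_reindex inj)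
  also have "\<dots> = (\<integral>z. pind \<sigma> {..<k} z \<partial>Om)"
    by (rule integral_Om_reindex[OF bdd_meas_measurable[OF bdd_meas_pind] depends_on_pind inj(1)])
  finally show ?thesis by (simp add: CS_eq_expectation[OF assms(1)])
qed

lemma second_sample_reindex: "second_sample k z = (\<lambda>i. z (if i = 0 then 0 else k + i - 1))"
  by (auto simp: second_sample_def)

text \<open>The second sample is a relabelling of the first coordinates by an injection, so its
  pattern event lives on an index set that meets \<open>{..<k}\<close> in 0 only.\<close>

lemma CS2_eq_expectation:
  assumes \<sigma>: "\<sigma> \<in> perms k" and \<tau>: "\<tau> \<in> perms j" and kj: "k \<ge> 1" "j \<ge> 1"
  shows "CS2 \<mu> \<sigma> \<tau> = (\<integral>z. pind \<sigma> {..<k} z * pind \<tau> (insert 0 {k..<k+j-1}) z \<partial>Om)"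
proof -
  let ?s = "\<lambda>i. if i = 0 then 0 else k + i - 1"
  have len: "length \<sigma> = k" "length \<tau> = j" using permsD \<sigma> \<tau> by auto
  have inj: "inj_on ?s {..<j}" using kj by (auto simp: inj_on_def)
  have img: "?s ` {..<j} = insert 0 {k..<k+j-1}"
  proof (intro equalityI subsetI)
    fix x assume "x \<in> insert 0 {k..<k+j-1}"
    then consider "x = 0" | "k \<le> x" "x < k + j - 1" by auto
    then show "x \<in> ?s ` {..<j}"
    proof cases
      case 1 then show ?thesis using kj by (intro image_eqI[of _ _ 0]) auto
    next
      case 2 then show ?thesis using kj by (intro image_eqI[of _ _ "x - k + 1"]) auto
    qed
  qed (use kj in auto)
  have 1: "no_ties j (second_sample k z) \<and> sample_perm j (second_sample k z) = \<tau> \<longleftrightarrow>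
      pat \<tau> (insert 0 {k..<k+j-1}) z" for z
    unfolding pat_sample_perm[OF \<tau>, symmetric] second_sample_reindex pat_reindex[OF inj] img ..
  have 2: "no_ties k z \<and> sample_perm k z = \<sigma> \<and> no_ties j (second_sample k z) \<and> sample_perm j (second_sample k z) = \<tau> \<longleftrightarrow>
      pat \<sigma> {..<k} z \<and> pat \<tau> (insert 0 {k..<k+j-1}) z" for z
    using 1 pat_sample_perm[OF \<sigma>] by blast
  have "CS2 \<mu> \<sigma> \<tau> = (\<integral>z. of_bool (pat \<sigma> {..<k} z \<and> pat \<tau> (insert 0 {k..<k+j-1}) z) \<partial>Om)"
    unfolding CS2_def Let_def len 2
    by (rule measure_PiM_Collect[OF _ depends_on_conj_pat]) (use kj in auto)
  also have "\<dots> = (\<integral>z. pind \<sigma> {..<k} z * pind \<tau> (insert 0 {k..<k+j-1}) z \<partial>Om)"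
    by (intro Bochner_Integration.integral_cong) (auto simp: pind_def)
  finally show ?thesis .
qed

text \<open>The conditional probability of the pattern given that one of its points is
  \<open>x\<close>. Index 0 is a mere choice, see \<open>h1_eq\<close>.\<close>

definition h1 :: "nat list \<Rightarrow> real \<times> real \<Rightarrow> real" where
  "h1 \<sigma> x = (\<integral>z. pind \<sigma> {..<length \<sigma>} (z(0 := x)) \<partial>Om)"

text \<open>Exchangeability: a bijection from \<open>{..<k}\<close> to \<open>A\<close> that sends 0
  to \<open>i\<close> carries conditioning on point 0 to conditioning on point
  \<open>i\<close>.\<close>

lemma h1_eq:
  assumes \<sigma>: "\<sigma> \<in> perms k" and A: "finite A" "card A = k" "i \<in> A"
  shows "(\<integral>z. pind \<sigma> A (z(i := x)) \<partial>Om) = h1 \<sigma> x"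
proof -
  have len: "length \<sigma> = k" using permsD \<sigma> by auto
  have k: "k \<ge> 1" using A by (auto simp: Suc_le_eq card_gt_0_iff)
  have "card {1..<k} = card (A - {i})" using A by simp
  then obtain e' where e': "bij_betw e' {1..<k} (A - {i})"
    using finite_same_card_bij[of "{1..<k}" "A - {i}"] A by auto
  define e where "e x = (if x = 0 then i else e' x)" for x
  have "bij_betw e {1..<k} (A - {i})" using e' by (rule bij_betw_cong[THEN iffD1, rotated]) (auto simp: e_def)
  then have "bij_betw e ({1..<k} \<union> {0}) ((A - {i}) \<union> {i})"
    by (intro bij_betw_combine) (auto simp: e_def bij_betw_def)
  moreover have "{1..<k} \<union> {0} = {..<k}" "(A - {i}) \<union> {i} = A" using k A by auto
  ultimately have "bij_betw e {..<k} A" by (simp only:)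
  then have e: "inj_on e {..<k}" "e ` {..<k} = A" by (auto simp: bij_betw_def)
  have "pind \<sigma> A (z(i := x)) = pind \<sigma> {..<k} ((\<lambda>j. z (e j))(0 := x))" for z
  proof -
    have "pind \<sigma> A (z(i := x)) = pind \<sigma> {..<k} (\<lambda>j. (z(i := x)) (e j))"
      using pind_reindex[OF e(1), of \<sigma> "z(i := x)"] by (simp only: e(2))
    also have "\<dots> = pind \<sigma> {..<k} ((\<lambda>j. z (e j))(0 := x))"
    proof (rule depends_onD[OF depends_on_pind])
      fix j assume j: "j \<in> {..<k}"
      have "e j = i \<longleftrightarrow> j = 0"
      proof -
        have "e 0 = i" by (simp add: e_def)
        moreover have "e j = e 0 \<longleftrightarrow> j = 0"
          by (rule inj_on_eq_iff[OF e(1) j]) (use k in simp)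
        ultimately show ?thesis by (simp only:)
      qed
      then show "(z(i := x)) (e j) = ((\<lambda>j. z (e j))(0 := x)) j" by auto
    qed
    finally show ?thesis .
  qed
  then have "(\<integral>z. pind \<sigma> A (z(i := x)) \<partial>Om) = (\<integral>z. (\<lambda>z. pind \<sigma> {..<k} (z(0 := x))) (\<lambda>j. z (e j)) \<partial>Om)"
    by (simp only:)
  also have "\<dots> = (\<integral>z. pind \<sigma> {..<k} (z(0 := x)) \<partial>Om)"
    by (rule integral_Om_reindex[OF bdd_meas_measurable[OF bdd_meas_update[OF bdd_meas_pind]] _ e(1)])
      (rule depends_on_mono[OF depends_on_update[OF depends_on_pind]], auto)
  finally show ?thesis by (simp only: h1_def len)
qed

lemma bdd_meas_h1: "bdd_meas \<mu> (h1 \<sigma>)"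
  unfolding h1_def[abs_def] by (rule bdd_meas_update_integral[OF bdd_meas_pind])

lemma h1_bounds: "0 \<le> h1 \<sigma> x" "h1 \<sigma> x \<le> 1"
proof -
  show "0 \<le> h1 \<sigma> x" unfolding h1_def by (rule integral_nonneg_AE) (simp add: pind_bounds)
  have "h1 \<sigma> x \<le> (\<integral>z. 1 \<partial>Om)" unfolding h1_def
    by (rule integral_mono) (auto intro!: Om.bdd_meas_integrable bdd_meas_update bdd_meas_pind pind_bounds)
  then show "h1 \<sigma> x \<le> 1" by simp
qed

lemma expectation_h1:
  assumes "\<sigma> \<in> perms k" "k \<ge> 1"
  shows "(\<integral>x. h1 \<sigma> x \<partial>\<mu>) = CS \<mu> \<sigma>"
proof -
  have len: "length \<sigma> = k" using permsD assms by auto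
  show ?thesis
    unfolding CS_eq_expectation[OF assms(1)] h1_def len
    by (rule integral_Om_update[OF bdd_meas_pind, symmetric])
qed

text \<open>Given their only common point, the two pattern events are independent. For index 0 this
  identifies \<open>CS2\<close> with an inner product of conditional probabilities.\<close>

lemma expectation_pind_mult_overlap:
  assumes "\<sigma> \<in> perms k" "\<tau> \<in> perms j" "finite A" "finite B" "card A = k" "card B = j" "A \<inter> B = {i}"
  shows "(\<integral>z. pind \<sigma> A z * pind \<tau> B z \<partial>Om) = (\<integral>x. h1 \<sigma> x * h1 \<tau> x \<partial>\<mu>)"
proof -
  have i: "i \<in> A" "i \<in> B" using assms(7) by auto
  show ?thesis
    by (simp only: integral_Om_overlap[OF assms(3,7) bdd_meas_pind bdd_meas_pind depends_on_pind depends_on_pind]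
        h1_eq[OF assms(1,3,5) i(1)] h1_eq[OF assms(2,4,6) i(2)])
qed

lemma expectation_h1_mult:
  assumes "\<sigma> \<in> perms k" "\<tau> \<in> perms j" "k \<ge> 1" "j \<ge> 1"
  shows "(\<integral>x. h1 \<sigma> x * h1 \<tau> x \<partial>\<mu>) = CS2 \<mu> \<sigma> \<tau>"
  unfolding CS2_eq_expectation[OF assms]
  by (rule expectation_pind_mult_overlap[OF assms(1,2), of _ _ 0, symmetric]) (use assms in auto)

lemma CS_bounds: assumes "\<sigma> \<in> perms k" shows "0 \<le> CS \<mu> \<sigma>" "CS \<mu> \<sigma> \<le> 1"
proof -
  show "0 \<le> CS \<mu> \<sigma>" unfolding CS_def by simp
  have "CS \<mu> \<sigma> \<le> (\<integral>z. 1 \<partial>Om)" unfolding CS_eq_expectation[OF assms]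
    by (rule integral_mono) (auto intro!: Om.bdd_meas_integrable bdd_meas_pind pind_bounds)
  then show "CS \<mu> \<sigma> \<le> 1" by simp
qed

definition m1 :: "nat list \<Rightarrow> real \<times> real \<Rightarrow> real" where
  "m1 \<sigma> x = h1 \<sigma> x - CS \<mu> \<sigma>"

lemma bdd_meas_m1: "bdd_meas \<mu> (m1 \<sigma>)"
  unfolding m1_def[abs_def] by (intro bdd_meas_diff bdd_meas_h1 bdd_meas_const)

lemma m1_bound: "\<sigma> \<in> perms k \<Longrightarrow> \<bar>m1 \<sigma> x\<bar> \<le> 1"
  using h1_bounds[of \<sigma> x] CS_bounds[of \<sigma> k] by (auto simp: m1_def)

lemma expectation_m1: "\<sigma> \<in> perms k \<Longrightarrow> k \<ge> 1 \<Longrightarrow> (\<integral>x. m1 \<sigma> x \<partial>\<mu>) = 0"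
  unfolding m1_def
  by (subst Bochner_Integration.integral_diff) (auto simp: expectation_h1 intro!: bdd_meas_integrable bdd_meas_h1)

text \<open>This makes \<open>rho\<close> a Gram kernel, from which its symmetry and positive
  semidefiniteness follow.\<close>

lemma expectation_m1_mult:
  assumes "\<sigma> \<in> perms k" "\<tau> \<in> perms j" "k \<ge> 1" "j \<ge> 1"
  shows "(\<integral>x. m1 \<sigma> x * m1 \<tau> x \<partial>\<mu>) = rho \<mu> \<sigma> \<tau>"
proof -
  have "(\<integral>x. m1 \<sigma> x * m1 \<tau> x \<partial>\<mu>) =
      (\<integral>x. h1 \<sigma> x * h1 \<tau> x - CS \<mu> \<tau> * h1 \<sigma> x - CS \<mu> \<sigma> * m1 \<tau> x \<partial>\<mu>)"
    by (intro Bochner_Integration.integral_cong) (auto simp: m1_def algebra_simps)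
  also have "\<dots> = (\<integral>x. h1 \<sigma> x * h1 \<tau> x \<partial>\<mu>) - CS \<mu> \<tau> * (\<integral>x. h1 \<sigma> x \<partial>\<mu>) - CS \<mu> \<sigma> * (\<integral>x. m1 \<tau> x \<partial>\<mu>)"
    by (subst Bochner_Integration.integral_diff, (intro bdd_meas_integrable bdd_meas_diff bdd_meas_mult bdd_meas_h1 bdd_meas_m1 bdd_meas_const)+)
      (subst Bochner_Integration.integral_diff, (intro bdd_meas_integrable bdd_meas_diff bdd_meas_mult bdd_meas_h1 bdd_meas_m1 bdd_meas_const)+, simp)
  finally show ?thesis
    unfolding expectation_m1[OF assms(2,4)] expectation_h1[OF assms(1,3)] expectation_h1_mult[OF assms] rho_def
    by (simp add: mult.commute)
qed

end

section \<open>Weak convergence of copulas and pattern probabilities\<close>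

text \<open>For \<open>d > 0\<close> a continuous version of the indicator of
  \<open>u \<le> x\<close>: 1 up to \<open>x\<close>, 0 from \<open>x + d\<close> on, linear in
  between.\<close>

definition ramp :: "real \<Rightarrow> real \<Rightarrow> real \<Rightarrow> real" where
  "ramp d x u = max 0 (min 1 ((x + d - u) / d))"

lemma ramp_bounds: "0 \<le> ramp d x u" "ramp d x u \<le> 1"
  by (auto simp: ramp_def)

lemma ramp_approx: "d > 0 \<Longrightarrow> \<bar>ramp d x u - of_bool (u \<le> x)\<bar> \<le> of_bool (x < u \<and> u \<le> x + d)"
  by (auto simp: ramp_def min_def max_def field_simps)

lemma continuous_ramp [continuous_intros]:
  "continuous_on S f \<Longrightarrow> d > 0 \<Longrightarrow> continuous_on S (\<lambda>z. ramp d x (f z))"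
  unfolding ramp_def by (intro continuous_intros) auto

text \<open>The grid coordinates are not divided by \<open>N\<close>, since only their order
  matters; they are cast to reals so that \<open>pat\<close> applies to the moved points.\<close>

definition cell :: "nat \<Rightarrow> real \<times> real \<Rightarrow> real \<times> real" where
  "cell N z = (of_int \<lceil>real N * fst z\<rceil>, of_int \<lceil>real N * snd z\<rceil>)"

definition cells :: "nat \<Rightarrow> (real \<times> real) set" where
  "cells N = (\<lambda>(b, c). (of_int b, of_int c)) ` ({1..int N} \<times> {1..int N})"

lemma finite_cells [simp]: "finite (cells N)"
  by (simp add: cells_def)

section \<open>Approximation by ramps and by grid cells\<close>

context copula_space
begin

lemma abs_integral_diff_le:
  assumes "bdd_meas \<mu> f" "bdd_meas \<mu> g" "bdd_meas \<mu> h" "\<And>x. \<bar>f x - g x\<bar> \<le> h x"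
  shows "\<bar>(\<integral>x. f x \<partial>\<mu>) - (\<integral>x. g x \<partial>\<mu>)\<bar> \<le> (\<integral>x. h x \<partial>\<mu>)"
proof -
  have "(\<integral>x. f x \<partial>\<mu>) - (\<integral>x. g x \<partial>\<mu>) = (\<integral>x. f x - g x \<partial>\<mu>)"
    by (simp add: assms bdd_meas_integrable)
  also have "\<bar>\<dots>\<bar> \<le> (\<integral>x. \<bar>f x - g x\<bar> \<partial>\<mu>)" by (rule integral_abs_bound)
  also have "\<dots> \<le> (\<integral>x. h x \<partial>\<mu>)"
    by (rule integral_mono) (auto intro!: bdd_meas_integrable integrable_abs bdd_meas_diff assms)
  finally show ?thesis .
qed

lemma bdd_meas_of_bool: "Measurable.pred \<mu> P \<Longrightarrow> bdd_meas \<mu> (\<lambda>x. of_bool (P x))"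
  by (rule bdd_measI[of _ _ 1]) auto

lemma bdd_meas_ramp: "bdd_meas \<mu> (\<lambda>z. ramp d x (fst z) * ramp d y (snd z))"
proof (rule bdd_measI[of _ _ 1])
  show "(\<lambda>z. ramp d x (fst z) * ramp d y (snd z)) \<in> borel_measurable \<mu>"
    unfolding ramp_def by measurable
  show "\<bar>ramp d x (fst z) * ramp d y (snd z)\<bar> \<le> 1" for z
    using ramp_bounds[of d x "fst z"] ramp_bounds[of d y "snd z"]
    by (simp add: abs_mult mult_le_one)
qed

text \<open>The error is carried by two strips of width \<open>d\<close> just above the thresholds.
  Their mass is bounded through the uniform marginals, so the estimate is the same for every
  copula.\<close>

lemma expectation_ramp:
  assumes "0 \<le> x" "x \<le> 1" "0 \<le> y" "y \<le> 1" "d > 0"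
  shows "\<bar>(\<integral>z. ramp d x (fst z) * ramp d y (snd z) \<partial>\<mu>) - (\<integral>z. of_bool (fst z \<le> x \<and> snd z \<le> y) \<partial>\<mu>)\<bar> \<le> 2 * d"
proof -
  have "\<bar>(\<integral>z. ramp d x (fst z) * ramp d y (snd z) \<partial>\<mu>) - (\<integral>z. of_bool (fst z \<le> x \<and> snd z \<le> y) \<partial>\<mu>)\<bar>
    \<le> (\<integral>z. of_bool (x < fst z \<and> fst z \<le> x + d) + of_bool (y < snd z \<and> snd z \<le> y + d) \<partial>\<mu>)"
  proof (rule abs_integral_diff_le)
    fix z
    let ?a = "ramp d x (fst z)" and ?b = "ramp d y (snd z)"
    let ?a' = "of_bool (fst z \<le> x) :: real" and ?b' = "of_bool (snd z \<le> y) :: real"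
    \<comment> \<open>One factor is exchanged at a time; the other one lies between 0 and 1.\<close>
    have "\<bar>?a * ?b - ?a' * ?b'\<bar> = \<bar>(?a - ?a') * ?b + ?a' * (?b - ?b')\<bar>" by (simp add: algebra_simps)
    also have "\<dots> \<le> \<bar>?a - ?a'\<bar> * ?b + ?a' * \<bar>?b - ?b'\<bar>"
      using ramp_bounds[of d y "snd z"] by (intro order_trans[OF abs_triangle_ineq]) (simp add: abs_mult)
    also have "\<dots> \<le> \<bar>?a - ?a'\<bar> * 1 + 1 * \<bar>?b - ?b'\<bar>"
      using ramp_bounds[of d y "snd z"] by (intro add_mono mult_mono) auto
    also have "\<dots> \<le> of_bool (x < fst z \<and> fst z \<le> x + d) + of_bool (y < snd z \<and> snd z \<le> y + d)"
      using ramp_approx[OF assms(5), of x "fst z"] ramp_approx[OF assms(5), of y "snd z"] by simp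
    finally show "\<bar>?a * ?b - of_bool (fst z \<le> x \<and> snd z \<le> y)\<bar> \<le> of_bool (x < fst z \<and> fst z \<le> x + d) + of_bool (y < snd z \<and> snd z \<le> y + d)"
      by (simp add: of_bool_conj)
  qed (intro bdd_meas_ramp bdd_meas_add bdd_meas_of_bool; measurable)+
  also have "\<dots> = prob {z. x < fst z \<and> fst z \<le> x + d} + prob {z. y < snd z \<and> snd z \<le> y + d}"
  proof -
    have p: "Measurable.pred \<mu> (\<lambda>z. x < fst z \<and> fst z \<le> x + d)" "Measurable.pred \<mu> (\<lambda>z. y < snd z \<and> snd z \<le> y + d)"
      by measurable
    show ?thesis
      unfolding integral_of_bool[OF p(1), symmetric] integral_of_bool[OF p(2), symmetric]
      by (rule Bochner_Integration.integral_add[OF bdd_meas_integrable[OF bdd_meas_of_bool[OF p(1)]] bdd_meas_integrable[OF bdd_meas_of_bool[OF p(2)]]])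
  qed
  also have "\<dots> \<le> d + d"
    by (intro add_mono prob_marginal_interval uniform_marginal_fst uniform_marginal_snd) (use assms in auto)
  finally show ?thesis by simp
qed

lemma AE_marginal:
  assumes h: "uniform_marginal h" shows "AE z in \<mu>. 0 < h z \<and> h z \<le> 1"
proof -
  have s: "{z. h z \<le> 0} \<in> events" "{z. 1 < h z} \<in> events"
    using measurable_sets[OF uniform_marginal_measurable[OF h], of "{..0}"]
      measurable_sets[OF uniform_marginal_measurable[OF h], of "{1<..}"] by (simp_all add: vimage_def)
  have "AE z in \<mu>. z \<notin> {z. h z \<le> 0}" "AE z in \<mu>. z \<notin> {z. 1 < h z}"
    using prob_eq_0[OF s(1)] prob_eq_0[OF s(2)] prob_marginal_outside[OF h] by auto
  then show ?thesis by eventually_elim auto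
qed

lemma AE_cell:
  assumes "0 < N" shows "AE z in \<mu>. cell N z \<in> cells N"
  using AE_marginal[OF uniform_marginal_fst] AE_marginal[OF uniform_marginal_snd]
proof eventually_elim
  case (elim z)
  have "1 \<le> \<lceil>real N * u\<rceil> \<and> \<lceil>real N * u\<rceil> \<le> int N" if "0 < u" "u \<le> 1" for u
  proof
    have "0 < real N * u" using that assms by simp
    then show "1 \<le> \<lceil>real N * u\<rceil>" by linarith
    have "real N * u \<le> real N" using that by (simp add: mult_left_le)
    then show "\<lceil>real N * u\<rceil> \<le> int N" by linarith
  qed
  then show ?case using elim
    unfolding cell_def cells_def
    by (intro image_eqI[of _ _ "(\<lceil>real N * fst z\<rceil>, \<lceil>real N * snd z\<rceil>)"]) auto
qed

lemma AE_Om_cell: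
  assumes "0 < N" shows "AE z in Om. \<forall>i. cell N (z i) \<in> cells N"
proof -
  have "AE z in Om. cell N (z i) \<in> cells N" for i
    unfolding Om_def by (rule AE_PiM_component[OF prob_space_axioms UNIV_I AE_cell[OF assms]])
  then show ?thesis by (simp add: AE_all_countable)
qed

lemma measurable_cell: "cell N \<in> measurable \<mu> \<mu>"
proof -
  have "cell N \<in> borel_measurable \<mu>"
    unfolding cell_def[abs_def] by (intro borel_measurable_Pair) measurable
  then show ?thesis using measurable_cong_sets[OF refl sets_eq] by blast
qed

lemma pred_cell [measurable]: "Measurable.pred \<mu> (\<lambda>z. cell N z = c)"
  unfolding cell_def prod_eq_iff fst_conv snd_conv by measurable

lemma pred_Om_cell:
  assumes "Measurable.pred Om Q" shows "Measurable.pred Om (\<lambda>z. Q (\<lambda>i. cell N (z i)))"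
proof -
  have "(\<lambda>z i. cell N (z i)) \<in> measurable Om Om"
    by (rule measurable_OmI) (rule measurable_compose[OF measurable_Om_component measurable_cell])
  then show ?thesis using assms by (rule measurable_compose)
qed

text \<open>An event about discretised points is a finite disjoint union of cell configurations, so
  its probability is a polynomial in the cell probabilities.\<close>

lemma expectation_cells:
  assumes Q: "Measurable.pred Om Q" "depends_on Q {..<m}" and N: "0 < N"
  shows "(\<integral>z. of_bool (Q (\<lambda>i. cell N (z i))) \<partial>Om :: real) =
    (\<Sum>c\<in>PiE {..<m} (\<lambda>_. cells N). of_bool (Q c) * (\<Prod>i<m. \<integral>z. of_bool (cell N z = c i) \<partial>\<mu>))"
proof -
  let ?C = "PiE {..<m} (\<lambda>_. cells N)"
  have fin: "finite ?C" by (intro finite_PiE) auto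
  have int: "integrable Om (\<lambda>z. \<Prod>i<m. of_bool (cell N (z i) = c i) :: real)" for c
  proof (rule Om.bdd_meas_integrable, rule bdd_measI[of _ _ 1])
    show "(\<lambda>z. \<Prod>i<m. of_bool (cell N (z i) = c i) :: real) \<in> borel_measurable Om"
      by (intro borel_measurable_prod measurable_compose[OF measurable_Om_component]) measurable
    show "\<bar>\<Prod>i<m. of_bool (cell N (z i) = c i) :: real\<bar> \<le> 1" for z
      by (simp add: abs_prod prod_le_1)
  qed
  have "(\<integral>z. of_bool (Q (\<lambda>i. cell N (z i))) \<partial>Om) =
      (\<integral>z. (\<Sum>c\<in>?C. of_bool (Q c) * (\<Prod>i<m. of_bool (cell N (z i) = c i))) \<partial>Om :: real)"
  proof (rule integral_cong_AE)
    show "(\<lambda>z. of_bool (Q (\<lambda>i. cell N (z i))) :: real) \<in> borel_measurable Om"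
      using pred_Om_cell[OF Q(1)] by measurable
    show "(\<lambda>z. \<Sum>c\<in>?C. of_bool (Q c) * (\<Prod>i<m. of_bool (cell N (z i) = c i)) :: real) \<in> borel_measurable Om"
      by (intro borel_measurable_sum borel_measurable_times borel_measurable_const borel_measurable_integrable[OF int])
    show "AE z in Om. (of_bool (Q (\<lambda>i. cell N (z i))) :: real) =
        (\<Sum>c\<in>?C. of_bool (Q c) * (\<Prod>i<m. of_bool (cell N (z i) = c i)))"
      using AE_Om_cell[OF N]
    proof eventually_elim
      case (elim z)
      \<comment> \<open>The configuration of the sample; almost surely it is one of the summation
        indices, and then it contributes the only nonzero product.\<close>
      define c0 where "c0 = restrict (\<lambda>i. cell N (z i)) {..<m}"
      have c0: "c0 \<in> ?C" using elim by (auto simp: c0_def)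
      have Q0: "Q (\<lambda>i. cell N (z i)) = Q c0"
        by (rule depends_onD[OF Q(2)]) (simp add: c0_def)
      have "(\<Prod>i<m. of_bool (cell N (z i) = c i)) = (of_bool (c = c0) :: real)" if "c \<in> ?C" for c
      proof (cases "c = c0")
        case False
        have "\<not> (\<forall>i\<in>{..<m}. c i = c0 i)" using PiE_ext[OF that c0] False by blast
        then obtain i where "i < m" "c i \<noteq> c0 i" by auto
        then show ?thesis using False by (auto simp: c0_def intro!: bexI[of _ i])
      qed (auto simp: c0_def)
      then have "(\<Sum>c\<in>?C. of_bool (Q c) * (\<Prod>i<m. of_bool (cell N (z i) = c i))) =
          (\<Sum>c\<in>?C. of_bool (Q c) * (of_bool (c = c0) :: real))"
        by (intro sum.cong) auto
      also have "\<dots> = (\<Sum>c\<in>?C. if c = c0 then of_bool (Q c0) else 0)"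
        by (intro sum.cong) auto
      also have "\<dots> = of_bool (Q c0)" using fin c0 by (simp add: sum.delta)
      finally show ?case using Q0 by simp
    qed
  qed
  also have "\<dots> = (\<Sum>c\<in>?C. of_bool (Q c) * (\<integral>z. (\<Prod>i<m. of_bool (cell N (z i) = c i)) \<partial>Om))"
    by (subst Bochner_Integration.integral_sum) (auto intro!: int)
  also have "\<dots> = (\<Sum>c\<in>?C. of_bool (Q c) * (\<Prod>i<m. \<integral>z. of_bool (cell N z = c i) \<partial>\<mu>))"
  proof (rule sum.cong[OF refl])
    fix c
    have "(\<integral>z. (\<Prod>i<m. of_bool (cell N (z i) = c i) :: real) \<partial>Om) = (\<Prod>i<m. \<integral>z. of_bool (cell N z = c i) \<partial>\<mu>)"
      by (rule integral_Om_prod[of "{..<m}" "\<lambda>i z. of_bool (cell N z = c i)"])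
        (auto intro!: bdd_meas_integrable bdd_meas_of_bool)
    then show "of_bool (Q c) * (\<integral>z. (\<Prod>i<m. of_bool (cell N (z i) = c i)) \<partial>Om) =
        (of_bool (Q c) * (\<Prod>i<m. \<integral>z. of_bool (cell N z = c i) \<partial>\<mu>) :: real)" by simp
  qed
  finally show ?thesis .
qed

text \<open>Discretisation can change the event only on a grid tie, which keeps the error uniform
  over all copulas.\<close>

lemma expectation_cell_approx:
  assumes Q: "Measurable.pred Om Q" and N: "0 < N"
    and inv: "\<And>z. \<not> grid_tie N m z \<Longrightarrow> Q (\<lambda>i. cell N (z i)) \<longleftrightarrow> Q z"
  shows "\<bar>(\<integral>z. of_bool (Q z) \<partial>Om) - (\<integral>z. of_bool (Q (\<lambda>i. cell N (z i))) \<partial>Om)\<bar> \<le> 2 * (real m)^2 / real N"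
proof -
  have b: "bdd_meas Om (\<lambda>z. of_bool (P z) :: real)" if "Measurable.pred Om P" for P
    by (rule bdd_measI[of _ _ 1]) (use that in auto)
  have i: "integrable Om (\<lambda>z. of_bool (P z) :: real)" if "Measurable.pred Om P" for P
    by (rule Om.bdd_meas_integrable[OF b[OF that]])
  note Q' = pred_Om_cell[OF Q, of N]
  have "(\<integral>z. of_bool (Q z) \<partial>Om) - (\<integral>z. of_bool (Q (\<lambda>i. cell N (z i))) \<partial>Om) =
     (\<integral>z. of_bool (Q z) - of_bool (Q (\<lambda>i. cell N (z i))) \<partial>Om :: real)"
    using Bochner_Integration.integral_diff[OF i[OF Q] i[OF Q']] by simp
  also have "\<bar>\<dots>\<bar> \<le> (\<integral>z. \<bar>of_bool (Q z) - of_bool (Q (\<lambda>i. cell N (z i)))\<bar> \<partial>Om)"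
    by (rule integral_abs_bound)
  also have "\<dots> \<le> (\<integral>z. of_bool (grid_tie N m z) \<partial>Om)"
  proof (rule integral_mono)
    show "integrable Om (\<lambda>z. \<bar>of_bool (Q z) - of_bool (Q (\<lambda>i. cell N (z i))) :: real\<bar>)"
      by (intro integrable_abs Bochner_Integration.integrable_diff i Q Q')
    show "integrable Om (\<lambda>z. of_bool (grid_tie N m z) :: real)" by (rule i) measurable
    fix z show "\<bar>of_bool (Q z) - of_bool (Q (\<lambda>i. cell N (z i)))\<bar> \<le> (of_bool (grid_tie N m z) :: real)"
      using inv[of z] by (cases "grid_tie N m z") (auto simp: of_bool_def)
  qed
  also have "\<dots> \<le> 2 * (real m)^2 / real N" by (rule expectation_grid_tie[OF N])
  finally show ?thesis .
qed

text \<open>Rounding up is monotone, and strictly so between points in different rows or columns.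
  The case of equal coordinates covers the comparison of a point with itself.\<close>

lemma pat_cell_iff:
  assumes "\<not> grid_tie N m z" "A \<subseteq> {..<m}"
  shows "pat \<sigma> A (\<lambda>i. cell N (z i)) \<longleftrightarrow> pat \<sigma> A z"
proof (rule pat_cong_order)
  have *: "\<lceil>real N * u\<rceil> < \<lceil>real N * v\<rceil> \<longleftrightarrow> u < v" if "u = v \<or> \<lceil>real N * u\<rceil> \<noteq> \<lceil>real N * v\<rceil>" for u v
  proof
    assume "\<lceil>real N * u\<rceil> < \<lceil>real N * v\<rceil>"
    then have "\<not> real N * v \<le> real N * u" using ceiling_mono[of "real N * v" "real N * u"] by linarith
    then show "u < v" using mult_left_mono[of v u "real N"] by linarith
  next
    assume "u < v"
    then have "\<lceil>real N * u\<rceil> \<le> \<lceil>real N * v\<rceil>" by (intro ceiling_mono mult_left_mono) auto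
    with that \<open>u < v\<close> show "\<lceil>real N * u\<rceil> < \<lceil>real N * v\<rceil>" by auto
  qed
  fix a b assume "a \<in> A" "b \<in> A"
  then have ab: "a < m" "b < m" using assms(2) by auto
  have "fst (z a) = fst (z b) \<or> \<lceil>real N * fst (z a)\<rceil> \<noteq> \<lceil>real N * fst (z b)\<rceil>"
       "snd (z a) = snd (z b) \<or> \<lceil>real N * snd (z a)\<rceil> \<noteq> \<lceil>real N * snd (z b)\<rceil>"
    using assms(1) ab unfolding grid_tie_def by metis+
  then show "fst (cell N (z a)) < fst (cell N (z b)) \<longleftrightarrow> fst (z a) < fst (z b)"
    "snd (cell N (z a)) < snd (cell N (z b)) \<longleftrightarrow> snd (z a) < snd (z b)"
    by (simp_all add: cell_def *)
qed

text \<open>Inclusion-exclusion for a rectangle that is open on the left and below.\<close>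

lemma expectation_cell:
  assumes "0 < N" "b \<in> {1..int N}" "c \<in> {1..int N}"
  defines "H \<equiv> \<lambda>x y. \<integral>z. of_bool (fst z \<le> x \<and> snd z \<le> y) \<partial>\<mu> :: real"
  shows "(\<integral>z. of_bool (cell N z = (of_int b, of_int c)) \<partial>\<mu>) =
    H (real_of_int b / real N) (real_of_int c / real N) - H ((real_of_int b - 1) / real N) (real_of_int c / real N) - H (real_of_int b / real N) ((real_of_int c - 1) / real N) + H ((real_of_int b - 1) / real N) ((real_of_int c - 1) / real N)"
proof -
  have ce: "\<lceil>real N * u\<rceil> = a \<longleftrightarrow> u \<le> real_of_int a / real N \<and> \<not> u \<le> (real_of_int a - 1) / real N" for u and a :: int
    using assms(1) by (auto simp: ceiling_eq_iff field_simps)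
  have le: "(a - 1) / N \<le> a / N" for a :: real by (simp add: divide_right_mono)
  have "(\<integral>z. of_bool (cell N z = (of_int b, of_int c)) \<partial>\<mu> :: real) =
    (\<integral>z. of_bool (fst z \<le> real_of_int b / real N \<and> snd z \<le> real_of_int c / real N) - of_bool (fst z \<le> (real_of_int b - 1) / real N \<and> snd z \<le> real_of_int c / real N)
      - of_bool (fst z \<le> real_of_int b / real N \<and> snd z \<le> (real_of_int c - 1) / real N) + of_bool (fst z \<le> (real_of_int b - 1) / real N \<and> snd z \<le> (real_of_int c - 1) / real N) \<partial>\<mu>)" (is "_ = ?I")
  proof (rule Bochner_Integration.integral_cong[OF refl])
    fix z
    have "fst z \<le> (real_of_int b - 1) / real N \<Longrightarrow> fst z \<le> real_of_int b / real N" "snd z \<le> (real_of_int c - 1) / real N \<Longrightarrow> snd z \<le> real_of_int c / real N"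
      using le[of "real_of_int b"] le[of "real_of_int c"] by auto
    then show "of_bool (cell N z = (of_int b, of_int c)) = (of_bool (fst z \<le> real_of_int b / real N \<and> snd z \<le> real_of_int c / real N) - of_bool (fst z \<le> (real_of_int b - 1) / real N \<and> snd z \<le> real_of_int c / real N)
      - of_bool (fst z \<le> real_of_int b / real N \<and> snd z \<le> (real_of_int c - 1) / real N) + of_bool (fst z \<le> (real_of_int b - 1) / real N \<and> snd z \<le> (real_of_int c - 1) / real N) :: real)"
      unfolding cell_def prod.inject of_int_eq_iff ce
      by (cases "fst z \<le> real_of_int b / real N"; cases "fst z \<le> (real_of_int b - 1) / real N"; cases "snd z \<le> real_of_int c / real N"; cases "snd z \<le> (real_of_int c - 1) / real N") simp_all
  qed
  also have "?I = H (real_of_int b / real N) (real_of_int c / real N) - H ((real_of_int b - 1) / real N) (real_of_int c / real N) - H (real_of_int b / real N) ((real_of_int c - 1) / real N) + H ((real_of_int b - 1) / real N) ((real_of_int c - 1) / real N)"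
  proof -
    have i: "integrable \<mu> (\<lambda>z. of_bool (fst z \<le> x \<and> snd z \<le> y) :: real)" for x y
      by (intro bdd_meas_integrable bdd_meas_of_bool) measurable
    show ?thesis unfolding H_def
      by (simp add: i Bochner_Integration.integral_add Bochner_Integration.integral_diff
          Bochner_Integration.integrable_diff)
  qed
  finally show ?thesis .
qed

end

section \<open>Limits of pattern probabilities along weakly convergent copulas\<close>

locale copula_limit =
  fixes \<mu> :: "nat \<Rightarrow> (real \<times> real) measure" and \<nu>
  assumes copulas: "\<And>n. copula (\<mu> n)" "copula \<nu>" and weak_conv: "weak_conv2 \<mu> \<nu>"
begin

sublocale C: copula_space "\<mu> n" for n by unfold_locales (rule copulas)
sublocale L: copula_space \<nu> by unfold_locales (rule copulas)

text \<open>The ramp error is uniform in \<open>n\<close> and also holds for the limit, so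
  \<open>d\<close> can be fixed before weak convergence is applied to the ramps.\<close>

lemma cdf_limit:
  assumes xy: "0 \<le> x" "x \<le> 1" "0 \<le> y" "y \<le> 1"
  shows "(\<lambda>n. \<integral>z. of_bool (fst z \<le> x \<and> snd z \<le> y) \<partial>\<mu> n) \<longlonglongrightarrow> (\<integral>z. of_bool (fst z \<le> x \<and> snd z \<le> y) \<partial>\<nu> :: real)"
proof (rule LIMSEQ_I)
  fix e :: real assume e: "e > 0"
  \<comment> \<open>Two ramp errors of \<open>2 * d\<close> each and one \<open>d\<close> from weak
    convergence.\<close>
  define d where "d = e / 5"
  have d: "d > 0" using e by (simp add: d_def)
  let ?r = "\<lambda>z :: real \<times> real. ramp d x (fst z) * ramp d y (snd z)"
  have "continuous_on UNIV ?r" by (intro continuous_intros d)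
  moreover have "bounded (range ?r)"
    unfolding bounded_iff using ramp_bounds
    by (intro exI[of _ 1]) (auto simp: abs_mult mult_le_one)
  ultimately have "(\<lambda>n. \<integral>z. ?r z \<partial>\<mu> n) \<longlonglongrightarrow> (\<integral>z. ?r z \<partial>\<nu>)"
    using weak_conv unfolding weak_conv2_def by blast
  from LIMSEQ_D[OF this d] obtain n0 where n0: "\<And>n. n \<ge> n0 \<Longrightarrow> \<bar>(\<integral>z. ?r z \<partial>\<mu> n) - (\<integral>z. ?r z \<partial>\<nu>)\<bar> < d"
    unfolding real_norm_def by blast
  show "\<exists>n0. \<forall>n\<ge>n0. norm ((\<integral>z. of_bool (fst z \<le> x \<and> snd z \<le> y) \<partial>\<mu> n) - (\<integral>z. of_bool (fst z \<le> x \<and> snd z \<le> y) \<partial>\<nu> :: real)) < e"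
  proof (intro exI allI impI)
    fix n assume "n \<ge> n0"
    from n0[OF this] C.expectation_ramp[of x y d n] L.expectation_ramp[of x y d] xy d
    show "norm ((\<integral>z. of_bool (fst z \<le> x \<and> snd z \<le> y) \<partial>\<mu> n) - (\<integral>z. of_bool (fst z \<le> x \<and> snd z \<le> y) \<partial>\<nu> :: real)) < e"
      unfolding d_def real_norm_def by linarith
  qed
qed

lemma cell_limit:
  assumes N: "0 < N" and c: "c \<in> cells N"
  shows "(\<lambda>n. \<integral>z. of_bool (cell N z = c) \<partial>\<mu> n) \<longlonglongrightarrow> (\<integral>z. of_bool (cell N z = c) \<partial>\<nu> :: real)"
proof -
  obtain a b where ab: "c = (of_int a, of_int b)" "a \<in> {1..int N}" "b \<in> {1..int N}"
    using c by (auto simp: cells_def)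
  have r: "0 \<le> (real_of_int d - 1) / real N" "(real_of_int d - 1) / real N \<le> 1" "0 \<le> real_of_int d / real N" "real_of_int d / real N \<le> 1" if "d \<in> {1..int N}" for d :: int
  proof -
    have "1 \<le> real_of_int d" "real_of_int d \<le> real N" using that by auto
    then show "0 \<le> (real_of_int d - 1) / real N" "(real_of_int d - 1) / real N \<le> 1" "0 \<le> real_of_int d / real N" "real_of_int d / real N \<le> 1" using N by (auto simp: field_simps)
  qed
  show ?thesis
    unfolding ab(1) C.expectation_cell[OF N ab(2,3)] L.expectation_cell[OF N ab(2,3)]
    by (intro tendsto_intros cdf_limit r ab)
qed

text \<open>The discretisation error does not depend on \<open>n\<close>, so the grid is fixed
  first; for a fixed grid only finitely many cell probabilities have to converge.\<close>

lemma order_event_limit: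
  assumes Q: "\<And>n. Measurable.pred (C.Om n) Q" "Measurable.pred L.Om Q" and dep: "depends_on Q {..<m}"
    and inv: "\<And>N z. \<not> L.grid_tie N m z \<Longrightarrow> Q (\<lambda>i. cell N (z i)) \<longleftrightarrow> Q z"
  shows "(\<lambda>n. \<integral>z. of_bool (Q z) \<partial>C.Om n) \<longlonglongrightarrow> (\<integral>z. of_bool (Q z) \<partial>L.Om :: real)"
proof (rule LIMSEQ_I)
  fix e :: real assume e: "e > 0"
  \<comment> \<open>Chosen to keep each of the two discretisation errors below
    \<open>e / 3\<close>.\<close>
  obtain N where N: "real N > 6 * (real m)^2 / e + 1" using reals_Archimedean2 by blast
  have "0 \<le> 6 * (real m)^2 / e" using e by simp
  then have N0: "0 < N" using N by (metis add_nonneg_pos le_less_trans less_numeral_extra(1) not_less of_nat_0_less_iff order_less_imp_le)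
  have bd: "2 * (real m)^2 / real N < e / 3"
  proof -
    have "6 * (real m)^2 / e < real N" using N by simp
    then have "6 * (real m)^2 < real N * e" using e by (simp add: field_simps)
    then show ?thesis using N0 by (simp add: field_simps)
  qed
  have "(\<lambda>n. \<integral>z. of_bool (Q (\<lambda>i. cell N (z i))) \<partial>C.Om n) \<longlonglongrightarrow> (\<integral>z. of_bool (Q (\<lambda>i. cell N (z i))) \<partial>L.Om :: real)"
    unfolding C.expectation_cells[OF Q(1) dep N0] L.expectation_cells[OF Q(2) dep N0]
    by (intro tendsto_intros cell_limit[OF N0]) auto
  then obtain n0 where n0: "\<And>n. n \<ge> n0 \<Longrightarrow> \<bar>(\<integral>z. of_bool (Q (\<lambda>i. cell N (z i))) \<partial>C.Om n) - (\<integral>z. of_bool (Q (\<lambda>i. cell N (z i))) \<partial>L.Om :: real)\<bar> < e / 3"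
    using LIMSEQ_D[of _ _ "e / 3"] e by (metis real_norm_def zero_less_divide_iff zero_less_numeral)
  show "\<exists>n0. \<forall>n\<ge>n0. norm ((\<integral>z. of_bool (Q z) \<partial>C.Om n) - (\<integral>z. of_bool (Q z) \<partial>L.Om :: real)) < e"
  proof (intro exI allI impI)
    fix n assume "n \<ge> n0"
    from n0[OF this] C.expectation_cell_approx[OF Q(1) N0 inv, of m n] L.expectation_cell_approx[OF Q(2) N0 inv, of m] bd
    show "norm ((\<integral>z. of_bool (Q z) \<partial>C.Om n) - (\<integral>z. of_bool (Q z) \<partial>L.Om :: real)) < e"
      unfolding real_norm_def by linarith
  qed
qed

lemma pat_pair_limit:
  assumes "A \<subseteq> {..<m}" "B \<subseteq> {..<m}"
  shows "(\<lambda>n. \<integral>z. L.pind \<sigma> A z * L.pind \<tau> B z \<partial>C.Om n) \<longlonglongrightarrow> (\<integral>z. L.pind \<sigma> A z * L.pind \<tau> B z \<partial>L.Om)"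
proof -
  have eq: "L.pind \<sigma> A z * L.pind \<tau> B z = of_bool (pat \<sigma> A z \<and> pat \<tau> B z)" for z
    by (simp add: L.pind_def)
  show ?thesis unfolding eq
  proof (rule order_event_limit[of _ m])
    show "depends_on (\<lambda>z. pat \<sigma> A z \<and> pat \<tau> B z) {..<m}" by (rule L.depends_on_conj_pat[OF assms])
  qed (auto simp: L.pat_cell_iff assms)
qed

lemma CS_limit:
  assumes "\<sigma> \<in> Sall" shows "(\<lambda>n. CS (\<mu> n) \<sigma>) \<longlonglongrightarrow> CS \<nu> \<sigma>"
proof -
  \<comment> \<open>Indicators are idempotent, so one pattern is treated as a pair with
    itself.\<close>
  have eq: "(\<lambda>z. L.pind \<sigma> A z * L.pind \<sigma> A z) = L.pind \<sigma> A" for A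
    by (auto simp: L.pind_def fun_eq_iff)
  show ?thesis
    unfolding C.CS_eq_expectation[OF Sall_perms[OF assms]] L.CS_eq_expectation[OF Sall_perms[OF assms]]
    using pat_pair_limit[of "{..<length \<sigma>}" "length \<sigma>" "{..<length \<sigma>}" \<sigma> \<sigma>] unfolding eq by simp
qed

lemma rho_limit:
  assumes "\<sigma> \<in> Sall" "\<tau> \<in> Sall" shows "(\<lambda>n. rho (\<mu> n) \<sigma> \<tau>) \<longlonglongrightarrow> rho \<nu> \<sigma> \<tau>"
proof -
  have len: "length \<sigma> \<ge> 1" "length \<tau> \<ge> 1" using assms by (auto simp: Sall_def)
  have "(\<lambda>n. CS2 (\<mu> n) \<sigma> \<tau>) \<longlonglongrightarrow> CS2 \<nu> \<sigma> \<tau>"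
    unfolding C.CS2_eq_expectation[OF Sall_perms[OF assms(1)] Sall_perms[OF assms(2)] len]
      L.CS2_eq_expectation[OF Sall_perms[OF assms(1)] Sall_perms[OF assms(2)] len]
    by (rule pat_pair_limit[of _ "length \<sigma> + length \<tau> - 1"]) (use len in auto)
  then show ?thesis
    unfolding rho_def by (intro tendsto_intros CS_limit assms)
qed

end

section \<open>Second moments of U-statistics\<close>

lemma card_subsets_containing:
  assumes "finite X" "D \<subseteq> X" "card D = r" "r \<le> k"
  shows "card {A. A \<subseteq> X \<and> card A = k \<and> D \<subseteq> A} = (card X - r) choose (k - r)"
proof -
  have finD: "finite D" using assms(1,2) finite_subset by blast
  have "bij_betw (\<lambda>B. B \<union> D) {B. B \<subseteq> X - D \<and> card B = k - r} {A. A \<subseteq> X \<and> card A = k \<and> D \<subseteq> A}"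
  proof (rule bij_betw_byWitness[where f' = "\<lambda>A. A - D"])
    show "(\<lambda>B. B \<union> D) ` {B. B \<subseteq> X - D \<and> card B = k - r} \<subseteq> {A. A \<subseteq> X \<and> card A = k \<and> D \<subseteq> A}"
    proof safe
      fix B assume B: "B \<subseteq> X - D" "card B = k - r"
      then have "finite B" using assms(1) by (meson finite_Diff finite_subset)
      then have "card (B \<union> D) = card B + card D"
        using B finD by (intro card_Un_disjoint) auto
      then show "card (B \<union> D) = k" using B assms by simp
    qed (use assms in auto)
    show "(\<lambda>A. A - D) ` {A. A \<subseteq> X \<and> card A = k \<and> D \<subseteq> A} \<subseteq> {B. B \<subseteq> X - D \<and> card B = k - r}"
      using assms finD by (auto simp: card_Diff_subset)
  qed auto
  then have "card {A. A \<subseteq> X \<and> card A = k \<and> D \<subseteq> A} = card {B. B \<subseteq> X - D \<and> card B = k - r}"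
    by (simp add: bij_betw_same_card)
  also have "\<dots> = card (X - D) choose (k - r)"
    using assms by (intro n_subsets) auto
  also have "card (X - D) = card X - r" using assms finD by (simp add: card_Diff_subset)
  finally show ?thesis .
qed

abbreviation ksubsets :: "nat \<Rightarrow> nat \<Rightarrow> nat set set" where
  "ksubsets n k \<equiv> {A. A \<subseteq> {..<n} \<and> card A = k}"

lemma card_ksubsets: "card (ksubsets n k) = n choose k"
  using n_subsets[of "{..<n}" k] by simp

text \<open>If two sets share at least \<open>r\<close> points, both contain some
  \<open>r\<close>-set \<open>D\<close>. Summing over \<open>D\<close> factors the double count into
  a square, and \<open>(n choose k) * (k choose r) = (n choose r) * ((n - r) choose (k - r))\<close>
  gives the stated form.\<close>

lemma card_overlapping_pairs:
  assumes "k \<le> n"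
  shows "(\<Sum>A\<in>ksubsets n k. \<Sum>B\<in>ksubsets n k. of_bool (r \<le> card (A \<inter> B)) :: real)
    \<le> (real (n choose k) * real (k choose r))^2 / real (n choose r)"
proof (cases "r \<le> k")
  \<comment> \<open>Here both sides are 0. The case occurs for patterns of length 1 with
    \<open>r = 2\<close>.\<close>
  case False
  have "card (A \<inter> B) < r" if "A \<in> ksubsets n k" for A B
  proof -
    have "card (A \<inter> B) \<le> card A" using that by (intro card_mono) (auto intro: finite_subset)
    with False that show ?thesis by auto
  qed
  then have "(\<Sum>A\<in>ksubsets n k. \<Sum>B\<in>ksubsets n k. of_bool (r \<le> card (A \<inter> B)) :: real) = 0"
    by (intro sum.neutral ballI) (simp add: not_le)
  then show ?thesis by simp
next
  case True
  have 1: "(of_bool (r \<le> card (A \<inter> B)) :: real) \<le> (\<Sum>D\<in>ksubsets n r. of_bool (D \<subseteq> A) * of_bool (D \<subseteq> B))"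
    if AB: "A \<in> ksubsets n k" for A B
  proof (cases "r \<le> card (A \<inter> B)")
    case True
    then obtain D where D: "D \<subseteq> A \<inter> B" "card D = r"
      by (meson obtain_subset_with_card_n)
    then have "D \<in> ksubsets n r" using AB by auto
    then have "(of_bool (D \<subseteq> A) * of_bool (D \<subseteq> B) :: real) \<le> (\<Sum>D\<in>ksubsets n r. of_bool (D \<subseteq> A) * of_bool (D \<subseteq> B))"
      by (intro member_le_sum) auto
    then show ?thesis using D by simp
  qed (simp add: sum_nonneg)
  have "(\<Sum>A\<in>ksubsets n k. \<Sum>B\<in>ksubsets n k. of_bool (r \<le> card (A \<inter> B)) :: real) \<le>
     (\<Sum>A\<in>ksubsets n k. \<Sum>B\<in>ksubsets n k. \<Sum>D\<in>ksubsets n r. of_bool (D \<subseteq> A) * of_bool (D \<subseteq> B))"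
    by (intro sum_mono 1)
  also have "\<dots> = (\<Sum>A\<in>ksubsets n k. \<Sum>D\<in>ksubsets n r. \<Sum>B\<in>ksubsets n k. of_bool (D \<subseteq> A) * of_bool (D \<subseteq> B))"
    by (intro sum.cong refl sum.swap)
  also have "\<dots> = (\<Sum>D\<in>ksubsets n r. \<Sum>A\<in>ksubsets n k. \<Sum>B\<in>ksubsets n k. of_bool (D \<subseteq> A) * of_bool (D \<subseteq> B))"
    by (rule sum.swap)
  also have "\<dots> = (\<Sum>D\<in>ksubsets n r. (\<Sum>A\<in>ksubsets n k. of_bool (D \<subseteq> A)) ^ 2)"
    by (intro sum.cong refl) (simp only: power2_eq_square sum_product)
  also have "\<dots> = (\<Sum>D\<in>ksubsets n r. real ((n - r) choose (k - r)) ^ 2)"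
  proof (intro sum.cong refl arg_cong[where f="\<lambda>x. x ^ 2"])
    fix D assume D: "D \<in> ksubsets n r"
    have "(\<Sum>A\<in>ksubsets n k. of_bool (D \<subseteq> A)) = real (card (ksubsets n k \<inter> {A. D \<subseteq> A}))"
      by simp
    also have "ksubsets n k \<inter> {A. D \<subseteq> A} = {A. A \<subseteq> {..<n} \<and> card A = k \<and> D \<subseteq> A}" by auto
    also have "real (card \<dots>) = real ((n - r) choose (k - r))"
      using card_subsets_containing[of "{..<n}" D r k] D True by simp
    finally show "(\<Sum>A\<in>ksubsets n k. of_bool (D \<subseteq> A)) = real ((n - r) choose (k - r))" .
  qed
  also have "\<dots> = real (n choose r) * real ((n - r) choose (k - r)) ^ 2"
    by (simp add: card_ksubsets)
  also have "\<dots> = (real (n choose k) * real (k choose r))^2 / real (n choose r)"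
  proof -
    have "real (n choose k) * real (k choose r) = real (n choose r) * real ((n - r) choose (k - r))"
      using choose_mult[OF True assms] by (simp flip: of_nat_mult)
    moreover have "real (n choose r) > 0" using True assms by simp
    ultimately show ?thesis by (simp add: power2_eq_square)
  qed
  finally show ?thesis .
qed

context iid
begin

text \<open>Expanding the square leaves only pairs with at least \<open>r\<close> common indices,
  each worth at most \<open>c^2\<close>; such pairs are counted by
  \<open>card_overlapping_pairs\<close>.\<close>

lemma expectation_subset_average_square:
  assumes kn: "k \<le> n" and Q: "\<And>A. A \<in> ksubsets n k \<Longrightarrow> bdd_meas Om (Q A)"
    and c: "\<And>A z. A \<in> ksubsets n k \<Longrightarrow> \<bar>Q A z\<bar> \<le> c"
    and orth: "\<And>A B. A \<in> ksubsets n k \<Longrightarrow> B \<in> ksubsets n k \<Longrightarrow> card (A \<inter> B) < r \<Longrightarrow> (\<integral>z. Q A z * Q B z \<partial>Om) = 0"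
  shows "(\<integral>z. ((\<Sum>A\<in>ksubsets n k. Q A z) / real (n choose k))^2 \<partial>Om) \<le> c^2 * real (k choose r)^2 / real (n choose r)"
proof -
  let ?S = "ksubsets n k"
  have pos: "real (n choose k) > 0" using kn by simp
  have int: "integrable Om (\<lambda>z. Q A z * Q B z)" if "A \<in> ?S" "B \<in> ?S" for A B
    by (rule Om.bdd_meas_integrable[OF bdd_meas_mult[OF Q[OF that(1)] Q[OF that(2)]]])
  have le: "(\<integral>z. Q A z * Q B z \<partial>Om) \<le> c^2 * of_bool (r \<le> card (A \<inter> B))" if AB: "A \<in> ?S" "B \<in> ?S" for A B
  proof (cases "card (A \<inter> B) < r")
    case False
    have "(\<integral>z. Q A z * Q B z \<partial>Om) \<le> (\<integral>z. c^2 \<partial>Om)"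
    proof (rule integral_mono[OF int[OF AB]])
      fix z
      have "Q A z * Q B z \<le> \<bar>Q A z\<bar> * \<bar>Q B z\<bar>" by (simp flip: abs_mult)
      also have "\<dots> \<le> c * c"
        using c[OF AB(1), of z] c[OF AB(2), of z] by (intro mult_mono) auto
      finally show "Q A z * Q B z \<le> c^2" by (simp add: power2_eq_square)
    qed simp
    then show ?thesis using False by simp
  qed (simp add: orth[OF AB])
  have "(\<integral>z. (\<Sum>A\<in>?S. Q A z)^2 \<partial>Om) = (\<integral>z. (\<Sum>A\<in>?S. \<Sum>B\<in>?S. Q A z * Q B z) \<partial>Om)"
    by (simp only: power2_eq_square sum_product)
  also have "\<dots> = (\<Sum>A\<in>?S. \<Sum>B\<in>?S. \<integral>z. Q A z * Q B z \<partial>Om)"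
  proof -
    have "(\<integral>z. (\<Sum>A\<in>?S. \<Sum>B\<in>?S. Q A z * Q B z) \<partial>Om) = (\<Sum>A\<in>?S. \<integral>z. (\<Sum>B\<in>?S. Q A z * Q B z) \<partial>Om)"
      by (rule Bochner_Integration.integral_sum) (intro Bochner_Integration.integrable_sum int)
    also have "\<dots> = (\<Sum>A\<in>?S. \<Sum>B\<in>?S. \<integral>z. Q A z * Q B z \<partial>Om)"
      by (intro sum.cong refl Bochner_Integration.integral_sum int)
    finally show ?thesis .
  qed
  also have "\<dots> \<le> (\<Sum>A\<in>?S. \<Sum>B\<in>?S. c^2 * of_bool (r \<le> card (A \<inter> B)))"
    by (intro sum_mono le)
  also have "\<dots> = c^2 * (\<Sum>A\<in>?S. \<Sum>B\<in>?S. of_bool (r \<le> card (A \<inter> B)))"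
    by (simp only: sum_distrib_left)
  also have "\<dots> \<le> c^2 * ((real (n choose k) * real (k choose r))^2 / real (n choose r))"
    by (intro mult_left_mono card_overlapping_pairs kn) simp
  finally have "(\<integral>z. (\<Sum>A\<in>?S. Q A z)^2 \<partial>Om) / real (n choose k)^2 \<le>
      c^2 * ((real (n choose k) * real (k choose r))^2 / real (n choose r)) / real (n choose k)^2"
    by (rule divide_right_mono) simp
  also have "\<dots> = c^2 * real (k choose r)^2 / real (n choose r)"
    using pos by (simp add: power_mult_distrib)
  finally show ?thesis by (simp add: power_divide)
qed

end

section \<open>Pattern frequencies and their projection on sums over single points\<close>

context copula_space
begin

definition tfreq :: "nat \<Rightarrow> nat list \<Rightarrow> (nat \<Rightarrow> real \<times> real) \<Rightarrow> real" where
  "tfreq n \<sigma> z = (\<Sum>A\<in>ksubsets n (length \<sigma>). pind \<sigma> A z) / real (n choose length \<sigma>)"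

lemma bdd_meas_tfreq: "bdd_meas Om (tfreq n \<sigma>)"
  unfolding tfreq_def[abs_def] divide_inverse
  by (intro bdd_meas_mult bdd_meas_sum bdd_meas_pind bdd_meas_const)

lemma pfreq_eq_tfreq:
  assumes "no_ties n z" "\<sigma> \<in> Sall" "length \<sigma> \<le> n"
  shows "pfreq (sample_perm n z) \<sigma> = tfreq n \<sigma> z"
proof -
  have "(\<Sum>A\<in>ksubsets n (length \<sigma>). pind \<sigma> A z) = real (card (ksubsets n (length \<sigma>) \<inter> {A. pat \<sigma> A z}))"
    unfolding pind_def by simp
  also have "ksubsets n (length \<sigma>) \<inter> {A. pat \<sigma> A z} = {B. B \<subseteq> {..<n} \<and> card B = length \<sigma> \<and> pat \<sigma> B z}" by auto
  finally show ?thesis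
    by (simp add: tfreq_def pfreq_sample_perm[OF assms(1) Sall_perms[OF assms(2)] assms(3)])
qed

lemma average_diff_const:
  assumes "k \<le> n"
  shows "(\<Sum>A\<in>ksubsets n k. f A) / real (n choose k) - c = (\<Sum>A\<in>ksubsets n k. f A - c) / real (n choose k)"
  using assms by (simp add: sum_subtractf card_ksubsets field_simps)

text \<open>The case \<open>r = 1\<close>: centred indicators on disjoint index sets are
  independent. The factor \<open>k^2\<close> is exactly what the normalisation by the pattern length
  cancels.\<close>

lemma expectation_tfreq_deviation:
  assumes \<sigma>: "\<sigma> \<in> perms k" and kn: "k \<le> n"
  shows "(\<integral>z. (tfreq n \<sigma> z - CS \<mu> \<sigma>)^2 \<partial>Om) \<le> (real k)^2 / real n"
proof -
  have len: "length \<sigma> = k" using permsD[OF \<sigma>] by simp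
  have fin: "finite A" if "A \<in> ksubsets n k" for A using that by (auto intro: finite_subset)
  have E0: "(\<integral>z. pind \<sigma> A z - CS \<mu> \<sigma> \<partial>Om) = 0" if "A \<in> ksubsets n k" for A
    using that fin[OF that]
    by (simp add: Om.bdd_meas_integrable bdd_meas_pind expectation_pind[OF \<sigma>])
  have "(\<integral>z. ((\<Sum>A\<in>ksubsets n k. pind \<sigma> A z - CS \<mu> \<sigma>) / real (n choose k))^2 \<partial>Om)
     \<le> 1^2 * real (k choose 1)^2 / real (n choose 1)"
  proof (rule expectation_subset_average_square[OF kn])
    show "bdd_meas Om (\<lambda>z. pind \<sigma> A z - CS \<mu> \<sigma>)" for A
      by (intro bdd_meas_diff bdd_meas_pind bdd_meas_const)
    show "\<bar>pind \<sigma> A z - CS \<mu> \<sigma>\<bar> \<le> 1" for A z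
      using pind_bounds[of \<sigma> A z] CS_bounds[OF \<sigma>] by linarith
    fix A B assume AB: "A \<in> ksubsets n k" "B \<in> ksubsets n k" "card (A \<inter> B) < 1"
    then have "A \<inter> B = {}" using fin[OF AB(1)] by (simp add: card_eq_0_iff)
    then have "(\<integral>z. (pind \<sigma> A z - CS \<mu> \<sigma>) * (pind \<sigma> B z - CS \<mu> \<sigma>) \<partial>Om) =
       (\<integral>z. pind \<sigma> A z - CS \<mu> \<sigma> \<partial>Om) * (\<integral>z. pind \<sigma> B z - CS \<mu> \<sigma> \<partial>Om)"
      using depends_on_pind[of \<sigma> A] depends_on_mono[OF depends_on_pind[of \<sigma> B], of "- A"]
      by (intro integral_Om_indep[OF fin[OF AB(1)]] bdd_meas_diff bdd_meas_pind bdd_meas_const)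
        (auto simp: depends_on_def)
    then show "(\<integral>z. (pind \<sigma> A z - CS \<mu> \<sigma>) * (pind \<sigma> B z - CS \<mu> \<sigma>) \<partial>Om) = 0"
      by (simp add: E0[OF AB(1)])
  qed
  then show ?thesis by (simp add: tfreq_def len average_diff_const[OF kn])
qed

text \<open>What is left of the centred indicator after subtracting its Hajek projection.\<close>

definition hrem :: "nat list \<Rightarrow> nat set \<Rightarrow> (nat \<Rightarrow> real \<times> real) \<Rightarrow> real" where
  "hrem \<sigma> A z = pind \<sigma> A z - CS \<mu> \<sigma> - (\<Sum>i\<in>A. m1 \<sigma> (z i))"

lemma bdd_meas_hrem: "bdd_meas Om (hrem \<sigma> A)"
  unfolding hrem_def[abs_def]
  by (intro bdd_meas_diff bdd_meas_pind bdd_meas_const bdd_meas_sum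
      bdd_meas_compose[OF bdd_meas_m1 measurable_Om_component])

lemma depends_on_hrem: "depends_on (hrem \<sigma> A) A"
  unfolding depends_on_def hrem_def
  by (intro allI impI arg_cong2[where f="(-)"] depends_onD[OF depends_on_pind] sum.cong) auto

lemma integrable_m1: "integrable \<mu> (m1 \<sigma>)" "integrable Om (\<lambda>z. m1 \<sigma> (z i))"
  by (intro bdd_meas_integrable Om.bdd_meas_integrable bdd_meas_m1 bdd_meas_compose[OF bdd_meas_m1 measurable_Om_component])+

lemma expectation_Om_m1: "\<sigma> \<in> perms k \<Longrightarrow> k \<ge> 1 \<Longrightarrow> (\<integral>z. m1 \<sigma> (z i) \<partial>Om) = 0"
  by (subst integral_Om_component) (auto simp: expectation_m1 intro!: bdd_meas_measurable bdd_meas_m1)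

lemma expectation_hrem:
  assumes \<sigma>: "\<sigma> \<in> perms k" "k \<ge> 1" and A: "finite A" "card A = k"
  shows "(\<integral>z. hrem \<sigma> A z \<partial>Om) = 0"
  unfolding hrem_def
  by (simp add: Om.bdd_meas_integrable bdd_meas_pind integrable_m1
      Bochner_Integration.integral_sum expectation_Om_m1[OF \<sigma>] expectation_pind[OF \<sigma>(1) A])

text \<open>Given point \<open>i\<close>, the indicator has mean \<open>h1 \<sigma> x\<close>, which
  is cancelled by \<open>CS\<close> and the term \<open>m1 \<sigma> x\<close>; the other terms have
  mean 0. This degeneracy is what permits \<open>r = 2\<close>.\<close>

lemma expectation_hrem_update:
  assumes \<sigma>: "\<sigma> \<in> perms k" "k \<ge> 1" and A: "finite A" "card A = k" "i \<in> A"
  shows "(\<integral>z. hrem \<sigma> A (z(i := x)) \<partial>Om) = 0"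
proof -
  have "(\<Sum>j\<in>A. m1 \<sigma> ((z(i := x)) j)) = m1 \<sigma> x + (\<Sum>j\<in>A - {i}. m1 \<sigma> (z j))" for z
    by (subst sum.remove[OF A(1,3)]) (auto intro!: sum.cong)
  then have "(\<integral>z. hrem \<sigma> A (z(i := x)) \<partial>Om) =
     (\<integral>z. pind \<sigma> A (z(i := x)) - (CS \<mu> \<sigma> + m1 \<sigma> x) - (\<Sum>j\<in>A - {i}. m1 \<sigma> (z j)) \<partial>Om)"
    by (simp only: hrem_def) (simp only: diff_diff_eq add.assoc)
  also have "\<dots> = (\<integral>z. pind \<sigma> A (z(i := x)) \<partial>Om) - (CS \<mu> \<sigma> + m1 \<sigma> x) - (\<Sum>j\<in>A - {i}. \<integral>z. m1 \<sigma> (z j) \<partial>Om)"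
  proof -
    have 1: "integrable Om (\<lambda>z. pind \<sigma> A (z(i := x)))"
      by (intro Om.bdd_meas_integrable bdd_meas_update bdd_meas_pind)
    have 2: "integrable Om (\<lambda>z. pind \<sigma> A (z(i := x)) - (CS \<mu> \<sigma> + m1 \<sigma> x))"
      by (intro Bochner_Integration.integrable_diff 1) simp
    have 3: "(\<integral>z. pind \<sigma> A (z(i := x)) - (CS \<mu> \<sigma> + m1 \<sigma> x) \<partial>Om) = (\<integral>z. pind \<sigma> A (z(i := x)) \<partial>Om) - (CS \<mu> \<sigma> + m1 \<sigma> x)"
      using Bochner_Integration.integral_diff[OF 1, of "\<lambda>_. CS \<mu> \<sigma> + m1 \<sigma> x"] by simp
    have 4: "integrable Om (\<lambda>z. \<Sum>j\<in>A - {i}. m1 \<sigma> (z j))"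
      by (intro Bochner_Integration.integrable_sum integrable_m1)
    have 5: "(\<integral>z. (\<Sum>j\<in>A - {i}. m1 \<sigma> (z j)) \<partial>Om) = (\<Sum>j\<in>A - {i}. \<integral>z. m1 \<sigma> (z j) \<partial>Om)"
      by (intro Bochner_Integration.integral_sum integrable_m1)
    show ?thesis unfolding Bochner_Integration.integral_diff[OF 2 4] 3 5 ..
  qed
  also have "\<dots> = 0"
    unfolding h1_eq[OF \<sigma>(1) A] expectation_Om_m1[OF \<sigma>] by (simp add: m1_def)
  finally show ?thesis .
qed

lemma hrem_bound:
  assumes \<sigma>: "\<sigma> \<in> perms k" and A: "card A = k"
  shows "\<bar>hrem \<sigma> A z\<bar> \<le> 1 + real k"
proof -
  have "\<bar>\<Sum>i\<in>A. m1 \<sigma> (z i)\<bar> \<le> (\<Sum>i\<in>A. 1)"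
    by (rule order_trans[OF sum_abs]) (intro sum_mono m1_bound[OF \<sigma>])
  then show ?thesis
    using pind_bounds[of \<sigma> A z] CS_bounds[OF \<sigma>] A by (simp add: hrem_def)
qed

text \<open>Each index belongs to a fraction \<open>k / n\<close> of the \<open>k\<close>-subsets,
  so the projections average to a multiple of an ordinary sum over the sample.\<close>

lemma hajek_identity:
  assumes \<sigma>: "\<sigma> \<in> perms k" "k \<ge> 1" and kn: "k \<le> n"
  shows "(\<Sum>A\<in>ksubsets n k. hrem \<sigma> A z) / real (n choose k) =
    tfreq n \<sigma> z - CS \<mu> \<sigma> - real k / real n * (\<Sum>i<n. m1 \<sigma> (z i))"
proof -
  have len: "length \<sigma> = k" using permsD[OF \<sigma>(1)] by simp
  have pos: "real (n choose k) > 0" "real n > 0" using kn \<sigma> by auto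
  have "(\<Sum>A\<in>ksubsets n k. \<Sum>i\<in>A. m1 \<sigma> (z i)) = (\<Sum>A\<in>ksubsets n k. \<Sum>i<n. of_bool (i \<in> A) * m1 \<sigma> (z i))"
  proof (rule sum.cong[OF refl])
    fix A assume A: "A \<in> ksubsets n k"
    then have "A = {..<n} \<inter> A" by auto
    then have "(\<Sum>i\<in>A. m1 \<sigma> (z i)) = (\<Sum>i\<in>{..<n} \<inter> A. m1 \<sigma> (z i))" by simp
    also have "\<dots> = (\<Sum>i<n. of_bool (i \<in> A) * m1 \<sigma> (z i))"
      using sum_of_bool_mult_eq[of "{..<n}" "\<lambda>i. i \<in> A" "\<lambda>i. m1 \<sigma> (z i)"] by simp
    finally show "(\<Sum>i\<in>A. m1 \<sigma> (z i)) = (\<Sum>i<n. of_bool (i \<in> A) * m1 \<sigma> (z i))" .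
  qed
  also have "\<dots> = (\<Sum>i<n. \<Sum>A\<in>ksubsets n k. of_bool (i \<in> A) * m1 \<sigma> (z i))"
    by (rule sum.swap)
  also have "\<dots> = (\<Sum>i<n. real ((n - 1) choose (k - 1)) * m1 \<sigma> (z i))"
  proof (intro sum.cong refl)
    fix i assume i: "i \<in> {..<n}"
    have "(\<Sum>A\<in>ksubsets n k. of_bool (i \<in> A) * m1 \<sigma> (z i)) = (\<Sum>A\<in>ksubsets n k. of_bool (i \<in> A)) * m1 \<sigma> (z i)"
      by (simp only: sum_distrib_right)
    also have "(\<Sum>A\<in>ksubsets n k. of_bool (i \<in> A)) = real (card (ksubsets n k \<inter> {A. i \<in> A}))"
      by simp
    also have "ksubsets n k \<inter> {A. i \<in> A} = {A. A \<subseteq> {..<n} \<and> card A = k \<and> {i} \<subseteq> A}" by auto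
    also have "real (card \<dots>) = real ((n - 1) choose (k - 1))"
      using card_subsets_containing[of "{..<n}" "{i}" 1 k] i \<sigma>(2) by simp
    finally show "(\<Sum>A\<in>ksubsets n k. of_bool (i \<in> A) * m1 \<sigma> (z i)) = real ((n - 1) choose (k - 1)) * m1 \<sigma> (z i)" .
  qed
  finally have 1: "(\<Sum>A\<in>ksubsets n k. \<Sum>i\<in>A. m1 \<sigma> (z i)) = real ((n - 1) choose (k - 1)) * (\<Sum>i<n. m1 \<sigma> (z i))"
    by (simp only: sum_distrib_left)
  have 2: "real ((n - 1) choose (k - 1)) / real (n choose k) = real k / real n"
  proof -
    have "k * (n choose k) = n * ((n - 1) choose (k - 1))"
      using times_binomial_minus1_eq[of k n] \<sigma>(2) by simp
    then have "real k * real (n choose k) = real n * real ((n - 1) choose (k - 1))"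
      by (simp flip: of_nat_mult)
    then show ?thesis using pos by (simp add: field_simps)
  qed
  have "(\<Sum>A\<in>ksubsets n k. hrem \<sigma> A z) = (\<Sum>A\<in>ksubsets n k. pind \<sigma> A z - CS \<mu> \<sigma>) - (\<Sum>A\<in>ksubsets n k. \<Sum>i\<in>A. m1 \<sigma> (z i))"
    by (simp only: hrem_def sum_subtractf)
  then have "(\<Sum>A\<in>ksubsets n k. hrem \<sigma> A z) / real (n choose k) =
     (\<Sum>A\<in>ksubsets n k. pind \<sigma> A z - CS \<mu> \<sigma>) / real (n choose k) -
     real ((n - 1) choose (k - 1)) / real (n choose k) * (\<Sum>i<n. m1 \<sigma> (z i))"
    by (simp only: 1 diff_divide_distrib) simp
  then show ?thesis
    by (simp only: 2 average_diff_const[OF kn, symmetric] tfreq_def len)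
qed

text \<open>The case \<open>r = 2\<close>: remainders on disjoint sets are uncorrelated by
  independence, those with one common point by conditioning on it. The resulting order
  \<open>n^-2\<close> still vanishes after multiplication by \<open>n\<close>.\<close>

lemma expectation_hajek_remainder:
  assumes \<sigma>: "\<sigma> \<in> perms k" "k \<ge> 1" and kn: "k \<le> n"
  shows "(\<integral>z. (tfreq n \<sigma> z - CS \<mu> \<sigma> - real k / real n * (\<Sum>i<n. m1 \<sigma> (z i)))^2 \<partial>Om)
    \<le> (1 + real k)^2 * real (k choose 2)^2 / real (n choose 2)"
  unfolding hajek_identity[OF \<sigma> kn, symmetric]
proof (rule expectation_subset_average_square[OF kn bdd_meas_hrem])
  show "\<bar>hrem \<sigma> A z\<bar> \<le> 1 + real k" if "A \<in> ksubsets n k" for A z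
    using that by (intro hrem_bound[OF \<sigma>(1)]) auto
  fix A B assume AB: "A \<in> ksubsets n k" "B \<in> ksubsets n k" "card (A \<inter> B) < 2"
  have A: "finite A" "card A = k" and B: "finite B" "card B = k" using AB by (auto intro: finite_subset)
  consider "A \<inter> B = {}" | i where "A \<inter> B = {i}"
  proof -
    have "card (A \<inter> B) = 0 \<or> card (A \<inter> B) = 1" using AB(3) by linarith
    then show ?thesis using that A(1) by (auto simp: card_1_singleton_iff)
  qed
  then show "(\<integral>z. hrem \<sigma> A z * hrem \<sigma> B z \<partial>Om) = 0"
  proof cases
    case 1
    then have "B \<subseteq> - A" by auto
    then show ?thesis
      using integral_Om_indep[OF A(1) bdd_meas_hrem bdd_meas_hrem depends_on_hrem depends_on_mono[OF depends_on_hrem], of B \<sigma> \<sigma>]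
        expectation_hrem[OF \<sigma> A] by simp
  next
    case 2
    then have i: "i \<in> A" by auto
    show ?thesis
      unfolding integral_Om_overlap[OF A(1) 2 bdd_meas_hrem bdd_meas_hrem depends_on_hrem depends_on_hrem]
        expectation_hrem_update[OF \<sigma> A i] by simp
  qed
qed

end

section \<open>Characteristic functions of pattern frequencies\<close>

lemma norm_iexp_diff_le: "norm (iexp a - iexp b) \<le> \<bar>a - b\<bar>"
proof -
  have "iexp a - iexp b = iexp b * (iexp (a - b) - 1)"
    by (simp add: algebra_simps flip: exp_add)
  also have "norm \<dots> = norm (iexp (a - b) - 1)"
    by (simp add: norm_mult)
  also have "\<dots> \<le> \<bar>a - b\<bar>"
    using iexp_approx1[of "a - b" 0] by simp
  finally show ?thesis .
qed

lemma exp_neg_approx: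
  fixes y :: real assumes "0 \<le> y" shows "\<bar>exp (- y) - (1 - y)\<bar> \<le> y^2"
proof -
  have 1: "1 - y \<le> exp (- y)" using exp_ge_add_one_self[of "- y"] by simp
  have "exp (- y) \<le> 1 / (1 + y)"
    using exp_ge_add_one_self[of y] assms by (simp add: exp_minus field_simps)
  also have "\<dots> \<le> 1 - y + y^2"
  proof -
    have "0 \<le> y ^ 3" using assms by simp
    then show ?thesis using assms by (simp add: field_simps power2_eq_square power3_eq_cube)
  qed
  finally show ?thesis using 1 by simp
qed

lemma (in prob_space) expectation_abs_le_sqrt:
  assumes "bdd_meas M f" shows "(\<integral>x. \<bar>f x\<bar> \<partial>M) \<le> sqrt (\<integral>x. (f x)^2 \<partial>M)"
proof -
  have b: "bdd_meas M (\<lambda>x. \<bar>f x\<bar>)"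
    using assms unfolding bdd_meas_def by auto
  let ?m = "\<integral>x. \<bar>f x\<bar> \<partial>M"
  have i: "integrable M (\<lambda>x. \<bar>f x\<bar>)" "integrable M (\<lambda>x. (\<bar>f x\<bar>)^2)"
    using bdd_meas_integrable[OF b] bdd_meas_integrable[OF bdd_meas_mult[OF b b]] by (simp_all add: power2_eq_square)
  have "0 \<le> variance (\<lambda>x. \<bar>f x\<bar>)" by (rule variance_positive)
  also have "\<dots> = (\<integral>x. (f x)^2 \<partial>M) - ?m^2" using variance_eq[OF i] by simp
  finally have "?m^2 \<le> (\<integral>x. (f x)^2 \<partial>M)" by simp
  then show ?thesis by (rule real_le_rsqrt)
qed

context iid
begin

text \<open>A central limit theorem with an explicit error depending on \<open>c\<close> and
  \<open>n\<close> only, so that it can be applied although the law of the sample changes with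
  \<open>n\<close>. The variance may be 0.\<close>

lemma iid_sum_char_bound:
  assumes Y: "Y \<in> borel_measurable \<mu>" "\<And>x. \<bar>Y x\<bar> \<le> c" and mean: "(\<integral>x. Y x \<partial>\<mu>) = 0" and n: "n \<ge> 1"
  defines "v \<equiv> (\<integral>x. (Y x)^2 \<partial>\<mu>) :: real"
  shows "norm ((\<integral>z. iexp ((\<Sum>i<n. Y (z i)) / sqrt n) \<partial>Om) - of_real (exp (- v / 2))) \<le> c^3 / sqrt n + c^4 / n"
proof -
  define t where "t = 1 / sqrt (real n)"
  have t: "t > 0" "t^2 = 1 / n" using n by (auto simp: t_def power_divide)
  have c0: "0 \<le> c" using order_trans[OF abs_ge_zero Y(2)] .
  note [measurable] = Y(1)
  have bY: "bdd_meas \<mu> Y" by (rule bdd_measI[OF Y])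
  have iY: "integrable \<mu> Y" "integrable \<mu> (\<lambda>x. (Y x)^2)"
    using bdd_meas_integrable[OF bY] bdd_meas_integrable[OF bdd_meas_mult[OF bY bY]] by (simp_all add: power2_eq_square)
  have v: "0 \<le> v" "v \<le> c^2"
  proof -
    show "0 \<le> v" unfolding v_def by simp
    have "v \<le> (\<integral>x. c^2 \<partial>\<mu>)" unfolding v_def
    proof (rule integral_mono[OF iY(2)])
      show "(Y x)^2 \<le> c^2" for x using power_mono[OF Y(2)[of x], of 2] by simp
    qed simp
    then show "v \<le> c^2" using prob_space by simp
  qed
  define \<phi> where "\<phi> = (\<integral>x. iexp (t * Y x) \<partial>\<mu>)"
  have int: "integrable \<mu> (\<lambda>x. iexp (t * Y x))" by (rule integrable_iexp) measurable
  have pow: "(\<integral>z. iexp ((\<Sum>i<n. Y (z i)) / sqrt n) \<partial>Om) = \<phi> ^ n"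
  proof -
    have "(\<integral>z. iexp ((\<Sum>i<n. Y (z i)) / sqrt n) \<partial>Om) = (\<integral>z. (\<Prod>i<n. iexp (t * Y (z i))) \<partial>Om)"
      by (intro Bochner_Integration.integral_cong refl)
        (simp add: exp_sum[symmetric] sum_divide_distrib sum_distrib_left t_def)
    also have "\<dots> = (\<Prod>i<n. \<phi>)" unfolding \<phi>_def
      by (rule integral_Om_prod[of "{..<n}" "\<lambda>i x. iexp (t * Y x)"]) (rule finite_lessThan, rule int)
    finally show ?thesis by simp
  qed
  have \<phi>1: "norm \<phi> \<le> 1"
  proof -
    have "norm \<phi> \<le> (\<integral>x. norm (iexp (t * Y x)) \<partial>\<mu>)" unfolding \<phi>_def by (rule integral_norm_bound)
    then show ?thesis using prob_space by simp
  qed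
  have var: "variance Y = v" unfolding v_def by (simp add: mean)
  have char: "char (distr \<mu> borel Y) t = \<phi>"
    unfolding char_def \<phi>_def by (subst integral_distr) auto
  \<comment> \<open>Second-order expansion; of the two bounds in the minimum only the cubic one is
    used.\<close>
  have "norm (\<phi> - (1 - t^2 * v / 2)) \<le> (t^2 / 6) * expectation (\<lambda>x. min (6 * (Y x)^2) (\<bar>t\<bar> * \<bar>Y x\<bar>^3))"
    using char_approx3'[OF Y(1) iY mean var refl, of t] by (simp only: char)
  also have "\<dots> \<le> (t^2 / 6) * (t * c^3)"
  proof (intro mult_left_mono)
    have b3: "\<bar>Y x\<bar>^3 \<le> c^3" for x using power_mono[OF Y(2)[of x], of 3] by simp
    have "expectation (\<lambda>x. min (6 * (Y x)^2) (\<bar>t\<bar> * \<bar>Y x\<bar>^3)) \<le> expectation (\<lambda>x. t * c^3)"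
    proof (rule integral_mono)
      show "min (6 * (Y x)^2) (\<bar>t\<bar> * \<bar>Y x\<bar>^3) \<le> t * c^3" for x
        using b3[of x] t(1) by (intro min.coboundedI2) (simp add: mult_left_mono)
      show "integrable \<mu> (\<lambda>x. min (6 * (Y x)^2) (\<bar>t\<bar> * \<bar>Y x\<bar>^3))"
      proof (rule integrable_const_bound[of _ "t * c^3"])
        show "AE x in \<mu>. norm (min (6 * (Y x)^2) (\<bar>t\<bar> * \<bar>Y x\<bar>^3)) \<le> t * c^3"
        proof (rule AE_I2)
          fix x
          have "0 \<le> min (6 * (Y x)^2) (\<bar>t\<bar> * \<bar>Y x\<bar>^3)" by simp
          moreover have "min (6 * (Y x)^2) (\<bar>t\<bar> * \<bar>Y x\<bar>^3) \<le> t * c^3"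
            using b3[of x] t(1) by (intro min.coboundedI2) (simp add: mult_left_mono)
          ultimately show "norm (min (6 * (Y x)^2) (\<bar>t\<bar> * \<bar>Y x\<bar>^3)) \<le> t * c^3" by simp
        qed
      qed measurable
    qed simp
    then show "expectation (\<lambda>x. min (6 * (Y x)^2) (\<bar>t\<bar> * \<bar>Y x\<bar>^3)) \<le> t * c^3" using prob_space by simp
  qed simp
  finally have A: "norm (\<phi> - (1 - t^2 * v / 2)) \<le> c^3 * t / (6 * n)"
    by (simp add: t(2) mult.commute)
  \<comment> \<open>With this choice \<open>exp (- y)\<close> is the \<open>n\<close>-th root of the
    Gaussian factor and \<open>1 - y\<close> is the second-order expansion of
    \<open>\<phi>\<close>.\<close>
  define y where "y = v / (2 * n)"
  have y0: "0 \<le> y" using v by (simp add: y_def)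
  have B: "norm (of_real (exp (- y)) - (1 - t^2 * v / 2 :: complex)) \<le> y^2"
  proof -
    have "of_real (exp (- y)) - (1 - t^2 * v / 2 :: complex) = of_real (exp (- y) - (1 - y))"
      by (simp add: y_def t(2) flip: of_real_power)
    then show ?thesis using exp_neg_approx[OF y0] by (simp only: norm_of_real)
  qed
  have "norm (\<phi> - of_real (exp (- y))) \<le> c^3 * t / (6 * n) + y^2"
    using norm_triangle_le_diff[OF order_trans[OF add_mono[OF A B] order_refl]] by (simp add: norm_minus_commute)
  then have C: "real n * norm (\<phi> - of_real (exp (- y))) \<le> real n * (c^3 * t / (6 * n) + y^2)"
    by (rule mult_left_mono) simp
  have "exp (- v / 2) = exp (- y) ^ n"
    using n by (simp add: exp_of_nat_mult[symmetric] y_def)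
  then have "norm (\<phi> ^ n - of_real (exp (- v / 2))) = norm (\<phi> ^ n - of_real (exp (- y)) ^ n)"
    by simp
  \<comment> \<open>For numbers of norm at most 1, \<open>n\<close>-th powers enlarge distances at
    most by the factor \<open>n\<close>.\<close>
  also have "\<dots> \<le> real n * norm (\<phi> - of_real (exp (- y)))"
    by (rule norm_power_diff[OF \<phi>1]) (use y0 in simp)
  also have "\<dots> \<le> real n * (c^3 * t / (6 * n) + y^2)" by (rule C)
  also have "\<dots> = c^3 * t / 6 + v^2 / (4 * n)"
    using n by (simp add: y_def field_simps power2_eq_square)
  also have "\<dots> \<le> c^3 * t + c^4 / n"
  proof (rule add_mono)
    show "c^3 * t / 6 \<le> c^3 * t" using c0 t(1) by simp
    have "v^2 \<le> (c^2)^2" using v by (intro power_mono)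
    then have "v^2 \<le> c^4" by simp
    then show "v^2 / (4 * n) \<le> c^4 / n" using n by (intro frac_le) (auto intro: order_trans[of _ "c^4 * 1"])
  qed
  finally show ?thesis unfolding pow by (simp add: t_def)
qed

end

lemma ratio_choose_two_tendsto_0: "(\<lambda>n. real n / real (n choose 2)) \<longlonglongrightarrow> 0"
proof -
  have "eventually (\<lambda>n. 2 * (1 / real (n - 1)) = real n / real (n choose 2)) sequentially"
    using eventually_ge_at_top[of 2]
  proof eventually_elim
    case (elim n)
    have "even (n * (n - 1))" by (cases "even n") auto
    then have "2 * (n choose 2) = n * (n - 1)" by (simp add: choose_two)
    then have "2 * real (n choose 2) = real n * real (n - 1)" by (metis of_nat_mult of_nat_numeral)
    then show ?case using elim by (simp add: field_simps)
  qed
  moreover have "(\<lambda>n. 2 * (1 / real (n - 1))) \<longlonglongrightarrow> 2 * 0"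
  proof (intro tendsto_mult tendsto_const)
    show "(\<lambda>n. 1 / real (n - 1)) \<longlonglongrightarrow> 0"
      by (subst filterlim_sequentially_Suc[symmetric]) (simp add: lim_1_over_n)
  qed
  ultimately show ?thesis by (auto intro: Lim_transform_eventually)
qed

section \<open>Characteristic functions for a sample from one copula\<close>

context copula_space
begin

text \<open>Built on \<open>tfreq\<close>, an exact U-statistic for every sample, ties included; it
  is compared with the permutation only almost surely, in \<open>expectation_Wnk\<close>.\<close>

definition wfreq :: "nat \<Rightarrow> nat list \<Rightarrow> (nat \<Rightarrow> real \<times> real) \<Rightarrow> real" where
  "wfreq n \<sigma> z = sqrt (real n) / real (length \<sigma>) * (tfreq n \<sigma> z - CS \<mu> \<sigma>)"

lemma bdd_meas_wfreq: "bdd_meas Om (wfreq n \<sigma>)"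
  unfolding wfreq_def[abs_def] by (intro bdd_meas_mult bdd_meas_diff bdd_meas_const bdd_meas_tfreq)

lemma expectation_wfreq_square:
  assumes "\<sigma> \<in> Sall" "length \<sigma> \<le> n"
  shows "(\<integral>z. (wfreq n \<sigma> z)^2 \<partial>Om) \<le> 1"
proof -
  let ?k = "length \<sigma>"
  have k: "?k \<ge> 1" using assms by (simp add: Sall_def)
  have "(\<integral>z. (wfreq n \<sigma> z)^2 \<partial>Om) = real n / (real ?k)^2 * (\<integral>z. (tfreq n \<sigma> z - CS \<mu> \<sigma>)^2 \<partial>Om)"
    by (simp add: wfreq_def power_mult_distrib power_divide)
  also have "\<dots> \<le> real n / (real ?k)^2 * ((real ?k)^2 / real n)"
    by (intro mult_left_mono expectation_tfreq_deviation Sall_perms assms) simp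
  also have "\<dots> = 1" using k assms(2) by (cases \<sigma>) auto
  finally show ?thesis .
qed

definition hajek_const :: "nat list \<Rightarrow> real" where
  "hajek_const \<sigma> = (1 + real (length \<sigma>))^2 * real (length \<sigma> choose 2)^2"

text \<open>The factors \<open>sqrt n / k\<close> and \<open>k / n\<close> combine to
  \<open>1 / sqrt n\<close>, so the projection becomes a normalised sum without the pattern length.
  A first moment suffices because \<open>iexp\<close> is Lipschitz.\<close>

lemma expectation_wfreq_remainder:
  assumes "\<sigma> \<in> Sall" "length \<sigma> \<le> n"
  shows "(\<integral>z. \<bar>wfreq n \<sigma> z - (\<Sum>i<n. m1 \<sigma> (z i)) / sqrt n\<bar> \<partial>Om) \<le> sqrt (hajek_const \<sigma> * (real n / real (n choose 2)))"
proof -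
  let ?k = "length \<sigma>"
  have k: "?k \<ge> 1" using assms by (simp add: Sall_def)
  have n: "n \<ge> 1" using k assms by simp
  define R where "R z = tfreq n \<sigma> z - CS \<mu> \<sigma> - real ?k / real n * (\<Sum>i<n. m1 \<sigma> (z i))" for z
  have bR: "bdd_meas Om R" unfolding R_def[abs_def]
    by (intro bdd_meas_diff bdd_meas_mult bdd_meas_const bdd_meas_tfreq bdd_meas_sum
      bdd_meas_compose[OF bdd_meas_m1 measurable_Om_component])
  have eq: "wfreq n \<sigma> z - (\<Sum>i<n. m1 \<sigma> (z i)) / sqrt n = sqrt n / ?k * R z" for z
  proof -
    have *: "s / k * (k / (s * s) * S) = S / s" if "s > 0" "k > 0" for s k S :: real
      using that by (simp add: field_simps)
    have "sqrt n / ?k * (real ?k / real n * S) = S / sqrt n" for S :: real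
      using *[of "sqrt n" "real ?k" S] n k by (cases "\<sigma> = []") simp_all
    then show ?thesis by (simp add: wfreq_def R_def right_diff_distrib)
  qed
  have "(\<integral>z. \<bar>wfreq n \<sigma> z - (\<Sum>i<n. m1 \<sigma> (z i)) / sqrt n\<bar> \<partial>Om) \<le> sqrt (\<integral>z. (sqrt n / ?k * R z)^2 \<partial>Om)"
    unfolding eq by (rule Om.expectation_abs_le_sqrt[OF bdd_meas_mult[OF bdd_meas_const bR]])
  also have "\<dots> \<le> sqrt (hajek_const \<sigma> * (real n / real (n choose 2)))"
  proof (rule real_sqrt_le_mono)
    have "(\<integral>z. (sqrt n / ?k * R z)^2 \<partial>Om) = real n / (real ?k)^2 * (\<integral>z. (R z)^2 \<partial>Om)"
      by (simp add: power_mult_distrib power_divide)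
    also have "\<dots> \<le> real n / 1 * (hajek_const \<sigma> / real (n choose 2))"
    proof (rule mult_mono)
      show "real n / (real ?k)^2 \<le> real n / 1" using k by (intro divide_left_mono) auto
      show "(\<integral>z. (R z)^2 \<partial>Om) \<le> hajek_const \<sigma> / real (n choose 2)"
        using expectation_hajek_remainder[OF Sall_perms[OF assms(1)] k assms(2)] by (simp add: R_def hajek_const_def)
    qed simp_all
    finally show "(\<integral>z. (sqrt n / ?k * R z)^2 \<partial>Om) \<le> hajek_const \<sigma> * (real n / real (n choose 2))" by (simp add: mult.commute)
  qed
  finally show ?thesis .
qed

lemma expectation_m1_combination_square:
  assumes "finite F" "F \<subseteq> Sall"
  shows "(\<integral>x. (\<Sum>\<sigma>\<in>F. t \<sigma> * m1 \<sigma> x)^2 \<partial>\<mu>) = (\<Sum>\<sigma>\<in>F. \<Sum>\<tau>\<in>F. t \<sigma> * t \<tau> * rho \<mu> \<sigma> \<tau>)"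
proof -
  have int: "integrable \<mu> (\<lambda>x. t \<sigma> * t \<tau> * (m1 \<sigma> x * m1 \<tau> x))" for \<sigma> \<tau>
    by (intro bdd_meas_integrable bdd_meas_mult bdd_meas_m1 bdd_meas_const)
  have "(\<integral>x. (\<Sum>\<sigma>\<in>F. t \<sigma> * m1 \<sigma> x)^2 \<partial>\<mu>) = (\<integral>x. (\<Sum>\<sigma>\<in>F. \<Sum>\<tau>\<in>F. t \<sigma> * t \<tau> * (m1 \<sigma> x * m1 \<tau> x)) \<partial>\<mu>)"
    by (intro Bochner_Integration.integral_cong refl) (simp add: power2_eq_square sum_product ac_simps)
  also have "\<dots> = (\<Sum>\<sigma>\<in>F. \<integral>x. (\<Sum>\<tau>\<in>F. t \<sigma> * t \<tau> * (m1 \<sigma> x * m1 \<tau> x)) \<partial>\<mu>)"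
    by (rule Bochner_Integration.integral_sum) (intro Bochner_Integration.integrable_sum int)
  also have "\<dots> = (\<Sum>\<sigma>\<in>F. \<Sum>\<tau>\<in>F. \<integral>x. t \<sigma> * t \<tau> * (m1 \<sigma> x * m1 \<tau> x) \<partial>\<mu>)"
    by (intro sum.cong refl Bochner_Integration.integral_sum int)
  also have "\<dots> = (\<Sum>\<sigma>\<in>F. \<Sum>\<tau>\<in>F. t \<sigma> * t \<tau> * rho \<mu> \<sigma> \<tau>)"
  proof (intro sum.cong refl)
    fix \<sigma> \<tau> assume "\<sigma> \<in> F" "\<tau> \<in> F"
    then have "\<sigma> \<in> Sall" "\<tau> \<in> Sall" using assms by auto
    then show "(\<integral>x. t \<sigma> * t \<tau> * (m1 \<sigma> x * m1 \<tau> x) \<partial>\<mu>) = t \<sigma> * t \<tau> * rho \<mu> \<sigma> \<tau>"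
      using expectation_m1_mult[OF Sall_perms Sall_perms, of \<sigma> \<tau>] by (simp add: Sall_def)
  qed
  finally show ?thesis .
qed

text \<open>The combination is replaced by the normalised sum of \<open>Y\<close>, which is bounded
  by \<open>c\<close> since \<open>m1\<close> is bounded by 1. The right-hand side does not involve
  \<open>\<mu>\<close>.\<close>

lemma wfreq_combination_char_bound:
  fixes t :: "nat list \<Rightarrow> real"
  assumes F: "finite F" "F \<subseteq> Sall" and n: "n \<ge> 1" "\<And>\<sigma>. \<sigma> \<in> F \<Longrightarrow> length \<sigma> \<le> n"
  defines "c \<equiv> \<Sum>\<sigma>\<in>F. \<bar>t \<sigma>\<bar>"
  shows "norm ((\<integral>z. iexp (\<Sum>\<sigma>\<in>F. t \<sigma> * wfreq n \<sigma> z) \<partial>Om) -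
      of_real (exp (- (\<Sum>\<sigma>\<in>F. \<Sum>\<tau>\<in>F. t \<sigma> * t \<tau> * rho \<mu> \<sigma> \<tau>) / 2))) \<le>
    (\<Sum>\<sigma>\<in>F. \<bar>t \<sigma>\<bar> * sqrt (hajek_const \<sigma> * (real n / real (n choose 2)))) + (c^3 / sqrt n + c^4 / n)"
proof -
  define Y where "Y x = (\<Sum>\<sigma>\<in>F. t \<sigma> * m1 \<sigma> x)" for x
  have bY: "bdd_meas \<mu> Y" unfolding Y_def[abs_def]
    by (intro bdd_meas_sum bdd_meas_mult bdd_meas_const bdd_meas_m1)
  have Yc: "\<bar>Y x\<bar> \<le> c" for x
    unfolding Y_def c_def
  proof (rule order_trans[OF sum_abs], rule sum_mono)
    fix \<sigma> assume "\<sigma> \<in> F"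
    then show "\<bar>t \<sigma> * m1 \<sigma> x\<bar> \<le> \<bar>t \<sigma>\<bar>"
      using m1_bound[OF Sall_perms, of \<sigma> x] F by (auto simp: abs_mult intro!: mult_left_le)
  qed
  have mean: "(\<integral>x. Y x \<partial>\<mu>) = 0"
    unfolding Y_def
  proof (subst Bochner_Integration.integral_sum)
    show "(\<Sum>\<sigma>\<in>F. \<integral>x. t \<sigma> * m1 \<sigma> x \<partial>\<mu>) = 0"
    proof (rule sum.neutral, rule ballI)
      fix \<sigma> assume "\<sigma> \<in> F"
      then have "\<sigma> \<in> Sall" using F by auto
      then show "(\<integral>x. t \<sigma> * m1 \<sigma> x \<partial>\<mu>) = 0"
        using expectation_m1[OF Sall_perms, of \<sigma>] by (simp add: Sall_def)
    qed
  qed (simp add: integrable_m1)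
  define V where "V z = (\<Sum>\<sigma>\<in>F. t \<sigma> * wfreq n \<sigma> z)" for z
  define S where "S z = (\<Sum>i<n. Y (z i)) / sqrt n" for z
  have bV: "bdd_meas Om V" unfolding V_def[abs_def]
    by (intro bdd_meas_sum bdd_meas_mult bdd_meas_const bdd_meas_wfreq)
  have bS: "bdd_meas Om S" unfolding S_def[abs_def] divide_inverse
    by (intro bdd_meas_sum bdd_meas_mult bdd_meas_const bdd_meas_compose[OF bY measurable_Om_component])
  define r where "r \<sigma> z = wfreq n \<sigma> z - (\<Sum>i<n. m1 \<sigma> (z i)) / sqrt n" for \<sigma> z
  have br: "bdd_meas Om (r \<sigma>)" for \<sigma> unfolding r_def[abs_def] divide_inverse
    by (intro bdd_meas_diff bdd_meas_mult bdd_meas_const bdd_meas_wfreq bdd_meas_sum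
      bdd_meas_compose[OF bdd_meas_m1 measurable_Om_component])
  have VS: "V z - S z = (\<Sum>\<sigma>\<in>F. t \<sigma> * r \<sigma> z)" for z
  proof -
    have "S z = (\<Sum>\<sigma>\<in>F. t \<sigma> * ((\<Sum>i<n. m1 \<sigma> (z i)) / sqrt n))"
      unfolding S_def Y_def by (subst sum.swap) (simp add: sum_divide_distrib sum_distrib_left)
    then show ?thesis by (simp add: V_def r_def right_diff_distrib sum_subtractf)
  qed
  have iV: "integrable Om (\<lambda>z. iexp (V z))" "integrable Om (\<lambda>z. iexp (S z))"
    using bdd_meas_measurable[OF bV] bdd_meas_measurable[OF bS] by (auto intro!: Om.integrable_iexp)
  have "(\<integral>z. iexp (V z) \<partial>Om) - (\<integral>z. iexp (S z) \<partial>Om) = (\<integral>z. iexp (V z) - iexp (S z) \<partial>Om)"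
    using iV by simp
  also have "norm \<dots> \<le> (\<integral>z. norm (iexp (V z) - iexp (S z)) \<partial>Om)"
    by (rule integral_norm_bound)
  also have "\<dots> \<le> (\<integral>z. (\<Sum>\<sigma>\<in>F. \<bar>t \<sigma>\<bar> * \<bar>r \<sigma> z\<bar>) \<partial>Om)"
  proof (rule integral_mono)
    show "integrable Om (\<lambda>z. norm (iexp (V z) - iexp (S z)))"
      by (intro integrable_norm Bochner_Integration.integrable_diff iV)
    show "integrable Om (\<lambda>z. \<Sum>\<sigma>\<in>F. \<bar>t \<sigma>\<bar> * \<bar>r \<sigma> z\<bar>)"
      by (intro Bochner_Integration.integrable_sum integrable_mult_right integrable_abs Om.bdd_meas_integrable br)
    fix z
    have "norm (iexp (V z) - iexp (S z)) \<le> \<bar>V z - S z\<bar>" by (rule norm_iexp_diff_le)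
    also have "\<dots> \<le> (\<Sum>\<sigma>\<in>F. \<bar>t \<sigma> * r \<sigma> z\<bar>)" unfolding VS by (rule sum_abs)
    finally show "norm (iexp (V z) - iexp (S z)) \<le> (\<Sum>\<sigma>\<in>F. \<bar>t \<sigma>\<bar> * \<bar>r \<sigma> z\<bar>)" by (simp add: abs_mult)
  qed
  also have "\<dots> = (\<Sum>\<sigma>\<in>F. \<bar>t \<sigma>\<bar> * (\<integral>z. \<bar>r \<sigma> z\<bar> \<partial>Om))"
    by (subst Bochner_Integration.integral_sum)
      (auto intro!: integrable_mult_right integrable_abs[OF Om.bdd_meas_integrable[OF br]])
  also have "\<dots> \<le> (\<Sum>\<sigma>\<in>F. \<bar>t \<sigma>\<bar> * sqrt (hajek_const \<sigma> * (real n / real (n choose 2))))"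
    unfolding r_def using F by (intro sum_mono mult_left_mono expectation_wfreq_remainder n) auto
  finally have 1: "norm ((\<integral>z. iexp (V z) \<partial>Om) - (\<integral>z. iexp (S z) \<partial>Om)) \<le>
    (\<Sum>\<sigma>\<in>F. \<bar>t \<sigma>\<bar> * sqrt (hajek_const \<sigma> * (real n / real (n choose 2))))" .
  have 2: "norm ((\<integral>z. iexp (S z) \<partial>Om) - of_real (exp (- (\<Sum>\<sigma>\<in>F. \<Sum>\<tau>\<in>F. t \<sigma> * t \<tau> * rho \<mu> \<sigma> \<tau>) / 2))) \<le> c^3 / sqrt n + c^4 / n"
    using iid_sum_char_bound[OF bdd_meas_measurable[OF bY] Yc mean n(1)]
    unfolding S_def expectation_m1_combination_square[OF F, of t, folded Y_def] .
  show ?thesis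
    using norm_triangle_le[OF add_mono[OF 1 2]] by (simp add: V_def)
qed

end

context copula_limit
begin

text \<open>Since the error bound is free of the copula, it vanishes along changing laws. The
  copulas remain only in the variance \<open>V n\<close>, which converges by
  \<open>rho_limit\<close>.\<close>

lemma wfreq_combination_char_limit:
  assumes F: "finite F" "F \<subseteq> Sall"
  shows "(\<lambda>n. \<integral>z. iexp (\<Sum>\<sigma>\<in>F. t \<sigma> * C.wfreq n n \<sigma> z) \<partial>C.Om n) \<longlonglongrightarrow>
    of_real (exp (- (\<Sum>\<sigma>\<in>F. \<Sum>\<tau>\<in>F. t \<sigma> * t \<tau> * rho \<nu> \<sigma> \<tau>) / 2))"
proof -
  define c where "c = (\<Sum>\<sigma>\<in>F. \<bar>t \<sigma>\<bar>)"
  define err where "err n = (\<Sum>\<sigma>\<in>F. \<bar>t \<sigma>\<bar> * sqrt (L.hajek_const \<sigma> * (real n / real (n choose 2)))) +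
    (c^3 * (1 / sqrt n) + c^4 * (1 / real n))" for n :: nat
  define V where "V n = (\<Sum>\<sigma>\<in>F. \<Sum>\<tau>\<in>F. t \<sigma> * t \<tau> * rho (\<mu> n) \<sigma> \<tau>)" for n
  have "err \<longlonglongrightarrow> (\<Sum>\<sigma>\<in>F. \<bar>t \<sigma>\<bar> * sqrt (L.hajek_const \<sigma> * 0)) + (c^3 * 0 + c^4 * 0)"
    unfolding err_def
    by (intro tendsto_intros ratio_choose_two_tendsto_0 lim_1_over_n
        tendsto_divide_0[OF tendsto_const] filterlim_at_top_imp_at_infinity
        filterlim_compose[OF sqrt_at_top filterlim_real_sequentially])
  then have err: "err \<longlonglongrightarrow> 0" by simp
  have 1: "(\<lambda>n. (\<integral>z. iexp (\<Sum>\<sigma>\<in>F. t \<sigma> * C.wfreq n n \<sigma> z) \<partial>C.Om n) - of_real (exp (- V n / 2))) \<longlonglongrightarrow> 0"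
  proof (rule Lim_null_comparison[OF _ err])
    show "\<forall>\<^sub>F n in sequentially. norm ((\<integral>z. iexp (\<Sum>\<sigma>\<in>F. t \<sigma> * C.wfreq n n \<sigma> z) \<partial>C.Om n) - of_real (exp (- V n / 2))) \<le> err n"
      using eventually_ge_at_top[of "Max (insert 1 (length ` F))"]
    proof eventually_elim
      case (elim n)
      then have "n \<ge> 1" "\<And>\<sigma>. \<sigma> \<in> F \<Longrightarrow> length \<sigma> \<le> n" using F(1) by auto
      from C.wfreq_combination_char_bound[OF F this, of n t]
      show ?case unfolding V_def err_def c_def by simp
    qed
  qed
  have "V \<longlonglongrightarrow> (\<Sum>\<sigma>\<in>F. \<Sum>\<tau>\<in>F. t \<sigma> * t \<tau> * rho \<nu> \<sigma> \<tau>)"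
    unfolding V_def using F by (intro tendsto_intros rho_limit) auto
  then have 2: "(\<lambda>n. complex_of_real (exp (- V n / 2))) \<longlonglongrightarrow> complex_of_real (exp (- (\<Sum>\<sigma>\<in>F. \<Sum>\<tau>\<in>F. t \<sigma> * t \<tau> * rho \<nu> \<sigma> \<tau>) / 2))"
    by (intro tendsto_intros)  auto
  show ?thesis
    using tendsto_add[OF 1 2] by simp
qed

end

section \<open>Cholesky factorisation of positive semidefinite kernels\<close>

definition psd_kernel :: "('i \<Rightarrow> 'i \<Rightarrow> real) \<Rightarrow> bool" where
  "psd_kernel K \<longleftrightarrow> (\<forall>i j. K i j = K j i) \<and>
     (\<forall>I x. finite I \<longrightarrow> 0 \<le> (\<Sum>i\<in>I. \<Sum>j\<in>I. x i * x j * K i j))"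

lemma psd_kernel_sym: "psd_kernel K \<Longrightarrow> K i j = K j i"
  by (simp add: psd_kernel_def)

lemma psd_kernel_sum: "psd_kernel K \<Longrightarrow> finite I \<Longrightarrow> 0 \<le> (\<Sum>i\<in>I. \<Sum>j\<in>I. x i * x j * K i j)"
  by (simp add: psd_kernel_def)

lemma psd_kernel_diag: "psd_kernel K \<Longrightarrow> 0 \<le> K i i"
  using psd_kernel_sum[of K "{i}" "\<lambda>_. 1"] by simp

text \<open>On the vector with entries 1 at \<open>i\<close> and \<open>t\<close> at
  \<open>m\<close> the quadratic form is affine in \<open>t\<close>; being nonnegative for all
  \<open>t\<close>, it must have slope 0.\<close>

lemma psd_kernel_zero_row:
  assumes K: "psd_kernel K" and 0: "K m m = 0" shows "K i m = 0"
proof (cases "i = m")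
  case False
  have *: "0 \<le> K i i + 2 * t * K i m" for t
    using psd_kernel_sum[OF K, of "{i, m}" "\<lambda>j. if j = i then 1 else t"] False 0 psd_kernel_sym[OF K, of m i]
    by (simp add: algebra_simps)
  show ?thesis
  proof (rule ccontr)
    assume "K i m \<noteq> 0"
    \<comment> \<open>For this \<open>t\<close> the form takes the value -1.\<close>
    then show False using *[of "- (K i i + 1) / (2 * K i m)"] by (simp add: field_simps)
  qed
qed (use 0 in simp)

text \<open>The Schur complement after eliminating index \<open>m\<close>. If the pivot
  \<open>K m m\<close> is 0, the quotient is 0 by convention and nothing changes.\<close>

definition schur_step :: "('i \<Rightarrow> 'i \<Rightarrow> real) \<Rightarrow> 'i \<Rightarrow> 'i \<Rightarrow> 'i \<Rightarrow> real" where
  "schur_step K m i j = K i j - K i m * K j m / K m m"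

text \<open>Completing the square: the form of the Schur complement at \<open>y\<close> is the
  original form at \<open>y - t * d\<close>, where \<open>d\<close> is the unit vector at
  \<open>m\<close> and \<open>t = B / K m m\<close> is the minimiser.\<close>

lemma psd_kernel_schur_step:
  assumes K: "psd_kernel K" shows "psd_kernel (schur_step K m)"
proof (cases "K m m = 0")
  case True
  then have "schur_step K m = K" by (simp add: schur_step_def fun_eq_iff)
  then show ?thesis using K by simp
next
  case False
  show ?thesis unfolding psd_kernel_def
  proof (intro conjI allI impI)
    show "schur_step K m i j = schur_step K m j i" for i j
      using psd_kernel_sym[OF K, of i j] by (simp add: schur_step_def mult.commute)
  next
    fix I :: "'a set" and x :: "'a \<Rightarrow> real"
    assume fin: "finite I"
    \<comment> \<open>The vector is extended by 0 so that the direction \<open>m\<close> is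
      available even if \<open>m\<close> is not in \<open>I\<close>.\<close>
    define J where "J = insert m I"
    define y where "y i = (if i \<in> I then x i else 0)" for i
    define B where "B = (\<Sum>i\<in>J. y i * K i m)"
    define t where "t = B / K m m"
    have finJ: "finite J" "m \<in> J" using fin by (auto simp: J_def)
    have ext: "(\<Sum>i\<in>I. \<Sum>j\<in>I. x i * x j * L i j) = (\<Sum>i\<in>J. \<Sum>j\<in>J. y i * y j * L i j)" for L
    proof -
      have "(\<Sum>i\<in>I. \<Sum>j\<in>I. x i * x j * L i j) = (\<Sum>i\<in>I. \<Sum>j\<in>J. y i * y j * L i j)"
        using finJ by (intro sum.cong refl sum.mono_neutral_cong_left) (auto simp: J_def y_def)
      also have "\<dots> = (\<Sum>i\<in>J. \<Sum>j\<in>J. y i * y j * L i j)"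
        using finJ by (intro sum.mono_neutral_left) (auto simp: J_def y_def)
      finally show ?thesis .
    qed
    define d where "d i = (if i = m then 1 else 0 :: real)" for i
    have sel: "(\<Sum>j\<in>J. d j * f j) = f m" for f
    proof -
      have "(\<Sum>j\<in>J. d j * f j) = (\<Sum>j\<in>J. if j = m then f j else 0)"
        by (intro sum.cong refl) (simp add: d_def)
      then show ?thesis using finJ by (simp add: sum.delta)
    qed
    have Bd: "(\<Sum>i\<in>J. \<Sum>j\<in>J. y i * d j * K i j) = B"
    proof -
      have "(\<Sum>j\<in>J. y i * d j * K i j) = y i * K i m" for i
        using sel[of "\<lambda>j. y i * K i j"] by (simp add: ac_simps)
      then show ?thesis by (simp only: B_def)
    qed
    have Bd': "(\<Sum>i\<in>J. \<Sum>j\<in>J. d i * y j * K i j) = B"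
    proof -
      have "(\<Sum>i\<in>J. \<Sum>j\<in>J. d i * y j * K i j) = (\<Sum>j\<in>J. \<Sum>i\<in>J. y j * d i * K j i)"
        proof (subst sum.swap, intro sum.cong refl)
        show "d i * y j * K i j = y j * d i * K j i" for i j
          using psd_kernel_sym[OF K, of i j] by simp
      qed
      then show ?thesis using Bd by simp
    qed
    have dd: "(\<Sum>i\<in>J. \<Sum>j\<in>J. d i * d j * K i j) = K m m"
    proof -
      have "(\<Sum>j\<in>J. d i * d j * K i j) = d i * K i m" for i
        using sel[of "\<lambda>j. d i * K i j"] by (simp add: ac_simps)
      then show ?thesis by (simp only: sel)
    qed
    have "0 \<le> (\<Sum>i\<in>J. \<Sum>j\<in>J. (y i - t * d i) * (y j - t * d j) * K i j)"
      by (rule psd_kernel_sum[OF K finJ(1)])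
    also have "\<dots> = (\<Sum>i\<in>J. \<Sum>j\<in>J. y i * y j * K i j - t * (y i * d j * K i j) - t * (d i * y j * K i j) + t^2 * (d i * d j * K i j))"
      by (intro sum.cong refl) (simp add: algebra_simps power2_eq_square)
    also have "\<dots> = (\<Sum>i\<in>J. \<Sum>j\<in>J. y i * y j * K i j) - t * B - t * B + t^2 * K m m"
      by (simp only: sum.distrib sum_subtractf sum_distrib_left[symmetric] Bd Bd' dd)
    also have "\<dots> = (\<Sum>i\<in>J. \<Sum>j\<in>J. y i * y j * K i j) - B^2 / K m m"
      using False by (simp add: t_def power2_eq_square)
    also have "\<dots> = (\<Sum>i\<in>J. \<Sum>j\<in>J. y i * y j * schur_step K m i j)"
    proof -
      have "B^2 / K m m = (\<Sum>i\<in>J. \<Sum>j\<in>J. y i * y j * (K i m * K j m / K m m))"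
        unfolding B_def power2_eq_square sum_product sum_divide_distrib by (simp add: ac_simps)
      then show ?thesis by (simp add: schur_step_def right_diff_distrib sum_subtractf)
    qed
    finally show "0 \<le> (\<Sum>i\<in>I. \<Sum>j\<in>I. x i * x j * schur_step K m i j)"
      by (simp only: ext)
  qed
qed

primrec schur :: "(nat \<Rightarrow> nat \<Rightarrow> real) \<Rightarrow> nat \<Rightarrow> nat \<Rightarrow> nat \<Rightarrow> real" where
  "schur K 0 = K"
| "schur K (Suc m) = schur_step (schur K m) m"

lemma psd_kernel_schur: "psd_kernel K \<Longrightarrow> psd_kernel (schur K m)"
  by (induction m) (auto intro: psd_kernel_schur_step)

text \<open>A nonzero pivot clears its own row; the row of a zero pivot vanishes already by
  semidefiniteness; later steps keep zero rows.\<close>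

lemma schur_zero_row:
  assumes K: "psd_kernel K" shows "i < n \<Longrightarrow> schur K n i j = 0"
proof (induction n arbitrary: i j)
  case (Suc n)
  note P = psd_kernel_schur[OF K, of n]
  show ?case
  proof (cases "i = n")
    case True
    show ?thesis
    proof (cases "schur K n n n = 0")
      case True
      with \<open>i = n\<close> show ?thesis
        using psd_kernel_zero_row[OF P True, of j] psd_kernel_sym[OF P, of n j] by (simp add: schur_step_def)
    next
      case False
      with \<open>i = n\<close> show ?thesis
        using psd_kernel_sym[OF P, of n j] by (simp add: schur_step_def)
    qed
  next
    case False
    then have "i < n" using Suc.prems by simp
    then show ?thesis using Suc.IH by (simp add: schur_step_def)
  qed
qed simp

text \<open>A zero pivot yields a zero column, again through division by zero.\<close>

definition chol :: "(nat \<Rightarrow> nat \<Rightarrow> real) \<Rightarrow> nat \<Rightarrow> nat \<Rightarrow> real" where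
  "chol K i m = schur K m i m / sqrt (schur K m m m)"

text \<open>The factor is lower triangular, which later makes each Gaussian coordinate a finite
  sum.\<close>

lemma chol_eq_0: "psd_kernel K \<Longrightarrow> i < m \<Longrightarrow> chol K i m = 0"
  by (simp add: chol_def schur_zero_row)

text \<open>Invariant: \<open>K\<close> is the sum of the products collected so far plus the current
  Schur complement, whose row \<open>i\<close> is 0 once \<open>i\<close> has been
  eliminated.\<close>

lemma cholesky:
  assumes K: "psd_kernel K" and "i < n"
  shows "K i j = (\<Sum>m<n. chol K i m * chol K j m)"
proof -
  have 1: "K i j = (\<Sum>m<n. chol K i m * chol K j m) + schur K n i j" for n
  proof (induction n)
    case (Suc n)
    have "0 \<le> schur K n n n" by (rule psd_kernel_diag[OF psd_kernel_schur[OF K]])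
    then have "chol K i n * chol K j n = schur K n i n * schur K n j n / schur K n n n"
      by (simp add: chol_def)
    then show ?case using Suc by (simp add: schur_step_def)
  qed simp
  show ?thesis using 1[of n] schur_zero_row[OF K assms(2), of j] by linarith
qed

section \<open>The Gaussian limit\<close>

lemma perms_eq: "perms k = permutations_of_set {1..k}"
proof -
  have "length \<sigma> = k" if "set \<sigma> = {1..k}" "distinct \<sigma>" for \<sigma>
    using distinct_card[OF that(2)] that(1) by simp
  then have "permutations_of_set {1..k} \<subseteq> perms k"
    unfolding perms_def permutations_of_set_def by blast
  moreover have "perms k \<subseteq> permutations_of_set {1..k}"
    unfolding permutations_of_set_def using permsD by blast
  ultimately show ?thesis by blast
qed

lemma finite_perms: "finite (perms k)" and card_perms: "card (perms k) = fact k"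
  by (simp_all add: perms_eq)

text \<open>There are \<open>k!\<close> permutations of length \<open>k\<close>, so the hypothesis
  bounds the total weight of each length by a geometric term.\<close>

lemma summable_on_Sall_by_length:
  fixes w :: "nat \<Rightarrow> real"
  assumes w: "\<And>k. 0 \<le> w k" "\<And>k. fact k * w k \<le> C * q ^ k" and q: "0 \<le> q" "q < 1"
  shows "(\<lambda>\<sigma>. w (length \<sigma>)) summable_on Sall"
proof (rule nonneg_bdd_above_summable_on)
  show "bdd_above (sum (\<lambda>\<sigma>. w (length \<sigma>)) ` {F. F \<subseteq> Sall \<and> finite F})"
  proof (rule bdd_aboveI2)
    fix F assume "F \<in> {F. F \<subseteq> Sall \<and> finite F}"
    then have F: "F \<subseteq> Sall" "finite F" by auto
    define N where "N = Max (insert 0 (length ` F))"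
    have "F \<subseteq> (\<Union>k\<in>{..N}. perms k)"
    proof
      fix \<sigma> assume "\<sigma> \<in> F"
      then have "\<sigma> \<in> perms (length \<sigma>)" "length \<sigma> \<le> N"
        using F by (auto simp: N_def Sall_perms)
      then show "\<sigma> \<in> (\<Union>k\<in>{..N}. perms k)" by auto
    qed
    then have "(\<Sum>\<sigma>\<in>F. w (length \<sigma>)) \<le> (\<Sum>\<sigma>\<in>(\<Union>k\<in>{..N}. perms k). w (length \<sigma>))"
      by (intro sum_mono2) (auto simp: w finite_perms)
    also have "\<dots> = (\<Sum>k\<le>N. \<Sum>\<sigma>\<in>perms k. w (length \<sigma>))"
      by (rule sum.UNION_disjoint) (auto simp: finite_perms dest: permsD)
    also have "\<dots> = (\<Sum>k\<le>N. fact k * w k)"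
    proof (rule sum.cong[OF refl])
      fix k
      have "(\<Sum>\<sigma>\<in>perms k. w (length \<sigma>)) = (\<Sum>\<sigma>\<in>perms k. w k)"
        by (intro sum.cong refl) (auto dest: permsD)
      then show "(\<Sum>\<sigma>\<in>perms k. w (length \<sigma>)) = fact k * w k" by (simp add: card_perms)
    qed
    also have "\<dots> \<le> (\<Sum>k\<le>N. C * q ^ k)" by (intro sum_mono w)
    also have "\<dots> = C * (\<Sum>k\<le>N. q ^ k)" by (simp only: sum_distrib_left)
    also have "\<dots> \<le> C * (1 / (1 - q))"
    proof (rule mult_left_mono)
      have "(\<Sum>k\<le>N. q ^ k) \<le> suminf (\<lambda>k. q ^ k)"
        using q by (intro sum_le_suminf) (auto intro: summable_geometric)
      then show "(\<Sum>k\<le>N. q ^ k) \<le> 1 / (1 - q)" using q by (simp add: suminf_geometric)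
      show "0 \<le> C" using w(1)[of 0] w(2)[of 0] by simp
    qed
    finally show "(\<Sum>\<sigma>\<in>F. w (length \<sigma>)) \<le> C * (1 / (1 - q))" .
  qed
qed (simp add: w)

lemma gamma_const_pos: "0 < gamma_const"
  by (simp add: gamma_const_def)

lemma pw_pos: "0 < pw \<sigma>"
  by (simp add: pw_def gamma_const_pos)

lemma summable_pw: "pw summable_on Sall"
proof -
  have "(\<lambda>\<sigma>. gamma_const / (fact (length \<sigma>) ^ 2 * 2 ^ length \<sigma>)) summable_on Sall"
  proof (rule summable_on_Sall_by_length[of _ gamma_const "1/2"])
    fix k
    have "fact k * (gamma_const / (fact k ^ 2 * 2 ^ k)) = gamma_const / 2 ^ k / fact k"
      by (simp add: power2_eq_square)
    also have "\<dots> \<le> gamma_const / 2 ^ k / 1"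
      using gamma_const_pos by (intro divide_left_mono) (auto simp: fact_ge_1)
    finally show "fact k * (gamma_const / (fact k ^ 2 * 2 ^ k)) \<le> gamma_const * (1/2) ^ k"
      by (simp add: power_divide)
  qed (use gamma_const_pos in auto)
  then show ?thesis by (simp add: pw_def[abs_def])
qed

text \<open>Enumeration by \<open>list_decode\<close>, padded with 0 at lists that are not patterns:
  unordered sums over \<open>Sall\<close> become ordinary series, for which convergence theorems are
  at hand.\<close>

definition sidx :: "(nat list \<Rightarrow> real) \<Rightarrow> nat \<Rightarrow> real" where
  "sidx f n = (if list_decode n \<in> Sall then f (list_decode n) else 0)"

lemma has_sum_Sall_sums:
  assumes "(f has_sum S) Sall" shows "sidx f sums S"
proof -
  have "((\<lambda>\<sigma>. if \<sigma> \<in> Sall then f \<sigma> else 0) has_sum S) (UNIV :: nat list set)"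
    using assms by (rule has_sum_cong_neutral[THEN iffD1, rotated -1]) auto
  moreover have "range list_decode = UNIV" by (metis list_encode_inverse surjI)
  ultimately have "((\<lambda>\<sigma>. if \<sigma> \<in> Sall then f \<sigma> else 0) \<circ> list_decode has_sum S) UNIV"
    using has_sum_reindex[of list_decode UNIV "\<lambda>\<sigma>. if \<sigma> \<in> Sall then f \<sigma> else 0" S] inj_list_decode by simp
  then have "((\<lambda>\<sigma>. if \<sigma> \<in> Sall then f \<sigma> else 0) \<circ> list_decode) sums S"
    by (rule has_sum_imp_sums)
  then show ?thesis by (simp add: sidx_def[abs_def] comp_def)
qed

lemma infsum_Sall_suminf:
  assumes "f summable_on Sall" shows "(\<Sum>\<^sub>\<infinity>\<sigma>\<in>Sall. f \<sigma>) = suminf (sidx f)" "summable (sidx f)"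
proof -
  have "sidx f sums (\<Sum>\<^sub>\<infinity>\<sigma>\<in>Sall. f \<sigma>)"
    using assms by (intro has_sum_Sall_sums) (simp add: has_sum_infsum)
  then show "(\<Sum>\<^sub>\<infinity>\<sigma>\<in>Sall. f \<sigma>) = suminf (sidx f)" "summable (sidx f)"
    by (simp_all add: sums_unique sums_summable)
qed

lemma summable_on_Sall_iff:
  assumes "\<And>\<sigma>. \<sigma> \<in> Sall \<Longrightarrow> 0 \<le> f \<sigma>"
  shows "f summable_on Sall \<longleftrightarrow> summable (sidx f)"
proof
  assume "summable (sidx f)"
  then have "sidx f summable_on UNIV"
    using assms by (subst summable_on_UNIV_nonneg_real_iff) (auto simp: sidx_def)
  then have "(\<lambda>n. (\<lambda>\<sigma>. if \<sigma> \<in> Sall then f \<sigma> else 0) (list_decode n)) summable_on UNIV"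
    by (simp add: sidx_def[abs_def])
  moreover have "bij list_decode"
    using inj_list_decode by (metis bij_def list_encode_inverse surjI)
  ultimately have "(\<lambda>\<sigma>. if \<sigma> \<in> Sall then f \<sigma> else 0) summable_on (UNIV :: nat list set)"
    using summable_on_reindex_bij_betw[of list_decode UNIV UNIV "\<lambda>\<sigma>. if \<sigma> \<in> Sall then f \<sigma> else 0"] by simp
  then show "f summable_on Sall"
    by (rule summable_on_cong_neutral[THEN iffD1, rotated -1]) auto
qed (rule infsum_Sall_suminf(2))

lemma real_distribution_prob_space: "real_distribution M \<Longrightarrow> prob_space M"
  by (simp add: real_distribution_def)

interpretation gn: iid std_normal_distribution
proof -
  interpret prob_space std_normal_distribution
    by (rule real_distribution_prob_space[OF real_dist_normal_dist])
  show "iid std_normal_distribution" by unfold_locales simp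
qed

lemma gn_measurable [measurable]: "(\<lambda>z. z i) \<in> borel_measurable gn.Om"
proof -
  have "sets (std_normal_distribution) = sets (borel :: real measure)" by simp
  then show ?thesis
    using gn.measurable_Om_component[of i] measurable_cong_sets[OF refl, of std_normal_distribution borel gn.Om] by blast
qed

lemma gn_char:
  "(\<integral>z. iexp (\<Sum>m<N. b m * z m) \<partial>gn.Om) = of_real (exp (- (\<Sum>m<N. (b m)^2) / 2))"
proof -
  have int: "integrable std_normal_distribution (\<lambda>x. iexp (b m * x))" for m
    by (rule gn.integrable_iexp) (simp_all del: of_real_mult)
  have "(\<integral>z. iexp (\<Sum>m<N. b m * z m) \<partial>gn.Om) = (\<integral>z. (\<Prod>m<N. iexp (b m * z m)) \<partial>gn.Om)"
    by (intro Bochner_Integration.integral_cong refl) (simp add: exp_sum[symmetric] sum_distrib_left)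
  also have "\<dots> = (\<Prod>m<N. char std_normal_distribution (b m))"
    unfolding char_def
    by (rule gn.integral_Om_prod[of "{..<N}" "\<lambda>m x. iexp (b m * x)"]) (rule finite_lessThan, rule int)
  also have "\<dots> = of_real (\<Prod>m<N. exp (- ((b m)^2) / 2))"
    by (simp add: char_std_normal_distribution)
  also have "(\<Prod>m<N. exp (- ((b m)^2) / 2)) = exp (- (\<Sum>m<N. (b m)^2) / 2)"
    by (simp add: exp_sum[symmetric] sum_divide_distrib sum_negf)
  finally show ?thesis .
qed

lemma gn_square: "integrable gn.Om (\<lambda>z. (z i)^2)" "(\<integral>z. (z i)^2 \<partial>gn.Om) = 1"
proof -
  have d: "distr gn.Om std_normal_distribution (\<lambda>z. z i) = std_normal_distribution"
    unfolding gn.Om_def by (rule distr_PiM_component) (auto intro: gn.prob_space_axioms)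
  have m: "(\<lambda>z. z i) \<in> measurable gn.Om std_normal_distribution" by (rule gn.measurable_Om_component)
  have i: "integrable std_normal_distribution (\<lambda>x. x^2)"
    by (rule integrable_std_normal_distribution_moment)
  then show "integrable gn.Om (\<lambda>z. (z i)^2)"
    using integrable_distr_eq[OF m, of "\<lambda>x. x^2"] by (simp add: d)
  have "(\<integral>z. (z i)^2 \<partial>gn.Om) = (\<integral>x. x^2 \<partial>std_normal_distribution)"
    by (rule gn.integral_Om_component[of "\<lambda>x. x^2"]) simp
  also have "\<dots> = 1" using std_normal_distribution_even_moments(1)[of 1] by (simp add: fact_numeral)
  finally show "(\<integral>z. (z i)^2 \<partial>gn.Om) = 1" .
qed

lemma gn_product: "integrable gn.Om (\<lambda>z. z i * z j)" "(\<integral>z. z i * z j \<partial>gn.Om) = (if i = j then 1 else 0)"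
proof -
  show "integrable gn.Om (\<lambda>z. z i * z j)"
  proof (rule Bochner_Integration.integrable_bound)
    show "integrable gn.Om (\<lambda>z. (z i)^2 + (z j)^2)" by (intro Bochner_Integration.integrable_add gn_square)
    show "AE z in gn.Om. norm (z i * z j) \<le> norm ((z i)^2 + (z j)^2)"
    proof (rule AE_I2)
      fix z :: "nat \<Rightarrow> real"
      have "0 \<le> (\<bar>z i\<bar> - \<bar>z j\<bar>)^2" by simp
      then have "2 * (\<bar>z i\<bar> * \<bar>z j\<bar>) \<le> (z i)^2 + (z j)^2" by (simp add: power2_diff)
      moreover have "0 \<le> \<bar>z i\<bar> * \<bar>z j\<bar>" by simp
      ultimately have "\<bar>z i\<bar> * \<bar>z j\<bar> \<le> (z i)^2 + (z j)^2" by linarith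
      then show "norm (z i * z j) \<le> norm ((z i)^2 + (z j)^2)" by (simp add: abs_mult)
    qed
  qed measurable
  show "(\<integral>z. z i * z j \<partial>gn.Om) = (if i = j then 1 else 0)"
  proof (cases "i = j")
    case True
    then show ?thesis using gn_square(2)[of j] by (simp add: power2_eq_square)
  next
    case False
    have "(\<integral>z. (\<Prod>m\<in>{i, j}. z m) \<partial>gn.Om) = (\<Prod>m\<in>{i, j}. \<integral>x. x \<partial>std_normal_distribution)"
      using integrable_std_normal_distribution_moment[of 1]
      by (intro gn.integral_Om_prod[of "{i, j}" "\<lambda>m x. x"]) auto
    moreover have "(\<integral>x. x \<partial>std_normal_distribution) = 0"
      using integral_std_normal_distribution_moment_odd[of 1] by simp
    ultimately show ?thesis using False by simp
  qed
qed

section \<open>Gaussian fields with a given covariance kernel\<close>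

locale gaussian_kernel =
  fixes R :: "nat list \<Rightarrow> nat list \<Rightarrow> real"
  assumes R_sym: "\<And>\<sigma> \<tau>. \<sigma> \<in> Sall \<Longrightarrow> \<tau> \<in> Sall \<Longrightarrow> R \<sigma> \<tau> = R \<tau> \<sigma>"
    and R_psd: "\<And>F t. finite F \<Longrightarrow> F \<subseteq> Sall \<Longrightarrow> 0 \<le> (\<Sum>\<sigma>\<in>F. \<Sum>\<tau>\<in>F. t \<sigma> * t \<tau> * R \<sigma> \<tau>)"
    and R_diag: "\<And>\<sigma>. \<sigma> \<in> Sall \<Longrightarrow> R \<sigma> \<sigma> \<le> 1"
begin

definition K :: "nat \<Rightarrow> nat \<Rightarrow> real" where
  "K i j = (if list_decode i \<in> Sall \<and> list_decode j \<in> Sall then R (list_decode i) (list_decode j) else 0)"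

lemma psd_K: "psd_kernel K"
  unfolding psd_kernel_def
proof (intro conjI allI impI)
  show "K i j = K j i" for i j by (auto simp: K_def R_sym)
  fix I :: "nat set" and x :: "nat \<Rightarrow> real" assume fin: "finite I"
  define J where "J = {i \<in> I. list_decode i \<in> Sall}"
  have J: "finite J" "J \<subseteq> I" using fin by (auto simp: J_def)
  have inj: "inj_on list_decode J" by (rule inj_list_decode)
  have "(\<Sum>i\<in>I. \<Sum>j\<in>I. x i * x j * K i j) = (\<Sum>i\<in>I. \<Sum>j\<in>J. x i * x j * K i j)"
    using fin J by (intro sum.cong refl sum.mono_neutral_right) (auto simp: J_def K_def)
  also have "\<dots> = (\<Sum>i\<in>J. \<Sum>j\<in>J. x i * x j * K i j)"
    using fin J by (intro sum.mono_neutral_right) (auto simp: J_def K_def)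
  also have "\<dots> = (\<Sum>i\<in>J. \<Sum>j\<in>J. x (list_encode (list_decode i)) * x (list_encode (list_decode j)) * R (list_decode i) (list_decode j))"
    by (intro sum.cong refl) (auto simp: J_def K_def)
  also have "\<dots> = (\<Sum>\<sigma>\<in>list_decode ` J. \<Sum>\<tau>\<in>list_decode ` J. x (list_encode \<sigma>) * x (list_encode \<tau>) * R \<sigma> \<tau>)"
    by (simp only: sum.reindex[OF inj] comp_def)
  also have "0 \<le> \<dots>"
    using J by (intro R_psd[of "list_decode ` J" "\<lambda>\<sigma>. x (list_encode \<sigma>)"]) (auto simp: J_def)
  finally show "0 \<le> (\<Sum>i\<in>I. \<Sum>j\<in>I. x i * x j * K i j)" .
qed

text \<open>Row \<open>list_encode \<sigma>\<close> of the Cholesky factor applied to independent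
  normals, cut off at the diagonal.\<close>

definition gp :: "(nat \<Rightarrow> real) \<Rightarrow> nat list \<Rightarrow> real" where
  "gp z \<sigma> = (if \<sigma> \<in> Sall then \<Sum>m\<le>list_encode \<sigma>. chol K (list_encode \<sigma>) m * z m else 0)"

lemma gp_eq:
  assumes "\<sigma> \<in> Sall" "list_encode \<sigma> < N"
  shows "gp z \<sigma> = (\<Sum>m<N. chol K (list_encode \<sigma>) m * z m)"
proof -
  have "gp z \<sigma> = (\<Sum>m\<le>list_encode \<sigma>. chol K (list_encode \<sigma>) m * z m)"
    using assms(1) by (simp only: gp_def if_True)
  also have "\<dots> = (\<Sum>m<N. chol K (list_encode \<sigma>) m * z m)"
  proof (rule sum.mono_neutral_left)
    show "\<forall>m\<in>{..<N} - {..list_encode \<sigma>}. chol K (list_encode \<sigma>) m * z m = 0"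
      by (simp add: chol_eq_0[OF psd_K])
  qed (use assms(2) in auto)
  finally show ?thesis .
qed

lemma chol_product:
  assumes "\<sigma> \<in> Sall" "\<tau> \<in> Sall" "list_encode \<sigma> < N"
  shows "(\<Sum>m<N. chol K (list_encode \<sigma>) m * chol K (list_encode \<tau>) m) = R \<sigma> \<tau>"
proof -
  have "K (list_encode \<sigma>) (list_encode \<tau>) = R \<sigma> \<tau>" by (simp add: K_def assms)
  then show ?thesis using cholesky[OF psd_K assms(3), of "list_encode \<tau>"] by simp
qed

lemma measurable_gp [measurable]: "(\<lambda>z. gp z \<sigma>) \<in> borel_measurable gn.Om"
proof (cases "\<sigma> \<in> Sall")
  case True
  then show ?thesis unfolding gp_def
    by (simp only: if_True) (intro borel_measurable_sum borel_measurable_times borel_measurable_const gn_measurable)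
qed (simp add: gp_def)

text \<open>A common \<open>N\<close> beyond all codes in \<open>F\<close> writes the combination as
  one linear form in independent normals; its variance is read off from the factorisation.\<close>

lemma gp_char:
  assumes F: "finite F" "F \<subseteq> Sall"
  shows "(\<integral>z. iexp (\<Sum>\<sigma>\<in>F. t \<sigma> * gp z \<sigma>) \<partial>gn.Om) = of_real (exp (- (\<Sum>\<sigma>\<in>F. \<Sum>\<tau>\<in>F. t \<sigma> * t \<tau> * R \<sigma> \<tau>) / 2))"
proof -
  define N where "N = Suc (Max (insert 0 (list_encode ` F)))"
  have N: "list_encode \<sigma> < N" if "\<sigma> \<in> F" for \<sigma>
    using that F(1) unfolding N_def by (auto simp: less_Suc_eq_le)
  define b where "b m = (\<Sum>\<sigma>\<in>F. t \<sigma> * chol K (list_encode \<sigma>) m)" for m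
  have lin: "(\<Sum>\<sigma>\<in>F. t \<sigma> * gp z \<sigma>) = (\<Sum>m<N. b m * z m)" for z
  proof -
    have "(\<Sum>\<sigma>\<in>F. t \<sigma> * gp z \<sigma>) = (\<Sum>\<sigma>\<in>F. \<Sum>m<N. t \<sigma> * chol K (list_encode \<sigma>) m * z m)"
      using F N by (intro sum.cong refl) (simp add: gp_eq[of _ N] subset_iff sum_distrib_left mult.assoc)
    also have "\<dots> = (\<Sum>m<N. \<Sum>\<sigma>\<in>F. t \<sigma> * chol K (list_encode \<sigma>) m * z m)" by (rule sum.swap)
    finally show ?thesis by (simp add: b_def sum_distrib_right)
  qed
  have "(\<Sum>m<N. (b m)^2) = (\<Sum>m<N. \<Sum>\<sigma>\<in>F. \<Sum>\<tau>\<in>F. t \<sigma> * t \<tau> * (chol K (list_encode \<sigma>) m * chol K (list_encode \<tau>) m))"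
    by (simp add: b_def power2_eq_square sum_product ac_simps)
  also have "\<dots> = (\<Sum>\<sigma>\<in>F. \<Sum>m<N. \<Sum>\<tau>\<in>F. t \<sigma> * t \<tau> * (chol K (list_encode \<sigma>) m * chol K (list_encode \<tau>) m))"
    by (rule sum.swap)
  also have "\<dots> = (\<Sum>\<sigma>\<in>F. \<Sum>\<tau>\<in>F. \<Sum>m<N. t \<sigma> * t \<tau> * (chol K (list_encode \<sigma>) m * chol K (list_encode \<tau>) m))"
    by (intro sum.cong refl sum.swap)
  also have "\<dots> = (\<Sum>\<sigma>\<in>F. \<Sum>\<tau>\<in>F. t \<sigma> * t \<tau> * R \<sigma> \<tau>)"
    using F N by (intro sum.cong refl) (simp add: sum_distrib_left[symmetric] chol_product subset_iff)
  finally show ?thesis unfolding lin gn_char by simp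
qed

lemma gp_product:
  assumes "\<sigma> \<in> Sall" "\<tau> \<in> Sall"
  shows "integrable gn.Om (\<lambda>z. gp z \<sigma> * gp z \<tau>)" "(\<integral>z. gp z \<sigma> * gp z \<tau> \<partial>gn.Om) = R \<sigma> \<tau>"
proof -
  define N where "N = Suc (max (list_encode \<sigma>) (list_encode \<tau>))"
  have N: "list_encode \<sigma> < N" "list_encode \<tau> < N" by (auto simp: N_def)
  let ?a = "chol K (list_encode \<sigma>)" and ?b = "chol K (list_encode \<tau>)"
  have eq: "gp z \<sigma> * gp z \<tau> = (\<Sum>m<N. \<Sum>l<N. ?a m * ?b l * (z m * z l))" for z
    unfolding gp_eq[OF assms(1) N(1)] gp_eq[OF assms(2) N(2)] sum_product by (simp add: ac_simps)
  show "integrable gn.Om (\<lambda>z. gp z \<sigma> * gp z \<tau>)"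
    unfolding eq by (intro Bochner_Integration.integrable_sum integrable_mult_right gn_product)
  have "(\<integral>z. gp z \<sigma> * gp z \<tau> \<partial>gn.Om) = (\<Sum>m<N. \<integral>z. (\<Sum>l<N. ?a m * ?b l * (z m * z l)) \<partial>gn.Om)"
    unfolding eq by (rule Bochner_Integration.integral_sum)
      (intro Bochner_Integration.integrable_sum integrable_mult_right gn_product)
  also have "\<dots> = (\<Sum>m<N. \<Sum>l<N. ?a m * ?b l * (if m = l then 1 else 0))"
  proof (rule sum.cong[OF refl])
    fix m
    have "(\<integral>z. (\<Sum>l<N. ?a m * ?b l * (z m * z l)) \<partial>gn.Om) = (\<Sum>l<N. \<integral>z. ?a m * ?b l * (z m * z l) \<partial>gn.Om)"
      by (rule Bochner_Integration.integral_sum) (intro integrable_mult_right gn_product)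
    then show "(\<integral>z. (\<Sum>l<N. ?a m * ?b l * (z m * z l)) \<partial>gn.Om) = (\<Sum>l<N. ?a m * ?b l * (if m = l then 1 else 0))"
      by (simp add: gn_product)
  qed
  also have "\<dots> = (\<Sum>m<N. ?a m * ?b m)"
  proof (rule sum.cong[OF refl])
    fix m assume "m \<in> {..<N}"
    have "(\<Sum>l<N. ?a m * ?b l * (if m = l then 1 else 0)) = (\<Sum>l<N. if m = l then ?a m * ?b l else 0)"
      by (intro sum.cong refl) simp
    then show "(\<Sum>l<N. ?a m * ?b l * (if m = l then 1 else 0)) = ?a m * ?b m"
      using \<open>m \<in> {..<N}\<close> by (simp add: sum.delta)
  qed
  finally show "(\<integral>z. gp z \<sigma> * gp z \<tau> \<partial>gn.Om) = R \<sigma> \<tau>"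
    using chol_product[OF assms N(1)] by simp
qed

text \<open>Semidefiniteness for the weights (1, 1) and (1, -1), with diagonal entries at most
  1.\<close>

lemma R_abs_le: assumes "\<sigma> \<in> Sall" "\<tau> \<in> Sall" shows "\<bar>R \<sigma> \<tau>\<bar> \<le> 1"
proof (cases "\<sigma> = \<tau>")
  case True
  then show ?thesis using R_psd[of "{\<sigma>}" "\<lambda>_. 1"] R_diag assms by simp
next
  case False
  have "0 \<le> (\<Sum>a\<in>{\<sigma>, \<tau>}. \<Sum>b\<in>{\<sigma>, \<tau>}. (if a = \<sigma> then 1 else s) * (if b = \<sigma> then 1 else s) * R a b)" for s :: real
    by (rule R_psd[of "{\<sigma>, \<tau>}" "\<lambda>a. if a = \<sigma> then 1 else s"]) (use assms in auto)
  from this[of 1] this[of "-1"] show ?thesis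
    using False R_sym[OF assms] R_diag[OF assms(1)] R_diag[OF assms(2)] by simp
qed

end

lemma pw_nonneg: "0 \<le> pw \<sigma>"
  using pw_pos[of \<sigma>] by simp

lemma Hsp_product_abs_summable:
  assumes "f \<in> Hsp" "g \<in> Hsp"
  shows "(\<lambda>\<sigma>. \<bar>pw \<sigma> * f \<sigma> * g \<sigma>\<bar>) summable_on Sall"
proof (rule summable_on_comparison_test)
  show "(\<lambda>\<sigma>. pw \<sigma> * (f \<sigma>)^2 + pw \<sigma> * (g \<sigma>)^2) summable_on Sall"
    using assms by (intro summable_on_add) (auto simp: Hsp_def)
  fix \<sigma>
  have "0 \<le> (\<bar>f \<sigma>\<bar> - \<bar>g \<sigma>\<bar>)^2" by simp
  then have "2 * (\<bar>f \<sigma>\<bar> * \<bar>g \<sigma>\<bar>) \<le> (f \<sigma>)^2 + (g \<sigma>)^2" by (simp add: power2_diff)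
  moreover have "0 \<le> \<bar>f \<sigma>\<bar> * \<bar>g \<sigma>\<bar>" by simp
  ultimately have "\<bar>f \<sigma>\<bar> * \<bar>g \<sigma>\<bar> \<le> (f \<sigma>)^2 + (g \<sigma>)^2" by linarith
  then have "pw \<sigma> * (\<bar>f \<sigma>\<bar> * \<bar>g \<sigma>\<bar>) \<le> pw \<sigma> * ((f \<sigma>)^2 + (g \<sigma>)^2)"
    by (rule mult_left_mono[OF _ pw_nonneg])
  then show "\<bar>pw \<sigma> * f \<sigma> * g \<sigma>\<bar> \<le> pw \<sigma> * (f \<sigma>)^2 + pw \<sigma> * (g \<sigma>)^2"
    using pw_nonneg[of \<sigma>] by (simp add: abs_mult distrib_left mult.assoc)
qed simp

lemma Hsp_product_summable:
  assumes "f \<in> Hsp" "g \<in> Hsp"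
  shows "(\<lambda>\<sigma>. pw \<sigma> * f \<sigma> * g \<sigma>) summable_on Sall"
  using Hsp_product_abs_summable[OF assms] abs_summable_summable[of "\<lambda>\<sigma>. pw \<sigma> * f \<sigma> * g \<sigma>" Sall] by simp

lemma one_in_Hsp: "(\<lambda>_. 1) \<in> Hsp"
  using summable_pw by (simp add: Hsp_def)

definition Sall_upto :: "nat \<Rightarrow> nat list set" where
  "Sall_upto m = list_decode ` {n \<in> {..<m}. list_decode n \<in> Sall}"

lemma finite_Sall_upto: "finite (Sall_upto m)" and Sall_upto_subset: "Sall_upto m \<subseteq> Sall"
  by (auto simp: Sall_upto_def)

lemma sum_sidx: "(\<Sum>n<m. sidx f n) = (\<Sum>\<sigma>\<in>Sall_upto m. f \<sigma>)"
proof -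
  have "(\<Sum>n<m. sidx f n) = (\<Sum>n\<in>{n \<in> {..<m}. list_decode n \<in> Sall}. f (list_decode n))"
    unfolding sidx_def by (rule sum.inter_filter[symmetric]) simp
  also have "\<dots> = (\<Sum>\<sigma>\<in>Sall_upto m. f \<sigma>)"
    unfolding Sall_upto_def by (subst sum.reindex[OF inj_list_decode]) simp
  finally show ?thesis .
qed

section \<open>The Gaussian element of the Hilbert space\<close>

context gaussian_kernel
begin

definition good :: "(nat \<Rightarrow> real) \<Rightarrow> bool" where
  "good z \<longleftrightarrow> (\<lambda>\<sigma>. pw \<sigma> * (gp z \<sigma>)^2) summable_on Sall"

abbreviation gsum :: "(nat \<Rightarrow> real) \<Rightarrow> nat \<Rightarrow> real" where
  "gsum z \<equiv> sidx (\<lambda>\<sigma>. pw \<sigma> * (gp z \<sigma>)^2)"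

lemma gsum_nonneg: "0 \<le> gsum z n"
  by (simp add: sidx_def pw_nonneg)

lemma measurable_gsum [measurable]: "(\<lambda>z. gsum z n) \<in> borel_measurable gn.Om"
proof (cases "list_decode n \<in> Sall")
  case True
  then show ?thesis unfolding sidx_def
    by (simp only: if_True) (intro borel_measurable_times borel_measurable_power borel_measurable_const measurable_gp)
qed (simp add: sidx_def)

lemma good_iff: "good z \<longleftrightarrow> (\<Sum>n. ennreal (gsum z n)) \<noteq> top"
proof -
  have "good z \<longleftrightarrow> summable (gsum z)"
    unfolding good_def by (rule summable_on_Sall_iff) (simp add: pw_nonneg)
  also have "\<dots> \<longleftrightarrow> (\<Sum>n. ennreal (gsum z n)) \<noteq> top"
  proof
    assume "summable (gsum z)"
    then show "(\<Sum>n. ennreal (gsum z n)) \<noteq> top"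
      by (rule ennreal_suminf_neq_top) (rule gsum_nonneg)
  next
    assume *: "(\<Sum>n. ennreal (gsum z n)) \<noteq> top"
    show "summable (gsum z)"
      by (rule summable_suminf_not_top[OF _ *]) (rule gsum_nonneg)
  qed
  finally show ?thesis .
qed

lemma measurable_gsum_series: "(\<lambda>z. \<Sum>n. ennreal (gsum z n)) \<in> borel_measurable gn.Om"
  by (intro borel_measurable_suminf_order measurable_compose[OF measurable_gsum measurable_ennreal])

lemma pred_good [measurable]: "Measurable.pred gn.Om good"
proof -
  have "{z \<in> space gn.Om. (\<Sum>n. ennreal (gsum z n)) \<noteq> top} \<in> sets gn.Om"
    using measurable_gsum_series by measurable
  then show ?thesis by (simp add: pred_def good_iff)
qed

text \<open>By Tonelli the expected squared norm is the weighted sum of the variances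
  \<open>R \<sigma> \<sigma>\<close>, each at most 1, and the weights are summable.\<close>

lemma AE_good: "AE z in gn.Om. good z"
proof -
  have "(\<integral>\<^sup>+z. (\<Sum>n. ennreal (gsum z n)) \<partial>gn.Om) = (\<Sum>n. \<integral>\<^sup>+z. ennreal (gsum z n) \<partial>gn.Om)"
    by (rule nn_integral_suminf) (rule measurable_compose[OF measurable_gsum measurable_ennreal])
  also have "\<dots> \<le> (\<Sum>n. ennreal (sidx pw n))"
  proof (rule suminf_le)
    fix n
    show "(\<integral>\<^sup>+z. ennreal (gsum z n) \<partial>gn.Om) \<le> ennreal (sidx pw n)"
    proof (cases "list_decode n \<in> Sall")
      case True
      let ?s = "list_decode n"
      have i: "integrable gn.Om (\<lambda>z. pw ?s * (gp z ?s)^2)"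
        unfolding power2_eq_square by (intro integrable_mult_right gp_product True)
      have "(\<integral>\<^sup>+z. ennreal (gsum z n) \<partial>gn.Om) = (\<integral>\<^sup>+z. ennreal (pw ?s * (gp z ?s)^2) \<partial>gn.Om)"
        using True by (simp add: sidx_def)
      also have "\<dots> = ennreal (\<integral>z. pw ?s * (gp z ?s)^2 \<partial>gn.Om)"
        by (rule nn_integral_eq_integral[OF i]) (simp add: pw_nonneg)
      also have "(\<integral>z. pw ?s * (gp z ?s)^2 \<partial>gn.Om) = pw ?s * R ?s ?s"
        unfolding power2_eq_square by (simp add: gp_product[OF True True])
      also have "ennreal (pw ?s * R ?s ?s) \<le> ennreal (pw ?s)"
        using R_diag[OF True] pw_nonneg[of ?s] by (intro ennreal_leI) (simp add: mult_left_le)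
      finally show ?thesis using True by (simp add: sidx_def)
    qed (simp add: sidx_def)
  qed auto
  also have "\<dots> < top"
  proof -
    have "0 \<le> sidx pw n" for n by (simp add: sidx_def pw_nonneg)
    from ennreal_suminf_neq_top[OF infsum_Sall_suminf(2)[OF summable_pw] this]
    show ?thesis by (simp only: top.not_eq_extremum)
  qed
  finally have "AE z in gn.Om. (\<Sum>n. ennreal (gsum z n)) \<noteq> \<infinity>"
    by (intro nn_integral_PInf_AE measurable_gsum_series) (simp only: top.not_eq_extremum infinity_ennreal_def)
  then show ?thesis by (simp only: good_iff infinity_ennreal_def)
qed

text \<open>Membership in \<open>Hsp\<close> is wanted at every sample point, so the null set of
  paths that are not square summable is sent to 0.\<close>

definition gH :: "(nat \<Rightarrow> real) \<Rightarrow> nat list \<Rightarrow> real" where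
  "gH z \<sigma> = (if good z then gp z \<sigma> else 0)"

lemma gH_Hsp: "gH z \<in> Hsp"
  by (cases "good z") (simp_all add: gH_def[abs_def] Hsp_def good_def)

lemma measurable_gH [measurable]: "(\<lambda>z. gH z \<sigma>) \<in> borel_measurable gn.Om"
  unfolding gH_def by (rule measurable_If) (use pred_good in \<open>auto simp: pred_def\<close>)

lemma AE_gH: "AE z in gn.Om. \<forall>\<sigma>. gH z \<sigma> = gp z \<sigma>"
  using AE_good by eventually_elim (simp add: gH_def)

lemma gH_product:
  assumes "\<sigma> \<in> Sall" "\<tau> \<in> Sall"
  shows "integrable gn.Om (\<lambda>z. gH z \<sigma> * gH z \<tau>)" "(\<integral>z. gH z \<sigma> * gH z \<tau> \<partial>gn.Om) = R \<sigma> \<tau>"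
proof -
  have ae: "AE z in gn.Om. gH z \<sigma> * gH z \<tau> = gp z \<sigma> * gp z \<tau>"
    using AE_gH by eventually_elim simp
  have m: "(\<lambda>z. gH z \<sigma> * gH z \<tau>) \<in> borel_measurable gn.Om" "(\<lambda>z. gp z \<sigma> * gp z \<tau>) \<in> borel_measurable gn.Om"
    by (intro borel_measurable_times measurable_gH measurable_gp)+
  show "integrable gn.Om (\<lambda>z. gH z \<sigma> * gH z \<tau>)"
    using integrable_cong_AE[OF m ae] gp_product(1)[OF assms] by simp
  show "(\<integral>z. gH z \<sigma> * gH z \<tau> \<partial>gn.Om) = R \<sigma> \<tau>"
    using integral_cong_AE[OF m ae] gp_product(2)[OF assms] by simp
qed

lemma measurable_iexp_gH: "(\<lambda>z. iexp (\<Sum>\<sigma>\<in>F. t \<sigma> * gH z \<sigma>)) \<in> borel_measurable gn.Om"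
  "(\<lambda>z. iexp (\<Sum>\<sigma>\<in>F. t \<sigma> * gp z \<sigma>)) \<in> borel_measurable gn.Om"
proof -
  have 1: "(\<lambda>z. \<Sum>\<sigma>\<in>F. t \<sigma> * gH z \<sigma>) \<in> borel_measurable gn.Om"
    "(\<lambda>z. \<Sum>\<sigma>\<in>F. t \<sigma> * gp z \<sigma>) \<in> borel_measurable gn.Om"
    by (intro borel_measurable_sum borel_measurable_times borel_measurable_const measurable_gH measurable_gp)+
  have 2: "iexp \<in> borel_measurable borel"
    by (intro borel_measurable_continuous_onI continuous_intros)
  show "(\<lambda>z. iexp (\<Sum>\<sigma>\<in>F. t \<sigma> * gH z \<sigma>)) \<in> borel_measurable gn.Om"
    "(\<lambda>z. iexp (\<Sum>\<sigma>\<in>F. t \<sigma> * gp z \<sigma>)) \<in> borel_measurable gn.Om"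
    using measurable_compose[OF 1(1) 2] measurable_compose[OF 1(2) 2] by simp_all
qed

lemma gH_char:
  assumes F: "finite F" "F \<subseteq> Sall"
  shows "(\<integral>z. iexp (\<Sum>\<sigma>\<in>F. t \<sigma> * gH z \<sigma>) \<partial>gn.Om) = of_real (exp (- (\<Sum>\<sigma>\<in>F. \<Sum>\<tau>\<in>F. t \<sigma> * t \<tau> * R \<sigma> \<tau>) / 2))"
proof -
  have "(\<integral>z. iexp (\<Sum>\<sigma>\<in>F. t \<sigma> * gH z \<sigma>) \<partial>gn.Om) = (\<integral>z. iexp (\<Sum>\<sigma>\<in>F. t \<sigma> * gp z \<sigma>) \<partial>gn.Om)"
    by (rule integral_cong_AE[OF measurable_iexp_gH]) (use AE_gH in eventually_elim, simp)
  then show ?thesis by (simp only: gp_char[OF F])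
qed

text \<open>The partial sums of the inner product are Gaussian with variances \<open>v m\<close> and
  converge pointwise, so their characteristic functions converge by dominated convergence.\<close>

lemma hinner_gH_gaussian:
  assumes h: "h \<in> Hsp"
  shows "centered_gaussian_rv gn.Om (\<lambda>z. hinner (gH z) h)"
proof -
  define a where "a \<sigma> = pw \<sigma> * h \<sigma>" for \<sigma>
  define X where "X z = hinner (gH z) h" for z
  define Y where "Y m z = (\<Sum>\<sigma>\<in>Sall_upto m. a \<sigma> * gH z \<sigma>)" for m z
  have YX: "(\<lambda>m. Y m z) \<longlonglongrightarrow> X z" for z
  proof -
    have "(\<lambda>\<sigma>. pw \<sigma> * gH z \<sigma> * h \<sigma>) summable_on Sall" by (rule Hsp_product_summable[OF gH_Hsp h])
    then have "sidx (\<lambda>\<sigma>. pw \<sigma> * gH z \<sigma> * h \<sigma>) sums X z"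
      unfolding X_def hinner_def by (intro has_sum_Sall_sums) (simp add: has_sum_infsum)
    then show ?thesis unfolding sums_def sum_sidx by (simp add: Y_def a_def ac_simps)
  qed
  have mY: "Y m \<in> borel_measurable gn.Om" for m
    unfolding Y_def[abs_def] by (intro borel_measurable_sum borel_measurable_times borel_measurable_const measurable_gH)
  have mX: "X \<in> borel_measurable gn.Om"
    by (rule borel_measurable_LIMSEQ_real[OF YX mY])
  define v where "v m = (\<Sum>\<sigma>\<in>Sall_upto m. \<Sum>\<tau>\<in>Sall_upto m. a \<sigma> * a \<tau> * R \<sigma> \<tau>)" for m
  have v0: "0 \<le> v m" for m
    unfolding v_def by (rule R_psd[OF finite_Sall_upto Sall_upto_subset])
  \<comment> \<open>Finite because the constant 1 lies in \<open>Hsp\<close>; \<open>S^2\<close>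
    bounds all variances, as covariances are at most 1 in absolute value.\<close>
  define S where "S = (\<Sum>\<^sub>\<infinity>\<sigma>\<in>Sall. \<bar>a \<sigma>\<bar>)"
  have sa: "(\<lambda>\<sigma>. \<bar>a \<sigma>\<bar>) summable_on Sall"
    using Hsp_product_abs_summable[OF one_in_Hsp h] unfolding a_def mult_1_right .
  have aS: "(\<Sum>\<sigma>\<in>Sall_upto m. \<bar>a \<sigma>\<bar>) \<le> S" for m
    unfolding S_def by (rule finite_sum_le_infsum[OF sa finite_Sall_upto Sall_upto_subset]) simp
  have vS: "v m \<le> S^2" for m
  proof -
    have "v m \<le> (\<Sum>\<sigma>\<in>Sall_upto m. \<Sum>\<tau>\<in>Sall_upto m. \<bar>a \<sigma>\<bar> * \<bar>a \<tau>\<bar>)"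
      unfolding v_def
    proof (intro sum_mono)
      fix \<sigma> \<tau> assume "\<sigma> \<in> Sall_upto m" "\<tau> \<in> Sall_upto m"
      then have "\<bar>R \<sigma> \<tau>\<bar> \<le> 1" using Sall_upto_subset[of m] by (intro R_abs_le) auto
      then have "\<bar>a \<sigma> * a \<tau>\<bar> * \<bar>R \<sigma> \<tau>\<bar> \<le> \<bar>a \<sigma> * a \<tau>\<bar> * 1" by (intro mult_left_mono) auto
      then show "a \<sigma> * a \<tau> * R \<sigma> \<tau> \<le> \<bar>a \<sigma>\<bar> * \<bar>a \<tau>\<bar>"
        using abs_ge_self[of "a \<sigma> * a \<tau> * R \<sigma> \<tau>"] by (simp add: abs_mult)
    qed
    also have "\<dots> = (\<Sum>\<sigma>\<in>Sall_upto m. \<bar>a \<sigma>\<bar>)^2" by (simp add: power2_eq_square sum_product)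
    also have "\<dots> \<le> S^2" by (intro power_mono aS sum_nonneg) simp
    finally show ?thesis .
  qed
  have lim: "(\<lambda>m. complex_of_real (exp (- (v m * t^2 / 2)))) \<longlonglongrightarrow> (\<integral>z. iexp (t * X z) \<partial>gn.Om)" for t
  proof -
    have "(\<lambda>m. \<integral>z. iexp (t * Y m z) \<partial>gn.Om) \<longlonglongrightarrow> (\<integral>z. iexp (t * X z) \<partial>gn.Om)"
    proof (rule integral_dominated_convergence[where w = "\<lambda>_. 1"])
      have c: "(\<lambda>x. iexp (t * x)) \<in> borel_measurable borel"
        by (intro borel_measurable_continuous_onI continuous_intros)
      show "(\<lambda>z. iexp (t * X z)) \<in> borel_measurable gn.Om" using measurable_compose[OF mX c] by simp
      show "(\<lambda>z. iexp (t * Y m z)) \<in> borel_measurable gn.Om" for m using measurable_compose[OF mY c] by simp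
      show "AE z in gn.Om. (\<lambda>m. iexp (t * Y m z)) \<longlonglongrightarrow> iexp (t * X z)"
        by (intro AE_I2 tendsto_intros YX)
    qed auto
    moreover have "(\<integral>z. iexp (t * Y m z) \<partial>gn.Om) = complex_of_real (exp (- (v m * t^2 / 2)))" for m
    proof -
      have "t * Y m z = (\<Sum>\<sigma>\<in>Sall_upto m. (t * a \<sigma>) * gH z \<sigma>)" for z
        by (simp add: Y_def sum_distrib_left mult.assoc)
      then have "(\<integral>z. iexp (t * Y m z) \<partial>gn.Om) =
        of_real (exp (- (\<Sum>\<sigma>\<in>Sall_upto m. \<Sum>\<tau>\<in>Sall_upto m. (t * a \<sigma>) * (t * a \<tau>) * R \<sigma> \<tau>) / 2))"
        using gH_char[OF finite_Sall_upto Sall_upto_subset, of "\<lambda>\<sigma>. t * a \<sigma>" m] by (simp only:)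
      also have "(\<Sum>\<sigma>\<in>Sall_upto m. \<Sum>\<tau>\<in>Sall_upto m. (t * a \<sigma>) * (t * a \<tau>) * R \<sigma> \<tau>) = v m * t^2"
        unfolding v_def sum_distrib_right by (intro sum.cong refl) (simp add: power2_eq_square)
      finally show ?thesis by simp
    qed
    ultimately show ?thesis by simp
  qed
  \<comment> \<open>Convergence of the variances is extracted from the characteristic functions at
    \<open>t = 1\<close>: these are \<open>exp (- v m / 2)\<close> with a positive limit, since
    \<open>v\<close> is bounded, so logarithms may be taken.\<close>
  define c where "c = Re (\<integral>z. iexp (1 * X z) \<partial>gn.Om)"
  have c: "(\<lambda>m. exp (- (v m / 2))) \<longlonglongrightarrow> c"
    using tendsto_Re[OF lim[of 1]] by (simp add: c_def)
  have "exp (- (S^2 / 2)) \<le> c"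
    by (rule LIMSEQ_le_const[OF c]) (use vS in \<open>auto intro!: exI[of _ 0]\<close>)
  then have c0: "c > 0" by (rule less_le_trans[OF exp_gt_zero])
  define v' where "v' = - 2 * ln c"
  have vlim: "v \<longlonglongrightarrow> v'"
  proof -
    have "(\<lambda>m. - 2 * ln (exp (- (v m / 2)))) \<longlonglongrightarrow> - 2 * ln c"
      by (intro tendsto_intros c) (use c0 in simp)
    then show ?thesis by (simp add: v'_def)
  qed
  have "0 \<le> v'" by (rule LIMSEQ_le_const[OF vlim]) (use v0 in auto)
  moreover have "char (distr gn.Om borel X) t = exp (- complex_of_real (v' * t^2 / 2))" for t
  proof -
    have cb: "(\<lambda>x. iexp (t * x)) \<in> borel_measurable borel"
      by (intro borel_measurable_continuous_onI continuous_intros)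
    have "char (distr gn.Om borel X) t = (\<integral>z. iexp (t * X z) \<partial>gn.Om)"
      unfolding char_def by (rule integral_distr[OF mX cb])
    moreover have "(\<lambda>m. complex_of_real (exp (- (v m * t^2 / 2)))) \<longlonglongrightarrow> complex_of_real (exp (- (v' * t^2 / 2)))"
      by (intro tendsto_intros vlim) auto
    ultimately have "char (distr gn.Om borel X) t = complex_of_real (exp (- (v' * t^2 / 2)))"
      using LIMSEQ_unique[OF lim] by simp
    then show ?thesis by (simp add: exp_of_real[symmetric])
  qed
  ultimately show ?thesis
    unfolding centered_gaussian_rv_def X_def[symmetric] using mX by (auto simp: X_def[abs_def])
qed

text \<open>The probability space has to consist of functions on lists; \<open>T\<close> relabels
  normals indexed by lists along \<open>list_decode\<close> and preserves the law.\<close>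

lemma exists_gaussian_element:
  "\<exists>(M :: (nat list \<Rightarrow> real) measure) W.
    centered_gaussian_H M W \<and> (\<forall>\<omega>. W \<omega> \<in> Hsp) \<and>
    (\<forall>\<sigma>\<in>Sall. \<forall>\<tau>\<in>Sall. integrable M (\<lambda>\<omega>. W \<omega> \<sigma> * W \<omega> \<tau>) \<and> (\<integral>\<omega>. W \<omega> \<sigma> * W \<omega> \<tau> \<partial>M) = R \<sigma> \<tau>) \<and>
    (\<forall>F t. finite F \<longrightarrow> F \<subseteq> Sall \<longrightarrow>
      (\<integral>\<omega>. iexp (\<Sum>\<sigma>\<in>F. t \<sigma> * W \<omega> \<sigma>) \<partial>M) = of_real (exp (- (\<Sum>\<sigma>\<in>F. \<Sum>\<tau>\<in>F. t \<sigma> * t \<tau> * R \<sigma> \<tau>) / 2)))"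
proof -
  define M :: "(nat list \<Rightarrow> real) measure" where "M = PiM UNIV (\<lambda>_. std_normal_distribution)"
  define T :: "(nat list \<Rightarrow> real) \<Rightarrow> nat \<Rightarrow> real" where "T \<omega> = (\<lambda>n. \<omega> (list_decode n))" for \<omega>
  have T: "T \<in> measurable M gn.Om"
    unfolding T_def[abs_def] M_def by (intro gn.measurable_OmI measurable_component_singleton UNIV_I)
  have dT: "distr M gn.Om T = gn.Om"
    using distr_PiM_reindex[of UNIV "\<lambda>_. std_normal_distribution" list_decode UNIV] inj_list_decode gn.prob_space_axioms
    by (simp add: M_def gn.Om_def T_def[abs_def] restrict_def)
  have int: "(\<integral>\<omega>. f (T \<omega>) \<partial>M) = (\<integral>z. f z \<partial>gn.Om)" if "f \<in> borel_measurable gn.Om"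
    for f :: "_ \<Rightarrow> 'c::{banach, second_countable_topology}"
    using integral_distr[OF T that] by (simp only: dT)
  show ?thesis
  proof (intro exI[of _ M] exI[of _ "\<lambda>\<omega>. gH (T \<omega>)"] conjI ballI allI impI)
    show "gH (T \<omega>) \<in> Hsp" for \<omega> by (rule gH_Hsp)
    show "centered_gaussian_H M (\<lambda>\<omega>. gH (T \<omega>))"
      unfolding centered_gaussian_H_def
    proof (intro conjI ballI gH_Hsp)
      show "prob_space M" unfolding M_def by (intro prob_space_PiM gn.prob_space_axioms)
      show "(\<lambda>\<omega>. gH (T \<omega>) \<sigma>) \<in> borel_measurable M" for \<sigma>
        by (rule measurable_compose[OF T measurable_gH])
      fix h assume h: "h \<in> Hsp"
      from hinner_gH_gaussian[OF h] obtain v where v: "v \<ge> 0"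
        "(\<lambda>z. hinner (gH z) h) \<in> borel_measurable gn.Om"
        "\<And>t. char (distr gn.Om borel (\<lambda>z. hinner (gH z) h)) t = exp (- complex_of_real (v * t^2 / 2))"
        unfolding centered_gaussian_rv_def by blast
      have "distr M borel (\<lambda>\<omega>. hinner (gH (T \<omega>)) h) = distr gn.Om borel (\<lambda>z. hinner (gH z) h)"
        using distr_distr[OF v(2) T] by (simp add: dT comp_def)
      then show "centered_gaussian_rv M (\<lambda>\<omega>. hinner (gH (T \<omega>)) h)"
        unfolding centered_gaussian_rv_def using v measurable_compose[OF T v(2)] by auto
    qed
    fix \<sigma> \<tau> assume st: "\<sigma> \<in> Sall" "\<tau> \<in> Sall"
    have m: "(\<lambda>z. gH z \<sigma> * gH z \<tau>) \<in> borel_measurable gn.Om"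
      by (intro borel_measurable_times measurable_gH)
    show "(\<integral>\<omega>. gH (T \<omega>) \<sigma> * gH (T \<omega>) \<tau> \<partial>M) = R \<sigma> \<tau>"
      using int[OF m] gH_product(2)[OF st] by simp
    show "integrable M (\<lambda>\<omega>. gH (T \<omega>) \<sigma> * gH (T \<omega>) \<tau>)"
      using integrable_distr_eq[OF T m] gH_product(1)[OF st] by (simp add: dT)
  next
    fix F t assume "finite F" "F \<subseteq> Sall"
    then show "(\<integral>\<omega>. iexp (\<Sum>\<sigma>\<in>F. t \<sigma> * gH (T \<omega>) \<sigma>) \<partial>M) =
        of_real (exp (- (\<Sum>\<sigma>\<in>F. \<Sum>\<tau>\<in>F. t \<sigma> * t \<tau> * R \<sigma> \<tau>) / 2))"
      using int[OF measurable_iexp_gH(1)[of t F]] gH_char[of F t] by simp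
  qed
qed

end

section \<open>Weak convergence in the Hilbert space\<close>

lemma Hsp_iff: "f \<in> Hsp \<longleftrightarrow> (\<lambda>\<sigma>. pw \<sigma> * (f \<sigma>)^2) summable_on Sall"
  by (simp add: Hsp_def)

lemma Hsp_dominated:
  assumes "b \<in> Hsp" "\<And>\<sigma>. \<sigma> \<in> Sall \<Longrightarrow> \<bar>f \<sigma>\<bar> \<le> c * \<bar>b \<sigma>\<bar>"
  shows "f \<in> Hsp"
  unfolding Hsp_iff
proof (rule summable_on_comparison_test)
  show "(\<lambda>\<sigma>. c^2 * (pw \<sigma> * (b \<sigma>)^2)) summable_on Sall"
    using assms(1) by (intro summable_on_cmult_right) (simp add: Hsp_iff)
  fix \<sigma> assume "\<sigma> \<in> Sall"
  then have "\<bar>f \<sigma>\<bar>^2 \<le> (c * \<bar>b \<sigma>\<bar>)^2" by (intro power_mono assms(2)) auto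
  then have "(f \<sigma>)^2 \<le> c^2 * (b \<sigma>)^2" by (simp add: power_mult_distrib)
  then have "pw \<sigma> * (f \<sigma>)^2 \<le> pw \<sigma> * (c^2 * (b \<sigma>)^2)" by (rule mult_left_mono[OF _ pw_nonneg])
  then show "pw \<sigma> * (f \<sigma>)^2 \<le> c^2 * (pw \<sigma> * (b \<sigma>)^2)" by (simp add: ac_simps)
qed (simp add: pw_nonneg)

text \<open>Dominated convergence for series. Inside a box whose radii form an element of
  \<open>Hsp\<close>, coordinatewise convergence is norm convergence; in this form compactness of
  boxes is used.\<close>

lemma hnorm_tendsto_0:
  assumes b: "b \<in> Hsp" and le: "\<And>n \<sigma>. \<sigma> \<in> Sall \<Longrightarrow> \<bar>x n \<sigma>\<bar> \<le> c * \<bar>b \<sigma>\<bar>"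
    and lim: "\<And>\<sigma>. \<sigma> \<in> Sall \<Longrightarrow> (\<lambda>n. x n \<sigma>) \<longlonglongrightarrow> 0"
  shows "(\<lambda>n. hnorm (x n)) \<longlonglongrightarrow> 0"
proof -
  let ?a = "\<lambda>k n. sidx (\<lambda>\<sigma>. pw \<sigma> * (x n \<sigma>)^2) k"
  let ?M = "\<lambda>k. c^2 * sidx (\<lambda>\<sigma>. pw \<sigma> * (b \<sigma>)^2) k"
  have x: "x n \<in> Hsp" for n by (rule Hsp_dominated[OF b le])
  have "(\<lambda>n. suminf (\<lambda>k. ?a k n)) \<longlonglongrightarrow> suminf (\<lambda>k. 0 :: real)"
  proof (rule tannerys_theorem[THEN conjunct2, THEN conjunct2])
    show "(\<lambda>n. ?a k n) \<longlonglongrightarrow> 0" for k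
    proof (cases "list_decode k \<in> Sall")
      case True
      have "(\<lambda>n. pw (list_decode k) * (x n (list_decode k))^2) \<longlonglongrightarrow> pw (list_decode k) * 0^2"
        by (intro tendsto_intros lim True)
      then show ?thesis using True by (simp add: sidx_def)
    qed (simp add: sidx_def)
    show "summable ?M"
      using b by (intro summable_mult infsum_Sall_suminf(2)) (simp add: Hsp_iff)
    have "norm (?a k n) \<le> ?M k" for k n
    proof (cases "list_decode k \<in> Sall")
      case True
      let ?s = "list_decode k"
      have "\<bar>x n ?s\<bar>^2 \<le> (c * \<bar>b ?s\<bar>)^2" by (intro power_mono le True) auto
      then have "(x n ?s)^2 \<le> c^2 * (b ?s)^2" by (simp add: power_mult_distrib)
      then have "pw ?s * (x n ?s)^2 \<le> pw ?s * (c^2 * (b ?s)^2)" by (rule mult_left_mono[OF _ pw_nonneg])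
      then show ?thesis using True pw_nonneg[of ?s] by (simp add: sidx_def abs_mult ac_simps)
    qed (simp add: sidx_def)
    then show "eventually (\<lambda>(k, n). norm (?a k n) \<le> ?M k) (at_top \<times>\<^sub>F sequentially)"
      by (intro always_eventually) auto
  qed simp
  then have "(\<lambda>n. sqrt (suminf (\<lambda>k. ?a k n))) \<longlonglongrightarrow> sqrt 0"
    by (intro tendsto_real_sqrt) simp
  moreover have "hnorm (x n) = sqrt (suminf (\<lambda>k. ?a k n))" for n
    unfolding hnorm_def using infsum_Sall_suminf(1)[of "\<lambda>\<sigma>. pw \<sigma> * (x n \<sigma>)^2"] x[of n] by (simp add: Hsp_iff)
  ultimately show ?thesis by simp
qed

lemma bcont_H_sequential:
  assumes g: "bcont_H g" and "f \<in> Hsp" "\<And>n. x n \<in> Hsp" "(\<lambda>n. hnorm (\<lambda>\<sigma>. x n \<sigma> - f \<sigma>)) \<longlonglongrightarrow> 0"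
  shows "(\<lambda>n. g (x n)) \<longlonglongrightarrow> g f"
proof (rule LIMSEQ_I)
  fix e :: real assume "e > 0"
  then obtain d where d: "d > 0" "\<And>f'. f' \<in> Hsp \<Longrightarrow> hnorm (\<lambda>\<sigma>. f' \<sigma> - f \<sigma>) < d \<Longrightarrow> \<bar>g f' - g f\<bar> < e"
    using g assms(2) unfolding bcont_H_def by blast
  from LIMSEQ_D[OF assms(4) d(1)] obtain N where "\<And>n. n \<ge> N \<Longrightarrow> hnorm (\<lambda>\<sigma>. x n \<sigma> - f \<sigma>) < d"
    by (auto simp: abs_less_iff)
  then show "\<exists>N. \<forall>n\<ge>N. norm (g (x n) - g f) < e"
    using d(2)[OF assms(3)] by auto
qed

lemma bcont_H_dominated:
  assumes "bcont_H g" "b \<in> Hsp" "\<And>n \<sigma>. \<sigma> \<in> Sall \<Longrightarrow> \<bar>x n \<sigma>\<bar> \<le> c * \<bar>b \<sigma>\<bar>"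
    and f: "\<And>\<sigma>. \<sigma> \<in> Sall \<Longrightarrow> \<bar>f \<sigma>\<bar> \<le> c * \<bar>b \<sigma>\<bar>" and "\<And>\<sigma>. \<sigma> \<in> Sall \<Longrightarrow> (\<lambda>n. x n \<sigma>) \<longlonglongrightarrow> f \<sigma>"
  shows "(\<lambda>n. g (x n)) \<longlonglongrightarrow> g f"
proof (rule bcont_H_sequential[OF assms(1)])
  show "f \<in> Hsp" "x n \<in> Hsp" for n by (rule Hsp_dominated[OF assms(2)], fact)+
  show "(\<lambda>n. hnorm (\<lambda>\<sigma>. x n \<sigma> - f \<sigma>)) \<longlonglongrightarrow> 0"
  proof (rule hnorm_tendsto_0[OF assms(2), of _ "2 * c"])
    show "\<bar>x n \<sigma> - f \<sigma>\<bar> \<le> 2 * c * \<bar>b \<sigma>\<bar>" if "\<sigma> \<in> Sall" for n \<sigma>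
      using assms(3)[OF that, of n] f[OF that] by linarith
    show "(\<lambda>n. x n \<sigma> - f \<sigma>) \<longlonglongrightarrow> 0" if "\<sigma> \<in> Sall" for \<sigma>
      using tendsto_diff[OF assms(5)[OF that] tendsto_const[of "f \<sigma>"]] by simp
  qed
qed

text \<open>Lists outside \<open>Sall\<close> carry no weight, so the two functions are at distance
  0 and continuity of \<open>g\<close> cannot tell them apart.\<close>

lemma bcont_H_cong:
  assumes "bcont_H g" "f \<in> Hsp" "\<And>\<sigma>. \<sigma> \<in> Sall \<Longrightarrow> f' \<sigma> = f \<sigma>"
  shows "g f' = g f"
proof -
  have "(\<lambda>n. g f') \<longlonglongrightarrow> g f"
    by (rule bcont_H_dominated[OF assms(1,2), of _ 1]) (use assms(3) in auto)
  then show ?thesis by (simp add: LIMSEQ_const_iff)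
qed

text \<open>\<open>arcsin (sin u)\<close> is the triangle wave: bounded, periodic and equal to
  \<open>u\<close> for \<open>\<bar>u\<bar> \<le> pi / 2\<close>. Hence the map fixes the box with
  radii \<open>a\<close> and sends everything into a box with radii
  \<open>pi / 2 * a\<close>.\<close>

definition fold_box :: "(nat list \<Rightarrow> real) \<Rightarrow> (nat list \<Rightarrow> real) \<Rightarrow> nat list \<Rightarrow> real" where
  "fold_box a x \<sigma> = a \<sigma> * arcsin (sin (x \<sigma> / a \<sigma>))"

lemma abs_arcsin_le: "\<bar>y\<bar> \<le> 1 \<Longrightarrow> \<bar>arcsin y\<bar> \<le> pi / 2"
  using arcsin_bounded[of y] by (auto simp: abs_le_iff)

lemma abs_arcsin_sin_le: "\<bar>arcsin (sin u)\<bar> \<le> \<bar>u\<bar>"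
proof (cases "\<bar>u\<bar> \<le> pi / 2")
  case True
  then show ?thesis using arcsin_sin[of u] by (auto simp: abs_le_iff)
next
  case False
  then show ?thesis using abs_arcsin_le[of "sin u"] by simp
qed

lemma fold_box_le:
  assumes "a \<sigma> > 0" shows "\<bar>fold_box a x \<sigma>\<bar> \<le> \<bar>x \<sigma>\<bar>" "\<bar>fold_box a x \<sigma>\<bar> \<le> pi / 2 * \<bar>a \<sigma>\<bar>"
proof -
  have "\<bar>fold_box a x \<sigma>\<bar> \<le> a \<sigma> * \<bar>x \<sigma> / a \<sigma>\<bar>"
    unfolding fold_box_def abs_mult[of "a \<sigma>"] abs_of_pos[OF assms]
    using assms by (intro mult_left_mono abs_arcsin_sin_le) simp
  then show "\<bar>fold_box a x \<sigma>\<bar> \<le> \<bar>x \<sigma>\<bar>" using assms by simp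
  show "\<bar>fold_box a x \<sigma>\<bar> \<le> pi / 2 * \<bar>a \<sigma>\<bar>"
    unfolding fold_box_def abs_mult using assms abs_arcsin_le[of "sin (x \<sigma> / a \<sigma>)"]
    by (simp add: mult.commute mult_right_mono)
qed

lemma fold_box_eq:
  assumes "a \<sigma> > 0" "\<bar>x \<sigma>\<bar> \<le> a \<sigma>" shows "fold_box a x \<sigma> = x \<sigma>"
proof -
  have "\<bar>x \<sigma> / a \<sigma>\<bar> \<le> 1" using assms by simp
  then have "\<bar>x \<sigma> / a \<sigma>\<bar> \<le> pi / 2" using pi_ge_two by linarith
  then have "arcsin (sin (x \<sigma> / a \<sigma>)) = x \<sigma> / a \<sigma>"
    unfolding abs_le_iff by (intro arcsin_sin) linarith+
  then show ?thesis using assms(1) by (simp only: fold_box_def) simp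
qed

text \<open>Trigonometric polynomials in finitely many coordinates: exactly the functions whose
  expectations are combinations of characteristic functions.\<close>

inductive trig :: "((nat list \<Rightarrow> real) \<Rightarrow> complex) \<Rightarrow> bool" where
  exponential: "finite F \<Longrightarrow> F \<subseteq> Sall \<Longrightarrow> trig (\<lambda>x. c * iexp (\<Sum>\<sigma>\<in>F. t \<sigma> * x \<sigma>))"
| add: "trig f \<Longrightarrow> trig g \<Longrightarrow> trig (\<lambda>x. f x + g x)"

lemma trig_const: "trig (\<lambda>x. c)"
  using trig.exponential[of "{}" c] by simp

lemma trig_exponential_mult:
  assumes F: "finite F" "F \<subseteq> Sall" and "trig g"
  shows "trig (\<lambda>x. c * iexp (\<Sum>\<sigma>\<in>F. t \<sigma> * x \<sigma>) * g x)"
  using assms(3)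
proof induction
  case (exponential G d s)
  define u where "u \<sigma> = (if \<sigma> \<in> F then t \<sigma> else 0) + (if \<sigma> \<in> G then s \<sigma> else 0)" for \<sigma>
  have "(\<Sum>\<sigma>\<in>F \<union> G. u \<sigma> * x \<sigma>) = (\<Sum>\<sigma>\<in>F. t \<sigma> * x \<sigma>) + (\<Sum>\<sigma>\<in>G. s \<sigma> * x \<sigma>)" for x
  proof -
    have "(\<Sum>\<sigma>\<in>F \<union> G. u \<sigma> * x \<sigma>) = (\<Sum>\<sigma>\<in>F \<union> G. (if \<sigma> \<in> F then t \<sigma> else 0) * x \<sigma>) + (\<Sum>\<sigma>\<in>F \<union> G. (if \<sigma> \<in> G then s \<sigma> else 0) * x \<sigma>)"
      by (simp add: u_def distrib_right sum.distrib)
    also have "(\<Sum>\<sigma>\<in>F \<union> G. (if \<sigma> \<in> F then t \<sigma> else 0) * x \<sigma>) = (\<Sum>\<sigma>\<in>F. t \<sigma> * x \<sigma>)"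
      using F exponential by (intro sum.mono_neutral_cong_right) auto
    also have "(\<Sum>\<sigma>\<in>F \<union> G. (if \<sigma> \<in> G then s \<sigma> else 0) * x \<sigma>) = (\<Sum>\<sigma>\<in>G. s \<sigma> * x \<sigma>)"
      using F exponential by (intro sum.mono_neutral_cong_right) auto
    finally show ?thesis .
  qed
  then have eq: "c * iexp (\<Sum>\<sigma>\<in>F. t \<sigma> * x \<sigma>) * (d * iexp (\<Sum>\<sigma>\<in>G. s \<sigma> * x \<sigma>)) = c * d * iexp (\<Sum>\<sigma>\<in>F \<union> G. u \<sigma> * x \<sigma>)" for x
    by (simp add: exp_add distrib_left)
  show ?case
    unfolding eq by (rule trig.exponential) (use F exponential in auto)
next
  case (add f g)
  then show ?case
    using trig.add[OF add.IH] by (simp add: distrib_left)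
qed

lemma trig_mult:
  assumes "trig f" "trig g" shows "trig (\<lambda>x. f x * g x)"
  using assms(1)
proof induction
  case (exponential F c t)
  then show ?case by (rule trig_exponential_mult[OF _ _ assms(2)])
next
  case (add f1 f2)
  then show ?case using trig.add[OF add.IH] by (simp add: distrib_right)
qed

lemma trig_sin:
  assumes "\<sigma> \<in> Sall" shows "trig (\<lambda>x. complex_of_real (sin (x \<sigma> / a)))"
proof -
  have "complex_of_real (sin u) = (- \<i> / 2) * iexp u + (\<i> / 2) * iexp (- u)" for u
    by (simp add: complex_eq_iff Re_exp Im_exp)
  then have "(\<lambda>x. complex_of_real (sin (x \<sigma> / a))) =
      (\<lambda>x. (- \<i> / 2) * iexp (\<Sum>\<sigma>\<in>{\<sigma>}. (1 / a) * x \<sigma>) + (\<i> / 2) * iexp (\<Sum>\<sigma>\<in>{\<sigma>}. (- 1 / a) * x \<sigma>))"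
    by simp
  moreover have "trig \<dots>"
    by (intro trig.add trig.exponential) (use assms in auto)
  ultimately show ?thesis by simp
qed

text \<open>On the folded box, \<open>g\<close> is a function of the coordinatewise sines, which range over a compact cube;
  Stone-Weierstrass in these variables therefore gives a uniform approximation on the whole space.\<close>

lemma bcont_H_trig_approximation:
  assumes g: "bcont_H g" and a: "\<And>\<sigma>. a \<sigma> > 0" "a \<in> Hsp" and e: "e > 0"
  obtains q where "trig (\<lambda>x. complex_of_real (q x))" "\<And>x. \<bar>g (fold_box a x) - q x\<bar> < e"
proof -
  \<comment> \<open>Coordinates outside \<open>Sall\<close> are frozen at 0, so that distinct points
    of the cube differ at a pattern, where a sine separates them.\<close>
  define B where "B \<sigma> = (if \<sigma> \<in> Sall then {-1..1} else {0 :: real})" for \<sigma>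
  define S where "S = PiE UNIV B"
  have S: "y \<in> S \<longleftrightarrow> (\<forall>\<sigma>. y \<sigma> \<in> B \<sigma>)" for y by (auto simp: S_def)
  have S1: "\<bar>y \<sigma>\<bar> \<le> 1" if "y \<in> S" for y \<sigma>
    using that unfolding S B_def by (cases "\<sigma> \<in> Sall") (auto simp: abs_le_iff dest: spec[of _ \<sigma>])
  have compact: "compact S"
  proof -
    have "compactin (product_topology (\<lambda>_. euclidean) UNIV) (PiE UNIV B)"
      unfolding compactin_PiE by (auto simp: B_def)
    then show ?thesis by (simp add: S_def euclidean_product_topology)
  qed
  define g' where "g' y = g (\<lambda>\<sigma>. a \<sigma> * arcsin (y \<sigma>))" for y
  \<comment> \<open>Convergence in the cube is coordinatewise; domination by
    \<open>pi / 2 * a\<close> upgrades it to norm convergence of the arguments of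
    \<open>g\<close>.\<close>
  have cont: "continuous_on S g'"
    unfolding continuous_on_sequentially
  proof (intro allI ballI impI, elim conjE)
    fix y :: "nat \<Rightarrow> nat list \<Rightarrow> real" and y0 assume y0: "y0 \<in> S" and y: "\<forall>n. y n \<in> S" and lim: "y \<longlonglongrightarrow> y0"
    have bd: "\<bar>a \<sigma> * arcsin (w \<sigma>)\<bar> \<le> pi / 2 * \<bar>a \<sigma>\<bar>" if "w \<in> S" for w \<sigma>
      using abs_arcsin_le[OF S1[OF that, of \<sigma>]] a(1)[of \<sigma>] by (simp add: abs_mult mult.commute mult_right_mono)
    show "(g' \<circ> y) \<longlonglongrightarrow> g' y0"
      unfolding g'_def comp_def
    proof (rule bcont_H_dominated[OF g a(2), of _ "pi / 2"])
      fix \<sigma>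
      have "(\<lambda>n. y n \<sigma>) \<longlonglongrightarrow> y0 \<sigma>"
        by (rule continuous_on_tendsto_compose[OF continuous_on_product_coordinates lim]) auto
      then have "(\<lambda>n. arcsin (y n \<sigma>)) \<longlonglongrightarrow> arcsin (y0 \<sigma>)"
      proof (rule continuous_on_tendsto_compose[OF continuous_on_arcsin'])
        show "y0 \<sigma> \<in> {-1..1}" using S1[OF y0, of \<sigma>] by (simp add: abs_le_iff)
        show "\<forall>\<^sub>F n in sequentially. y n \<sigma> \<in> {-1..1}"
          using S1[OF spec[OF y], of _ \<sigma>] by (intro always_eventually allI) (simp add: abs_le_iff)
      qed
      then show "(\<lambda>n. a \<sigma> * arcsin (y n \<sigma>)) \<longlonglongrightarrow> a \<sigma> * arcsin (y0 \<sigma>)"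
        by (intro tendsto_intros)
    qed (use bd y y0 in auto)
  qed
  define s where "s x \<sigma> = (if \<sigma> \<in> Sall then sin (x \<sigma> / a \<sigma>) else 0)" for x :: "nat list \<Rightarrow> real" and \<sigma>
  \<comment> \<open>Functions on the cube that become trigonometric polynomials when the sines are
    substituted; products and sums preserve this.\<close>
  define P where "P f \<longleftrightarrow> continuous_on S f \<and> trig (\<lambda>x. complex_of_real (f (s x)))" for f
  have "\<exists>f. P f \<and> (\<forall>y\<in>S. \<bar>g' y - f y\<bar> < e)"
  proof (rule Stone_Weierstrass_HOL[OF compact _ _ _ _ _ cont e])
    show "P (\<lambda>x. c)" for c unfolding P_def by (intro conjI continuous_intros trig_const)
    show "P f \<Longrightarrow> continuous_on S f" for f by (simp add: P_def)
    show "P f \<and> P h \<Longrightarrow> P (\<lambda>x. f x + h x)" for f h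
      unfolding P_def using trig.add[of "\<lambda>x. complex_of_real (f (s x))" "\<lambda>x. complex_of_real (h (s x))"]
      by (auto intro!: continuous_intros)
    show "P f \<and> P h \<Longrightarrow> P (\<lambda>x. f x * h x)" for f h
      unfolding P_def using trig_mult[of "\<lambda>x. complex_of_real (f (s x))" "\<lambda>x. complex_of_real (h (s x))"]
      by (auto intro!: continuous_intros)
    fix y w assume "y \<in> S \<and> w \<in> S \<and> y \<noteq> w"
    then obtain \<sigma> where \<sigma>: "y \<sigma> \<noteq> w \<sigma>" "y \<in> S" "w \<in> S" by auto
    then have "\<sigma> \<in> Sall" unfolding S B_def by (metis singletonD)
    then have "P (\<lambda>y. y \<sigma>)" unfolding P_def
      using trig_sin[of \<sigma> "a \<sigma>"] continuous_on_subset[OF continuous_on_product_coordinates[of \<sigma>] subset_UNIV, of S] by (simp add: s_def)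
    then show "\<exists>f. P f \<and> f y \<noteq> f w" using \<sigma> by blast
  qed
  then obtain f where f: "P f" "\<And>y. y \<in> S \<Longrightarrow> \<bar>g' y - f y\<bar> < e" by blast
  show ?thesis
  proof (rule that[of "\<lambda>x. f (s x)"])
    show "trig (\<lambda>x. complex_of_real (f (s x)))" using f(1) by (simp add: P_def)
    fix x
    have "s x \<in> S" unfolding S s_def B_def by simp
    moreover have "g (fold_box a x) = g' (s x)"
      unfolding g'_def
    proof (rule bcont_H_cong[OF g])
      show "(\<lambda>\<sigma>. a \<sigma> * arcsin (s x \<sigma>)) \<in> Hsp"
        by (rule Hsp_dominated[OF a(2), of _ "pi / 2"])
          (use abs_arcsin_le[OF S1[OF \<open>s x \<in> S\<close>]] a(1) in \<open>simp add: abs_mult mult.commute mult_right_mono less_imp_le\<close>)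
    qed (simp add: fold_box_def s_def)
    ultimately show "\<bar>g (fold_box a x) - f (s x)\<bar> < e" using f(2) by simp
  qed
qed

section \<open>Random elements with bounded second moments\<close>

locale Hsp_element = prob_space M for M :: "'a measure" +
  fixes X :: "'a \<Rightarrow> nat list \<Rightarrow> real"
  assumes X_Hsp: "\<And>z. X z \<in> Hsp"
    and X_measurable: "\<And>\<sigma>. \<sigma> \<in> Sall \<Longrightarrow> (\<lambda>z. X z \<sigma>) \<in> borel_measurable M"
    and X_integrable: "\<And>\<sigma>. \<sigma> \<in> Sall \<Longrightarrow> integrable M (\<lambda>z. (X z \<sigma>)^2)"
    and X_second_moment: "\<And>\<sigma>. \<sigma> \<in> Sall \<Longrightarrow> (\<integral>z. (X z \<sigma>)^2 \<partial>M) \<le> 1"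
begin

lemma trig_measurable:
  assumes "trig f" shows "(\<lambda>z. f (X z)) \<in> borel_measurable M"
  using assms
proof induction
  case (exponential F c t)
  have 1: "(\<lambda>z. \<Sum>\<sigma>\<in>F. t \<sigma> * X z \<sigma>) \<in> borel_measurable M"
    using exponential by (intro borel_measurable_sum borel_measurable_times borel_measurable_const X_measurable) auto
  have 2: "(\<lambda>u. c * iexp u) \<in> borel_measurable borel"
    by (intro borel_measurable_continuous_onI continuous_intros)
  show ?case by (rule measurable_compose[OF 1 2])
qed (rule borel_measurable_add)

lemma trig_integrable:
  assumes "trig f" shows "integrable M (\<lambda>z. f (X z))"
  using assms
proof induction
  case (exponential F c t)
  show ?case
  proof (rule integrable_const_bound[of _ "norm c"])
    show "(\<lambda>z. c * iexp (\<Sum>\<sigma>\<in>F. t \<sigma> * X z \<sigma>)) \<in> borel_measurable M"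
      using trig_measurable[OF trig.exponential[OF exponential]] .
    show "AE z in M. norm (c * iexp (\<Sum>\<sigma>\<in>F. t \<sigma> * X z \<sigma>)) \<le> norm c"
      unfolding norm_mult norm_exp_i_times by simp
  qed
qed (rule Bochner_Integration.integrable_add)

lemma real_trig_measurable:
  assumes "trig (\<lambda>x. complex_of_real (q x))"
  shows "(\<lambda>z. q (X z)) \<in> borel_measurable M" "integrable M (\<lambda>z. q (X z))"
    "complex_of_real (\<integral>z. q (X z) \<partial>M) = (\<integral>z. complex_of_real (q (X z)) \<partial>M)"
proof -
  have "(\<lambda>z. Re (complex_of_real (q (X z)))) \<in> borel_measurable M"
    by (rule measurable_compose[OF trig_measurable[OF assms] borel_measurable_Re])
  then show "(\<lambda>z. q (X z)) \<in> borel_measurable M" by (simp only: Re_complex_of_real)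
  have "integrable M (\<lambda>z. Re (complex_of_real (q (X z))))"
    by (rule integrable_bounded_linear[OF bounded_linear_Re trig_integrable[OF assms]])
  then show "integrable M (\<lambda>z. q (X z))" by (simp only: Re_complex_of_real)
  show "complex_of_real (\<integral>z. q (X z) \<partial>M) = (\<integral>z. complex_of_real (q (X z)) \<partial>M)"
    by (rule integral_complex_of_real[symmetric])
qed

text \<open>A uniform limit of trigonometric polynomials, so measurability of the single coordinates
  suffices.\<close>

lemma fold_box_measurable:
  assumes g: "bcont_H g" and a: "\<And>\<sigma>. a \<sigma> > 0" "a \<in> Hsp"
  shows "(\<lambda>z. g (fold_box a (X z))) \<in> borel_measurable M"
proof -
  have "\<exists>q. trig (\<lambda>x. complex_of_real (q x)) \<and> (\<forall>x. \<bar>g (fold_box a x) - q x\<bar> < 1 / real (Suc n))" for n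
    using bcont_H_trig_approximation[OF g a, of "1 / real (Suc n)"] by (metis of_nat_0_less_iff zero_less_Suc zero_less_divide_1_iff)
  then obtain q where q: "\<And>n. trig (\<lambda>x. complex_of_real (q n x))" "\<And>n x. \<bar>g (fold_box a x) - q n x\<bar> < 1 / real (Suc n)"
    by metis
  show ?thesis
  proof (rule borel_measurable_LIMSEQ_real)
    show "(\<lambda>z. q n (X z)) \<in> borel_measurable M" for n by (rule real_trig_measurable(1)[OF q(1)])
    fix z
    have "(\<lambda>n. q n (X z) - g (fold_box a (X z))) \<longlonglongrightarrow> 0"
    proof (rule Lim_null_comparison)
      show "\<forall>\<^sub>F n in sequentially. norm (q n (X z) - g (fold_box a (X z))) \<le> 1 / real (Suc n)"
        using q(2) by (intro always_eventually) (auto simp: abs_minus_commute less_imp_le)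
      show "(\<lambda>n. 1 / real (Suc n)) \<longlonglongrightarrow> 0"
        using LIMSEQ_inverse_real_of_nat by (simp add: inverse_eq_divide)
    qed
    then show "(\<lambda>n. q n (X z)) \<longlonglongrightarrow> g (fold_box a (X z))" by (simp add: LIM_zero_iff)
  qed
qed

text \<open>Boxes of constant radius \<open>n + 1\<close> are admissible because the weights are
  summable. The folded points converge coordinatewise and are dominated by the point itself, so
  \<open>g\<close> converges along them.\<close>

lemma bcont_H_measurable:
  assumes g: "bcont_H g"
  shows "(\<lambda>z. g (X z)) \<in> borel_measurable M"
proof (rule borel_measurable_LIMSEQ_real)
  define a where "a n = (\<lambda>\<sigma> :: nat list. real (Suc n))" for n
  have a: "a n \<sigma> > 0" for n \<sigma> by (simp add: a_def)
  have aH: "a n \<in> Hsp" for n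
    by (rule Hsp_dominated[OF one_in_Hsp, of _ "real (Suc n)"]) (simp add: a_def)
  show "(\<lambda>z. g (fold_box (a n) (X z))) \<in> borel_measurable M" for n
    by (rule fold_box_measurable[OF g a aH])
  show "(\<lambda>n. g (fold_box (a n) (X z))) \<longlonglongrightarrow> g (X z)" for z
  proof (rule bcont_H_dominated[OF g X_Hsp[of z], of _ 1])
    show "\<bar>fold_box (a n) (X z) \<sigma>\<bar> \<le> 1 * \<bar>X z \<sigma>\<bar>" for n \<sigma>
      using fold_box_le(1)[OF a] by simp
    fix \<sigma>
    obtain N where N: "\<bar>X z \<sigma>\<bar> \<le> real N" using real_arch_simple by blast
    have "\<forall>\<^sub>F n in sequentially. X z \<sigma> = fold_box (a n) (X z) \<sigma>"
      using eventually_ge_at_top[of N]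
    proof eventually_elim
      case (elim n)
      then have "\<bar>X z \<sigma>\<bar> \<le> a n \<sigma>" using N by (simp add: a_def)
      then show ?case by (rule fold_box_eq[OF a, symmetric])
    qed
    then show "(\<lambda>n. fold_box (a n) (X z) \<sigma>) \<longlonglongrightarrow> X z \<sigma>"
      by (rule Lim_transform_eventually[OF tendsto_const])
  qed simp
qed

lemma bcont_H_integrable:
  assumes g: "bcont_H g" and B: "\<And>f. f \<in> Hsp \<Longrightarrow> \<bar>g f\<bar> \<le> B"
  shows "integrable M (\<lambda>z. g (X z))"
proof (rule integrable_const_bound[of _ B])
  show "AE z in M. norm (g (X z)) \<le> B" by (intro AE_I2) (simp add: B[OF X_Hsp])
qed (rule bcont_H_measurable[OF g])

lemma chebyshev_coordinate:
  assumes \<sigma>: "\<sigma> \<in> Sall" and a: "a > 0"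
  shows "prob {z \<in> space M. \<bar>X z \<sigma>\<bar> > a} \<le> 1 / a^2"
proof -
  have m: "(\<lambda>z. X z \<sigma>) \<in> borel_measurable M" by (rule X_measurable[OF \<sigma>])
  have "prob {z \<in> space M. \<bar>X z \<sigma>\<bar> > a} \<le> prob {z \<in> space M. (X z \<sigma>)^2 \<ge> a^2}"
  proof (rule finite_measure_mono)
    show "{z \<in> space M. \<bar>X z \<sigma>\<bar> > a} \<subseteq> {z \<in> space M. (X z \<sigma>)^2 \<ge> a^2}"
      using a power_mono[of a "\<bar>X _ \<sigma>\<bar>" 2] by auto
    show "{z \<in> space M. (X z \<sigma>)^2 \<ge> a^2} \<in> events" using m by measurable
  qed
  also have "\<dots> \<le> (\<integral>z. (X z \<sigma>)^2 \<partial>M) / a^2"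
    by (rule integral_Markov_inequality_measure[OF X_integrable[OF \<sigma>], of "{}"]) (use a in auto)
  also have "\<dots> \<le> 1 / a^2" using X_second_moment[OF \<sigma>] by (intro divide_right_mono) auto
  finally show ?thesis .
qed

text \<open>Chebyshev for each coordinate and countable subadditivity along the enumeration of the
  patterns.\<close>

lemma prob_outside_box:
  assumes a: "\<And>\<sigma>. a \<sigma> > 0" and s: "(\<lambda>\<sigma>. 1 / (a \<sigma>)^2) summable_on Sall"
  shows "{z \<in> space M. \<exists>\<sigma>\<in>Sall. \<bar>X z \<sigma>\<bar> > a \<sigma>} \<in> events"
    "prob {z \<in> space M. \<exists>\<sigma>\<in>Sall. \<bar>X z \<sigma>\<bar> > a \<sigma>} \<le> (\<Sum>\<^sub>\<infinity>\<sigma>\<in>Sall. 1 / (a \<sigma>)^2)"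
proof -
  define A where "A n = (if list_decode n \<in> Sall then {z \<in> space M. \<bar>X z (list_decode n)\<bar> > a (list_decode n)} else {})" for n
  have A: "A n \<in> events" for n
  proof (cases "list_decode n \<in> Sall")
    case True
    note [measurable] = X_measurable[OF True]
    show ?thesis unfolding A_def using True by (simp only: if_True) measurable
  qed (simp add: A_def)
  have eq: "{z \<in> space M. \<exists>\<sigma>\<in>Sall. \<bar>X z \<sigma>\<bar> > a \<sigma>} = (\<Union>n. A n)"
  proof (intro equalityI subsetI)
    fix z assume "z \<in> {z \<in> space M. \<exists>\<sigma>\<in>Sall. \<bar>X z \<sigma>\<bar> > a \<sigma>}"
    then obtain \<sigma> where "z \<in> space M" "\<sigma> \<in> Sall" "\<bar>X z \<sigma>\<bar> > a \<sigma>" by auto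
    then have "z \<in> A (list_encode \<sigma>)" by (simp add: A_def)
    then show "z \<in> (\<Union>n. A n)" by blast
  qed (auto simp: A_def split: if_splits)
  show "{z \<in> space M. \<exists>\<sigma>\<in>Sall. \<bar>X z \<sigma>\<bar> > a \<sigma>} \<in> events" unfolding eq using A by auto
  note ss = infsum_Sall_suminf[OF s]
  have le: "prob (A n) \<le> sidx (\<lambda>\<sigma>. 1 / (a \<sigma>)^2) n" for n
    using chebyshev_coordinate[of "list_decode n" "a (list_decode n)"] a by (simp add: A_def sidx_def)
  have sm: "summable (\<lambda>n. prob (A n))"
    by (rule summable_comparison_test'[OF ss(2), of 0]) (use le in simp)
  have "prob (\<Union>n. A n) \<le> (\<Sum>n. prob (A n))"
    by (rule finite_measure_subadditive_countably[OF _ sm]) (use A in auto)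
  also have "\<dots> \<le> suminf (sidx (\<lambda>\<sigma>. 1 / (a \<sigma>)^2))" by (rule suminf_le[OF le sm ss(2)])
  finally show "prob {z \<in> space M. \<exists>\<sigma>\<in>Sall. \<bar>X z \<sigma>\<bar> > a \<sigma>} \<le> (\<Sum>\<^sub>\<infinity>\<sigma>\<in>Sall. 1 / (a \<sigma>)^2)"
    unfolding eq ss(1) .
qed

text \<open>Inside the box folding changes nothing and the error is below \<open>e\<close>. Outside,
  \<open>q\<close> is still within \<open>e\<close> of the value of \<open>g\<close> at the folded
  point, so the error is at most \<open>2 * B + e\<close>.\<close>

lemma trig_replacement_error:
  assumes g: "bcont_H g" and B: "\<And>f. f \<in> Hsp \<Longrightarrow> \<bar>g f\<bar> \<le> B"
    and a: "\<And>\<sigma>. a \<sigma> > 0" "a \<in> Hsp" and s: "(\<lambda>\<sigma>. 1 / (a \<sigma>)^2) summable_on Sall"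
    and q: "trig (\<lambda>x. complex_of_real (q x))" "\<And>x. \<bar>g (fold_box a x) - q x\<bar> < e"
  shows "\<bar>(\<integral>z. g (X z) \<partial>M) - (\<integral>z. q (X z) \<partial>M)\<bar> \<le> e + 2 * B * (\<Sum>\<^sub>\<infinity>\<sigma>\<in>Sall. 1 / (a \<sigma>)^2)"
proof -
  define bad where "bad = {z \<in> space M. \<exists>\<sigma>\<in>Sall. \<bar>X z \<sigma>\<bar> > a \<sigma>}"
  note bad = prob_outside_box[OF a(1) s, folded bad_def]
  have B0: "0 \<le> B" using B[OF X_Hsp] by (meson abs_ge_zero order_trans)
  have foldH: "fold_box a (X z) \<in> Hsp" for z
    by (rule Hsp_dominated[OF X_Hsp[of z], of _ 1]) (use fold_box_le(1)[OF a(1)] in simp)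
  have "\<bar>(\<integral>z. g (X z) \<partial>M) - (\<integral>z. q (X z) \<partial>M)\<bar> = \<bar>\<integral>z. g (X z) - q (X z) \<partial>M\<bar>"
    using bcont_H_integrable[OF g B] real_trig_measurable(2)[OF q(1)] by simp
  also have "\<dots> \<le> (\<integral>z. \<bar>g (X z) - q (X z)\<bar> \<partial>M)" by (rule integral_abs_bound)
  also have "\<dots> \<le> (\<integral>z. e + 2 * B * indicator bad z \<partial>M)"
  proof (rule integral_mono_AE)
    show "integrable M (\<lambda>z. \<bar>g (X z) - q (X z)\<bar>)"
      by (intro integrable_abs Bochner_Integration.integrable_diff bcont_H_integrable[OF g B] real_trig_measurable(2)[OF q(1)])
    show "integrable M (\<lambda>z. e + 2 * B * indicator bad z)"
      using bad(1) by (intro Bochner_Integration.integrable_add integrable_mult_right) (auto simp: less_top[symmetric] intro!: integrable_real_indicator)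
    show "AE z in M. \<bar>g (X z) - q (X z)\<bar> \<le> e + 2 * B * indicator bad z"
    proof (rule AE_I2)
      fix z assume z: "z \<in> space M"
      show "\<bar>g (X z) - q (X z)\<bar> \<le> e + 2 * B * indicator bad z"
      proof (cases "z \<in> bad")
        case True
        then show ?thesis
          using B[OF X_Hsp[of z]] B[OF foldH[of z]] q(2)[of "X z"] by simp
      next
        case False
        then have "\<bar>X z \<sigma>\<bar> \<le> a \<sigma>" if "\<sigma> \<in> Sall" for \<sigma>
          using that z by (force simp: bad_def)
        then have "g (fold_box a (X z)) = g (X z)"
          by (intro bcont_H_cong[OF g X_Hsp] fold_box_eq a) auto
        then show ?thesis using q(2)[of "X z"] False by simp
      qed
    qed
  qed
  also have "\<dots> = e + 2 * B * prob bad"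
  proof -
    have "(\<integral>z. e + 2 * B * indicator bad z \<partial>M) = (\<integral>z. e \<partial>M) + (\<integral>z. 2 * B * indicator bad z \<partial>M)"
      using bad(1) by (intro Bochner_Integration.integral_add integrable_mult_right) (auto simp: less_top[symmetric] intro!: integrable_real_indicator)
    then show ?thesis using bad(1) by (simp add: prob_space sets.Int_space_eq2)
  qed
  also have "\<dots> \<le> e + 2 * B * (\<Sum>\<^sub>\<infinity>\<sigma>\<in>Sall. 1 / (a \<sigma>)^2)"
    using bad(2) B0 by (intro add_mono mult_left_mono) auto
  finally show ?thesis .
qed

end

text \<open>The weights \<open>p\<close> leave room for boxes that are compact in the Hilbert space
  and still carry most of the mass of every element with bounded second moments.\<close>

definition box_radius :: "real \<Rightarrow> nat list \<Rightarrow> real" where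
  "box_radius A \<sigma> = A * sqrt (fact (length \<sigma>) * (3/2) ^ length \<sigma>)"

lemma box_radius_pos: "A > 0 \<Longrightarrow> box_radius A \<sigma> > 0"
  unfolding box_radius_def by (intro mult_pos_pos real_sqrt_gt_zero) auto

lemma box_radius_square: "(box_radius A \<sigma>)^2 = A^2 * (fact (length \<sigma>) * (3/2) ^ length \<sigma>)"
  unfolding box_radius_def power_mult_distrib by (subst real_sqrt_pow2) auto

text \<open>The total for length \<open>k\<close> is \<open>gamma_const * A^2 * (3/4)^k\<close>;
  here the base 3/2 has to stay below the 2 in the weights, while \<open>box_radius_summable\<close>
  needs it above 1.\<close>

lemma box_radius_Hsp: "box_radius A \<in> Hsp"
proof -
  define w :: "nat \<Rightarrow> real" where "w k = gamma_const / (fact k ^ 2 * 2 ^ k) * (A^2 * (fact k * (3/2) ^ k))" for k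
  have "(\<lambda>\<sigma>. w (length \<sigma>)) summable_on Sall"
  proof (rule summable_on_Sall_by_length)
    fix k :: nat
    show "0 \<le> w k" unfolding w_def
      using gamma_const_pos by (intro mult_nonneg_nonneg divide_nonneg_nonneg) auto
    have q: "(3/2 :: real) ^ k / 2 ^ k = (3/4) ^ k" by (simp add: power_divide[symmetric])
    have *: "f * (c / (f ^ 2 * d) * (s * (f * r))) = c * s * (r / d)" if "f > 0" "d > 0" for f c d s r :: real
      using that by (simp add: divide_simps power2_eq_square)
    show "fact k * w k \<le> gamma_const * A^2 * (3/4) ^ k"
      unfolding w_def q[symmetric] by (subst *) auto
  qed simp_all
  moreover have "w (length \<sigma>) = pw \<sigma> * (box_radius A \<sigma>)^2" for \<sigma>
    unfolding w_def pw_def box_radius_square ..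
  ultimately show ?thesis by (simp only: Hsp_iff)
qed

lemma box_radius_summable: "(\<lambda>\<sigma>. 1 / (box_radius A \<sigma>)^2) summable_on Sall"
proof -
  define w :: "nat \<Rightarrow> real" where "w k = 1 / (A^2 * (fact k * (3/2) ^ k))" for k
  have "(\<lambda>\<sigma>. w (length \<sigma>)) summable_on Sall"
  proof (rule summable_on_Sall_by_length)
    fix k :: nat
    show "0 \<le> w k" unfolding w_def by (intro divide_nonneg_nonneg mult_nonneg_nonneg) auto
    have q: "1 / (3/2 :: real) ^ k = (2/3) ^ k" by (simp add: power_divide)
    have *: "f * (1 / (c * (f * r))) = 1 / c * (1 / r)" if "f > 0" for f c r :: real
      using that by simp
    show "fact k * w k \<le> 1 / A^2 * (2/3) ^ k"
      unfolding w_def q[symmetric] by (subst *) auto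
  qed simp_all
  then show ?thesis by (simp only: w_def box_radius_square)
qed

text \<open>The bound for the mass outside the box decays like \<open>A^-2\<close> with one fixed
  constant, so enlarging \<open>A\<close> makes it as small as desired.\<close>

lemma box_radius_infsum:
  "(\<Sum>\<^sub>\<infinity>\<sigma>\<in>Sall. 1 / (box_radius A \<sigma>)^2) = 1 / A^2 * (\<Sum>\<^sub>\<infinity>\<sigma>\<in>Sall. 1 / (box_radius 1 \<sigma>)^2)"
proof -
  have "1 / (box_radius A \<sigma>)^2 = 1 / A^2 * (1 / (box_radius 1 \<sigma>)^2)" for \<sigma>
    unfolding box_radius_square by (simp only: power_one mult_1_left times_divide_times_eq)
  then show ?thesis
    using infsum_cmult_right[of "1 / A^2" "\<lambda>\<sigma>. 1 / (box_radius 1 \<sigma>)^2" Sall] box_radius_summable[of 1]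
    by (simp only: simp_thms)
qed

text \<open>The box and then the polynomial \<open>q\<close> are chosen from \<open>e\<close> alone;
  the replacement error holds for all \<open>n\<close> and for the limit alike, and the expectation
  of \<open>q\<close> converges by the hypothesis on characteristic functions.\<close>

lemma Hsp_weak_convergence:
  fixes X :: "nat \<Rightarrow> 'a \<Rightarrow> nat list \<Rightarrow> real" and W :: "'b \<Rightarrow> nat list \<Rightarrow> real"
  assumes X: "\<And>n. Hsp_element (P n) (X n)" and W: "Hsp_element M W"
    and char: "\<And>F t. finite F \<Longrightarrow> F \<subseteq> Sall \<Longrightarrow>
      (\<lambda>n. \<integral>z. iexp (\<Sum>\<sigma>\<in>F. t \<sigma> * X n z \<sigma>) \<partial>P n) \<longlonglongrightarrow> (\<integral>\<omega>. iexp (\<Sum>\<sigma>\<in>F. t \<sigma> * W \<omega> \<sigma>) \<partial>M)"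
    and g: "bcont_H g"
  shows "(\<lambda>n. \<integral>z. g (X n z) \<partial>P n) \<longlonglongrightarrow> (\<integral>\<omega>. g (W \<omega>) \<partial>M)"
proof -
  interpret X: Hsp_element "P n" "X n" for n by (rule X)
  interpret W: Hsp_element M W by (rule W)
  have trig_limit: "(\<lambda>n. \<integral>z. f (X n z) \<partial>P n) \<longlonglongrightarrow> (\<integral>\<omega>. f (W \<omega>) \<partial>M)" if "trig f" for f
    using that
  proof induction
    case (exponential F c t)
    show ?case
      unfolding integral_mult_right_zero by (intro tendsto_intros char exponential)
  next
    case (add f1 f2)
    have "(\<integral>z. f1 (X n z) + f2 (X n z) \<partial>P n) = (\<integral>z. f1 (X n z) \<partial>P n) + (\<integral>z. f2 (X n z) \<partial>P n)" for n
      by (intro Bochner_Integration.integral_add X.trig_integrable add.hyps)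
    moreover have "(\<integral>z. f1 (W z) + f2 (W z) \<partial>M) = (\<integral>z. f1 (W z) \<partial>M) + (\<integral>z. f2 (W z) \<partial>M)"
      by (intro Bochner_Integration.integral_add W.trig_integrable add.hyps)
    ultimately show ?case using tendsto_add[OF add.IH] by simp
  qed
  obtain B where B: "\<And>f. f \<in> Hsp \<Longrightarrow> \<bar>g f\<bar> \<le> B" using g unfolding bcont_H_def by blast
  have B0: "0 \<le> B" using B[OF one_in_Hsp] by linarith
  define \<kappa> where "\<kappa> = (\<Sum>\<^sub>\<infinity>\<sigma>\<in>Sall. 1 / (box_radius 1 \<sigma>)^2)"
  have \<kappa>0: "0 \<le> \<kappa>" unfolding \<kappa>_def by (intro infsum_nonneg) simp
  show ?thesis
  proof (rule LIMSEQ_I)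
    fix e :: real assume e: "e > 0"
    \<comment> \<open>The leading 1 gives \<open>A \<le> A^2\<close>, and then
      \<open>2 * B * \<kappa> / A^2 \<le> e / 6\<close>.\<close>
    define A where "A = 1 + 12 * B * \<kappa> / e"
    have A: "A \<ge> 1" using B0 \<kappa>0 e by (simp add: A_def)
    have tail: "2 * B * (\<Sum>\<^sub>\<infinity>\<sigma>\<in>Sall. 1 / (box_radius A \<sigma>)^2) \<le> e / 6"
    proof -
      have "A * 1 \<le> A * A" using A by (intro mult_left_mono) auto
      then have "12 * B * \<kappa> / e \<le> A^2" by (simp add: A_def power2_eq_square)
      then have "12 * B * \<kappa> \<le> e * A^2" using e by (simp add: field_simps)
      then have "2 * B * (1 / A^2 * \<kappa>) \<le> e / 6" using A by (simp add: field_simps)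
      then show ?thesis unfolding box_radius_infsum[of A] \<kappa>_def .
    qed
    have a: "\<And>\<sigma>. box_radius A \<sigma> > 0" using A by (intro box_radius_pos) simp
    obtain q where q: "trig (\<lambda>x. complex_of_real (q x))" "\<And>x. \<bar>g (fold_box (box_radius A) x) - q x\<bar> < e / 6"
      using bcont_H_trig_approximation[OF g a box_radius_Hsp, of "e / 6"] e by auto
    have "(\<lambda>n. complex_of_real (\<integral>z. q (X n z) \<partial>P n)) \<longlonglongrightarrow> complex_of_real (\<integral>\<omega>. q (W \<omega>) \<partial>M)"
      unfolding X.real_trig_measurable(3)[OF q(1)] W.real_trig_measurable(3)[OF q(1)] by (rule trig_limit[OF q(1)])
    then have "(\<lambda>n. \<integral>z. q (X n z) \<partial>P n) \<longlonglongrightarrow> (\<integral>\<omega>. q (W \<omega>) \<partial>M)"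
      by (simp only: tendsto_of_real_iff)
    from LIMSEQ_D[OF this, of "e / 6"] e obtain N where
      N: "\<And>n. n \<ge> N \<Longrightarrow> \<bar>(\<integral>z. q (X n z) \<partial>P n) - (\<integral>\<omega>. q (W \<omega>) \<partial>M)\<bar> < e / 6"
      unfolding real_norm_def by (auto simp del: of_real_diff)
    show "\<exists>N. \<forall>n\<ge>N. norm ((\<integral>z. g (X n z) \<partial>P n) - (\<integral>\<omega>. g (W \<omega>) \<partial>M)) < e"
    proof (intro exI allI impI)
      fix n assume "n \<ge> N"
      note N[OF this]
      moreover have "\<bar>(\<integral>z. g (X n z) \<partial>P n) - (\<integral>z. q (X n z) \<partial>P n)\<bar> \<le> e / 6 + e / 6"
        using X.trig_replacement_error[OF g B a box_radius_Hsp box_radius_summable q, of n] tail by linarith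
      moreover have "\<bar>(\<integral>\<omega>. g (W \<omega>) \<partial>M) - (\<integral>\<omega>. q (W \<omega>) \<partial>M)\<bar> \<le> e / 6 + e / 6"
        using W.trig_replacement_error[OF g B a box_radius_Hsp box_radius_summable q] tail by linarith
      \<comment> \<open>One \<open>e / 6\<close> for the polynomial and \<open>e / 3\<close> for
        each replacement: \<open>5 * e / 6\<close> in total.\<close>
      ultimately show "norm ((\<integral>z. g (X n z) \<partial>P n) - (\<integral>\<omega>. g (W \<omega>) \<partial>M)) < e"
        using e unfolding real_norm_def by linarith
    qed
  qed
qed

section \<open>Pattern frequencies as Hilbert space elements\<close>

lemma finite_Sall_bounded_length: "finite {\<sigma> \<in> Sall. length \<sigma> \<le> N}"
proof (rule finite_subset)
  show "{\<sigma> \<in> Sall. length \<sigma> \<le> N} \<subseteq> (\<Union>k\<le>N. perms k)" by (auto simp: Sall_perms)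
qed (auto simp: finite_perms)

lemma Hsp_finite_support:
  assumes "\<And>\<sigma>. N < length \<sigma> \<Longrightarrow> f \<sigma> = 0" shows "f \<in> Hsp"
proof -
  have "(\<lambda>\<sigma>. pw \<sigma> * (f \<sigma>)^2) summable_on {\<sigma> \<in> Sall. length \<sigma> \<le> N}"
    by (rule summable_on_finite[OF finite_Sall_bounded_length])
  then have "(\<lambda>\<sigma>. pw \<sigma> * (f \<sigma>)^2) summable_on Sall"
    by (rule summable_on_cong_neutral[THEN iffD1, rotated -1]) (use assms in \<open>auto simp: not_le\<close>)
  then show ?thesis by (simp add: Hsp_iff)
qed

text \<open>\<open>rho\<close> is the Gram kernel of the functions \<open>m1\<close>, which are
  bounded by 1.\<close>

lemma (in copula_space) gaussian_kernel_rho: "gaussian_kernel (rho \<mu>)"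
proof
  fix \<sigma> \<tau> assume st: "\<sigma> \<in> Sall" "\<tau> \<in> Sall"
  have eq: "rho \<mu> \<alpha> \<beta> = (\<integral>x. m1 \<alpha> x * m1 \<beta> x \<partial>\<mu>)" if "\<alpha> \<in> Sall" "\<beta> \<in> Sall" for \<alpha> \<beta>
    using expectation_m1_mult[OF Sall_perms[OF that(1)] Sall_perms[OF that(2)]] that by (simp add: Sall_def)
  show "rho \<mu> \<sigma> \<tau> = rho \<mu> \<tau> \<sigma>"
    unfolding eq[OF st] eq[OF st(2,1)] by (simp only: mult.commute)
  have "rho \<mu> \<sigma> \<sigma> \<le> (\<integral>x. 1 \<partial>\<mu>)"
    unfolding eq[OF st(1) st(1)]
  proof (rule integral_mono)
    show "integrable \<mu> (\<lambda>x. m1 \<sigma> x * m1 \<sigma> x)" by (intro bdd_meas_integrable bdd_meas_mult bdd_meas_m1)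
    fix x
    have "\<bar>m1 \<sigma> x\<bar> * \<bar>m1 \<sigma> x\<bar> \<le> 1 * 1"
      by (intro mult_mono m1_bound[OF Sall_perms[OF st(1)]]) auto
    then show "m1 \<sigma> x * m1 \<sigma> x \<le> 1" by simp
  qed simp
  then show "rho \<mu> \<sigma> \<sigma> \<le> 1" by simp
next
  fix F and t :: "nat list \<Rightarrow> real" assume "finite F" "F \<subseteq> Sall"
  from expectation_m1_combination_square[OF this, of t, symmetric]
  show "0 \<le> (\<Sum>\<sigma>\<in>F. \<Sum>\<tau>\<in>F. t \<sigma> * t \<tau> * rho \<mu> \<sigma> \<tau>)" by simp
qed

context copula_space
begin

definition wtrunc :: "nat \<Rightarrow> nat \<Rightarrow> (nat \<Rightarrow> real \<times> real) \<Rightarrow> nat list \<Rightarrow> real" where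
  "wtrunc k n z \<sigma> = (if \<sigma> \<in> Sall \<and> length \<sigma> \<le> k then wfreq n \<sigma> z else 0)"

lemma Hsp_element_wtrunc:
  assumes "k \<le> n" shows "Hsp_element Om (wtrunc k n)"
proof
  show "wtrunc k n z \<in> Hsp" for z
    by (rule Hsp_finite_support[of k]) (simp add: wtrunc_def)
  fix \<sigma> assume \<sigma>: "\<sigma> \<in> Sall"
  have b: "bdd_meas Om (\<lambda>z. wtrunc k n z \<sigma>)"
    by (cases "length \<sigma> \<le> k") (simp_all add: wtrunc_def \<sigma> bdd_meas_wfreq)
  then show "(\<lambda>z. wtrunc k n z \<sigma>) \<in> borel_measurable Om" by (rule bdd_meas_measurable)
  show "integrable Om (\<lambda>z. (wtrunc k n z \<sigma>)^2)"
    unfolding power2_eq_square by (rule Om.bdd_meas_integrable[OF bdd_meas_mult[OF b b]])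
  show "(\<integral>z. (wtrunc k n z \<sigma>)^2 \<partial>Om) \<le> 1"
    using expectation_wfreq_square[OF \<sigma>, of n] assms by (cases "length \<sigma> \<le> k") (simp_all add: wtrunc_def \<sigma>)
qed

text \<open>The left integrand is a function of the permutation and therefore measurable for any
  \<open>g\<close>. Almost surely there are no ties, and then pattern frequency and U-statistic
  coincide.\<close>

lemma expectation_Wnk:
  assumes g: "bcont_H g" and k: "k \<le> n"
  shows "(\<integral>z. g (Wnk \<mu> k n (sample_perm n z)) \<partial>(PiM {..<n} (\<lambda>_. \<mu>))) = (\<integral>z. g (wtrunc k n z) \<partial>Om)"
proof -
  interpret W: Hsp_element Om "wtrunc k n" by (rule Hsp_element_wtrunc[OF k])
  have m: "(\<lambda>z. g (Wnk \<mu> k n (sample_perm n z))) \<in> borel_measurable Om"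
    by (rule measurable_compose[OF measurable_sample_perm]) simp
  have d: "depends_on (\<lambda>z. g (Wnk \<mu> k n (sample_perm n z))) {..<n}"
    unfolding depends_on_def
    by (intro allI impI arg_cong[where f="\<lambda>\<pi>. g (Wnk \<mu> k n \<pi>)"] sample_perm_cong_order) auto
  have "(\<integral>z. g (Wnk \<mu> k n (sample_perm n z)) \<partial>(PiM {..<n} (\<lambda>_. \<mu>))) = (\<integral>z. g (Wnk \<mu> k n (sample_perm n z)) \<partial>Om)"
    by (rule integral_PiM_eq_Om[OF m d])
  also have "\<dots> = (\<integral>z. g (wtrunc k n z) \<partial>Om)"
  proof (rule integral_cong_AE[OF m W.bcont_H_measurable[OF g]])
    show "AE z in Om. g (Wnk \<mu> k n (sample_perm n z)) = g (wtrunc k n z)"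
      using AE_no_ties[of n]
    proof eventually_elim
      case (elim z)
      have "Wnk \<mu> k n (sample_perm n z) \<sigma> = wtrunc k n z \<sigma>" for \<sigma>
        using pfreq_eq_tfreq[OF elim, of \<sigma>] k by (simp add: Wnk_def wtrunc_def wfreq_def)
      then show ?case by presburger
    qed
  qed
  finally show ?thesis .
qed

end

theorem theorem3p2:
  fixes \<mu> :: "nat \<Rightarrow> (real \<times> real) measure" and \<nu> :: "(real \<times> real) measure"
    and k :: "nat \<Rightarrow> nat"
  assumes "\<And>n. copula (\<mu> n)" and "copula \<nu>" and "weak_conv2 \<mu> \<nu>"
    and "\<And>n. k n \<le> n" and "filterlim k at_top sequentially"
  shows "\<exists>(M :: (nat list \<Rightarrow> real) measure) W.
           centered_gaussian_H M W \<and>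
           (\<forall>\<sigma>\<in>Sall. \<forall>\<tau>\<in>Sall. integrable M (\<lambda>\<omega>. W \<omega> \<sigma> * W \<omega> \<tau>) \<and>
               (\<integral>\<omega>. W \<omega> \<sigma> * W \<omega> \<tau> \<partial>M) = rho \<nu> \<sigma> \<tau>) \<and>
           (\<forall>g. bcont_H g \<longrightarrow>
              (\<lambda>\<omega>. g (W \<omega>)) \<in> borel_measurable M \<and>
              (\<lambda>n. \<integral>z. g (Wnk (\<mu> n) (k n) n (sample_perm n z)) \<partial>(PiM {..<n} (\<lambda>_. \<mu> n)))
                \<longlonglongrightarrow> (\<integral>\<omega>. g (W \<omega>) \<partial>M))"
proof -
  interpret copula_limit \<mu> \<nu> by unfold_locales (rule assms)+
  interpret G: gaussian_kernel "rho \<nu>" by (rule L.gaussian_kernel_rho)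
  obtain M :: "(nat list \<Rightarrow> real) measure" and W where W:
    "centered_gaussian_H M W" "\<And>\<omega>. W \<omega> \<in> Hsp"
    "\<forall>\<sigma>\<in>Sall. \<forall>\<tau>\<in>Sall. integrable M (\<lambda>\<omega>. W \<omega> \<sigma> * W \<omega> \<tau>) \<and> (\<integral>\<omega>. W \<omega> \<sigma> * W \<omega> \<tau> \<partial>M) = rho \<nu> \<sigma> \<tau>"
    "\<And>F t. finite F \<Longrightarrow> F \<subseteq> Sall \<Longrightarrow>
      (\<integral>\<omega>. iexp (\<Sum>\<sigma>\<in>F. t \<sigma> * W \<omega> \<sigma>) \<partial>M) = of_real (exp (- (\<Sum>\<sigma>\<in>F. \<Sum>\<tau>\<in>F. t \<sigma> * t \<tau> * rho \<nu> \<sigma> \<tau>) / 2))"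
    using G.exists_gaussian_element by blast
  have "prob_space M" using W(1) by (simp add: centered_gaussian_H_def)
  then interpret M: prob_space M .
  have WE: "Hsp_element M W"
  proof
    show "(\<lambda>z. W z \<sigma>) \<in> borel_measurable M" if "\<sigma> \<in> Sall" for \<sigma>
      using W(1) that by (simp add: centered_gaussian_H_def)
    show "integrable M (\<lambda>z. (W z \<sigma>)^2)" "(\<integral>z. (W z \<sigma>)^2 \<partial>M) \<le> 1" if "\<sigma> \<in> Sall" for \<sigma>
      using W(3) G.R_diag[OF that] that by (simp_all add: power2_eq_square)
  qed (rule W(2))
  have char: "(\<lambda>n. \<integral>z. iexp (\<Sum>\<sigma>\<in>F. t \<sigma> * C.wtrunc n (k n) n z \<sigma>) \<partial>C.Om n) \<longlonglongrightarrow> (\<integral>\<omega>. iexp (\<Sum>\<sigma>\<in>F. t \<sigma> * W \<omega> \<sigma>) \<partial>M)"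
    if F: "finite F" "F \<subseteq> Sall" for F t
    unfolding W(4)[OF F]
  proof (rule Lim_transform_eventually[OF wfreq_combination_char_limit[OF F]])
    \<comment> \<open>As \<open>k n\<close> tends to infinity, the truncation eventually spares
      every pattern in the finite set \<open>F\<close>.\<close>
    have "\<forall>\<^sub>F n in sequentially. Max (insert 0 (length ` F)) \<le> k n"
      using assms(5) by (simp add: filterlim_at_top)
    then show "\<forall>\<^sub>F n in sequentially. (\<integral>z. iexp (\<Sum>\<sigma>\<in>F. t \<sigma> * C.wfreq n n \<sigma> z) \<partial>C.Om n) =
        (\<integral>z. iexp (\<Sum>\<sigma>\<in>F. t \<sigma> * C.wtrunc n (k n) n z \<sigma>) \<partial>C.Om n)"
    proof eventually_elim
      case (elim n)
      have "C.wtrunc n (k n) n z \<sigma> = C.wfreq n n \<sigma> z" if "\<sigma> \<in> F" for \<sigma> z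
        using that F elim by (auto simp: C.wtrunc_def)
      then show ?case by (simp cong: sum.cong)
    qed
  qed
  have conv: "(\<lambda>n. \<integral>z. g (Wnk (\<mu> n) (k n) n (sample_perm n z)) \<partial>(PiM {..<n} (\<lambda>_. \<mu> n))) \<longlonglongrightarrow> (\<integral>\<omega>. g (W \<omega>) \<partial>M)"
    if g: "bcont_H g" for g
    unfolding C.expectation_Wnk[OF g assms(4)]
    by (rule Hsp_weak_convergence[OF C.Hsp_element_wtrunc[OF assms(4)] WE char g])
  show ?thesis
    using W(1,3) conv Hsp_element.bcont_H_measurable[OF WE] by blast
qed

end
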